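(* Let $n\ge 1$ and let $P\subset\mathbb{R}^2$ be a convex $(n+3)$-gon with no two vertices on the same vertical line. The vertex barycenters of the associahedron $\mathsf{Asso}(P)$ and of the permutahedron $\mathsf{Perm}(n)$ coincide.
   Context: The vertex barycenter of a polytope is the average (with equal weights) of its vertices. The permutahedron $\mathsf{Perm}(n)\subset\mathbb{R}^{n+1}$ is the convex hull of the points $(\sigma(1),\dots,\sigma(n+1))$ for all permutations $\sigma$ of $[n+1]=\{1,\dots,n+1\}$. Vertices of $P$: label the vertices of $P$ by $0,1,\dots,n+2$ in order of increasing $x$-coordinate. Let $U\subseteq[n+1]$ (up labels) and $D\subseteq[n+1]$ (down labels) be the sets of labels of the vertices among $1,\dots,n+1$ lying on the upper hull and on the lower hull of $P$, respectively (so $[n+1]=U\sqcup D$). A triangulation of $P$ is a maximal set of pairwise non-crossing internal diagonals of $P$. Spine: the spine $T^*$ of a triangulation $T$ is its dual tree, oriented and labeled as follows. It has an internal node $j^*$ for each triangle with vertices $i<j<k$ of $T$ (this gives exactly one node for each $j\in[n+1]$); an arc $\delta^*$ for each internal diagonal $\delta\in T$, oriented from the triangle below $\delta$ to the triangle above $\delta$; and an outgoing (resp. incoming) blossom (pendant half-edge) $\delta^*$ for each top (resp. bottom) boundary edge $\delta$ of $P$, attached to the node of the triangle containing $\delta$. Up nodes (labels in $U$) have indegree one and outdegree two, down nodes (labels in $D$) have indegree two and outdegree one, blossoms being counted. The point $\mathbf{x}(T)\in\mathbb{R}^{n+1}$: let $\Pi$ be the set of undirected paths in $T^*$ connecting two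 distinct blossoms. For $j\in[n+1]$, let $\mathsf{R}(j)\subseteq\Pi$ be the set of such paths that pass through $j^*$ using its two incoming arcs if $j\in D$, or its two outgoing arcs if $j\in U$ (arcs here include blossoms). Then $x_j(T)=|\mathsf{R}(j)|$ if $j\in D$ and $x_j(T)=n+2-|\mathsf{R}(j)|$ if $j\in U$. The associahedron $\mathsf{Asso}(P)$ is the convex hull of the points $\mathbf{x}(T)$ for all triangulations $T$ of $P$; the points $\mathbf{x}(T)$ are pairwise distinct and are exactly its vertices. *)

theory Defs
  imports "HOL-Analysis.Analysis" "HOL-Combinatorics.Permutations"
begin

definition vertices :: "'a::real_vector set \<Rightarrow> 'a set" where
  "vertices S = {v. v extreme_point_of S}"

definition vertex_barycenter :: "'a::real_vector set \<Rightarrow> 'a" where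
  "vertex_barycenter S = (1 / real (card (vertices S))) *\<^sub>R (\<Sum>v\<in>vertices S. v)"

text \<open>
  The space of real vectors with n + 1 coordinates is modelled by the type \<open>real ^ 'n\<close> together
  with a bijection \<open>lab\<close> from the index type onto the label set \<open>{1..n+1}\<close>:
  the coordinate with label \<open>lab i\<close> is the component at index \<open>i\<close>.
\<close>

definition point :: "('n::finite \<Rightarrow> nat) \<Rightarrow> (nat \<Rightarrow> real) \<Rightarrow> real ^ 'n" where
  "point lab x = (\<chi> i. x (lab i))"

definition permutahedron :: "nat \<Rightarrow> ('n::finite \<Rightarrow> nat) \<Rightarrow> (real ^ 'n) set" where
  "permutahedron n lab =
     convex hull {point lab (\<lambda>j. real (\<sigma> j)) | \<sigma>. \<sigma> permutes {1..n+1}}"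


section \<open>The polygon and its triangulations\<close>

text \<open>The first coordinate \<open>v $ 1\<close> is horizontal, the second one \<open>v $ 2\<close> is vertical.\<close>

definition vtx :: "(real ^ 2) set \<Rightarrow> nat \<Rightarrow> real ^ 2" where
  "vtx P k = (THE v. v \<in> vertices P \<and> card {w \<in> vertices P. w $ 1 < v $ 1} = k)"

definition upper_hull :: "(real ^ 2) set \<Rightarrow> (real ^ 2) set" where
  "upper_hull P = {p \<in> P. \<forall>q\<in>P. q $ 1 = p $ 1 \<longrightarrow> q $ 2 \<le> p $ 2}"

definition lower_hull :: "(real ^ 2) set \<Rightarrow> (real ^ 2) set" where
  "lower_hull P = {p \<in> P. \<forall>q\<in>P. q $ 1 = p $ 1 \<longrightarrow> p $ 2 \<le> q $ 2}"

definition up_labels :: "nat \<Rightarrow> (real ^ 2) set \<Rightarrow> nat set" where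
  "up_labels n P = {j \<in> {1..n+1}. vtx P j \<in> upper_hull P}"

definition down_labels :: "nat \<Rightarrow> (real ^ 2) set \<Rightarrow> nat set" where
  "down_labels n P = {j \<in> {1..n+1}. vtx P j \<in> lower_hull P}"

text \<open>A segment joining two vertices is encoded by the pair \<open>(i, j)\<close> of their labels, \<open>i < j\<close>.\<close>

type_synonym chord = "nat \<times> nat"

fun closed_chord :: "(real ^ 2) set \<Rightarrow> chord \<Rightarrow> (real ^ 2) set" where
  "closed_chord P (i, j) = closed_segment (vtx P i) (vtx P j)"

fun open_chord :: "(real ^ 2) set \<Rightarrow> chord \<Rightarrow> (real ^ 2) set" where
  "open_chord P (i, j) = open_segment (vtx P i) (vtx P j)"

definition chords :: "nat \<Rightarrow> chord set" where
  "chords n = {(i, j). i < j \<and> j \<le> n + 2}"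

definition top_edges :: "nat \<Rightarrow> (real ^ 2) set \<Rightarrow> chord set" where
  "top_edges n P =
     {\<delta> \<in> chords n. closed_chord P \<delta> edge_of P \<and> closed_chord P \<delta> \<subseteq> upper_hull P}"

definition bottom_edges :: "nat \<Rightarrow> (real ^ 2) set \<Rightarrow> chord set" where
  "bottom_edges n P =
     {\<delta> \<in> chords n. closed_chord P \<delta> edge_of P \<and> closed_chord P \<delta> \<subseteq> lower_hull P}"

definition internal_diagonals :: "nat \<Rightarrow> (real ^ 2) set \<Rightarrow> chord set" where
  "internal_diagonals n P = {\<delta> \<in> chords n. open_chord P \<delta> \<subseteq> interior P}"

definition noncrossing :: "(real ^ 2) set \<Rightarrow> chord set \<Rightarrow> bool" where
  "noncrossing P T \<longleftrightarrow> pairwise (\<lambda>\<delta> \<epsilon>. open_chord P \<delta> \<inter> open_chord P \<epsilon> = {}) T"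

definition triangulation :: "nat \<Rightarrow> (real ^ 2) set \<Rightarrow> chord set \<Rightarrow> bool" where
  "triangulation n P T \<longleftrightarrow>
     T \<subseteq> internal_diagonals n P \<and> noncrossing P T \<and>
     (\<forall>T'. T \<subseteq> T' \<and> T' \<subseteq> internal_diagonals n P \<and> noncrossing P T' \<longrightarrow> T' = T)"

type_synonym triangle = "nat \<times> nat \<times> nat"

fun sides :: "triangle \<Rightarrow> chord set" where
  "sides (i, j, k) = {(i, j), (j, k), (i, k)}"

fun corners :: "triangle \<Rightarrow> nat set" where
  "corners (i, j, k) = {i, j, k}"

text \<open>
  As the vertices of \<open>P\<close> are in convex position, the triangles of \<open>T\<close> are precisely the
  triples of vertices that are pairwise joined by a diagonal of \<open>T\<close> or a boundary edge.
\<close>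

definition triangles :: "nat \<Rightarrow> (real ^ 2) set \<Rightarrow> chord set \<Rightarrow> triangle set" where
  "triangles n P T =
     {(i, j, k). i < j \<and> j < k \<and> k \<le> n + 2 \<and>
                 sides (i, j, k) \<subseteq> T \<union> top_edges n P \<union> bottom_edges n P}"

text \<open>The height at abscissa \<open>x\<close> of the (non-vertical) line through \<open>a\<close> and \<open>b\<close>.\<close>

definition line_height :: "real ^ 2 \<Rightarrow> real ^ 2 \<Rightarrow> real \<Rightarrow> real" where
  "line_height a b x = a $ 2 + (b $ 2 - a $ 2) / (b $ 1 - a $ 1) * (x - a $ 1)"

fun lies_below :: "(real ^ 2) set \<Rightarrow> triangle \<Rightarrow> chord \<Rightarrow> bool" where
  "lies_below P t (a, b) \<longleftrightarrow>
     (\<forall>c\<in>corners t. vtx P c $ 2 \<le> line_height (vtx P a) (vtx P b) (vtx P c $ 1))"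

fun lies_above :: "(real ^ 2) set \<Rightarrow> triangle \<Rightarrow> chord \<Rightarrow> bool" where
  "lies_above P t (a, b) \<longleftrightarrow>
     (\<forall>c\<in>corners t. line_height (vtx P a) (vtx P b) (vtx P c $ 1) \<le> vtx P c $ 2)"


section \<open>Spines\<close>

text \<open>
  Directed graphs with blossoms (pendant half-edges) and labeled nodes. The sets \<open>incoming G v\<close>
  and \<open>outgoing G v\<close> contain both the arcs and the blossoms directed to, resp. from, \<open>v\<close>.
\<close>

record ('v, 'e) blossoming_graph =
  nodes :: "'v set"
  node_label :: "'v \<Rightarrow> nat"
  arcs :: "'e set"
  blossoms :: "'e set"
  incoming :: "'v \<Rightarrow> 'e set"
  outgoing :: "'v \<Rightarrow> 'e set"

definition spine :: "nat \<Rightarrow> (real ^ 2) set \<Rightarrow> chord set \<Rightarrow> (triangle, chord) blossoming_graph" where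
  "spine n P T =
     \<lparr> nodes = triangles n P T,
       node_label = (\<lambda>(i, j, k). j),
       arcs = T,
       blossoms = top_edges n P \<union> bottom_edges n P,
       incoming = (\<lambda>t. {\<delta> \<in> sides t. \<delta> \<in> T \<and> lies_above P t \<delta> \<or> \<delta> \<in> bottom_edges n P}),
       outgoing = (\<lambda>t. {\<delta> \<in> sides t. \<delta> \<in> T \<and> lies_below P t \<delta> \<or> \<delta> \<in> top_edges n P}) \<rparr>"

definition incident :: "('v, 'e) blossoming_graph \<Rightarrow> 'v \<Rightarrow> 'e set" where
  "incident G v = incoming G v \<union> outgoing G v"

text \<open>
  A simple path \<open>es ! 0, vs ! 0, es ! 1, vs ! 1, \<dots>\<close> which starts and ends with distinct blossoms
  and whose orientation need not agree with the orientation of the arcs.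
\<close>

definition blossom_path :: "('v, 'e) blossoming_graph \<Rightarrow> 'v list \<Rightarrow> 'e list \<Rightarrow> bool" where
  "blossom_path G vs es \<longleftrightarrow>
     length es = Suc (length vs) \<and> distinct vs \<and> distinct es \<and> set vs \<subseteq> nodes G \<and>
     hd es \<in> blossoms G \<and> last es \<in> blossoms G \<and> hd es \<noteq> last es \<and>
     (\<forall>i. 0 < i \<and> i < length vs \<longrightarrow> es ! i \<in> arcs G) \<and>
     (\<forall>i < length vs. es ! i \<in> incident G (vs ! i) \<and> es ! Suc i \<in> incident G (vs ! i))"

text \<open>
  Undirected paths are represented by their node and edge sets, so that a path is
  identified with its reversal.
\<close>

definition blossom_paths :: "('v, 'e) blossoming_graph \<Rightarrow> ('v set \<times> 'e set) set" where
  "blossom_paths G = {(set vs, set es) | vs es. blossom_path G vs es}"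

definition R_paths ::
    "nat \<Rightarrow> (real ^ 2) set \<Rightarrow> chord set \<Rightarrow> nat \<Rightarrow> (triangle set \<times> chord set) set" where
  "R_paths n P T j =
     (let G = spine n P T in
      {(V, E) \<in> blossom_paths G. \<exists>v\<in>V. node_label G v = j \<and>
         (j \<in> down_labels n P \<and> incoming G v \<subseteq> E \<or> j \<in> up_labels n P \<and> outgoing G v \<subseteq> E)})"

definition spine_coord :: "nat \<Rightarrow> (real ^ 2) set \<Rightarrow> chord set \<Rightarrow> nat \<Rightarrow> real" where
  "spine_coord n P T j =
     (if j \<in> down_labels n P then real (card (R_paths n P T j))
      else real n + 2 - real (card (R_paths n P T j)))"

definition associahedron ::
    "nat \<Rightarrow> (real ^ 2) set \<Rightarrow> ('n::finite \<Rightarrow> nat) \<Rightarrow> (real ^ 'n) set" where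
  "associahedron n P lab = convex hull {point lab (spine_coord n P T) | T. triangulation n P T}"

end

theory Submission
  imports Defs
begin

text \<open>
  Number the vertices of \<open>P\<close> counterclockwise by positions \<open>0, \<dots>, n + 2\<close>. A triangulation is then
  a binary tree with \<open>n + 2\<close> leaves: a node that covers the interval \<open>[p, q)\<close> and splits it at \<open>r\<close> is
  the triangle with corners \<open>p < r < q\<close>. In the spine, the paths counted by \<open>R(j)\<close> correspond to
  pairs of boundary edges, one beyond each of the two sides of the triangle with middle vertex \<open>j\<close>
  that meet at \<open>j\<close>. If these sides cut off \<open>a\<close> and \<open>b\<close> boundary edges, then \<open>x\<^sub>j\<close> is \<open>a b\<close> for down
  vertices and \<open>n + 2 - a b\<close> for up vertices.

  The points \<open>x(T)\<close> are distinct and extreme. A flip changes \<open>x(T)\<close> by a positive multiple of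
  \<open>e\<^sub>i - e\<^sub>j\<close>, where \<open>i\<close> and \<open>j\<close> are the labels of the two triangles involved. Let \<open>\<delta>\<close> be a chord
  and let \<open>B\<close> be the set of labels of the nodes that lie below \<open>\<delta>\<close> in a triangulation containing \<open>\<delta>\<close>.
  If the sum of \<open>x\<^sub>j\<close> over \<open>B\<close> is minimal at \<open>T\<close>, then no flip decreases it, so \<open>B\<close> is a down-set of
  the spine; following the triangles crossed by \<open>\<delta>\<close> from one endpoint to the other shows that this
  is impossible unless \<open>\<delta>\<close> belongs to \<open>T\<close>. Hence the sum of these functionals over the chords of
  \<open>T\<close> is minimised by \<open>T\<close> alone.

  For the barycenter, fix \<open>j\<close>. The triangles with middle vertex \<open>j\<close> are indexed by the distances
  \<open>a \<le> s\<close> and \<open>b \<le> r\<close> along the boundary to their other corners, where \<open>s\<close> and \<open>r\<close> are the numbers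
  of vertices on the two sides of \<open>j\<close> and \<open>s + r = n + 2\<close>. A triangle lies in
  \<open>c\<^sub>a c\<^sub>b c\<^sub>k\<close> triangulations with \<open>k = n + 3 - a - b\<close> and shifted Catalan numbers \<open>c\<close>. The sum of
  \<open>a b c\<^sub>a c\<^sub>b c\<^sub>k\<close> does not depend on how \<open>n + 2\<close> is split into \<open>s + r\<close>, and for \<open>s = 1\<close> the symmetry
  \<open>b \<mapsto> n + 2 - b\<close> evaluates it to \<open>(n + 2) / 2\<close> times the number of triangulations. All coordinates of
  the barycenter are therefore \<open>(n + 2) / 2\<close>, as they are for the permutahedron by the symmetry
  \<open>x\<^sub>i \<mapsto> n + 2 - x\<^sub>i\<close>.
\<close>

section \<open>Binary trees and triangulations of a labelled polygon\<close>

text \<open>Everything combinatorial happens on positions: a chord is a pair \<open>(p, q)\<close>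
  with \<open>p < q\<close>, read as the arc of the boundary edges \<open>p\<close>, ...,
  \<open>q - 1\<close>, and crossing becomes interleaving of pairs. Convexity survives only as a
  property of the sequence of labels along the boundary: it has no valley, since labels rise along
  the lower hull and fall along the upper hull. The obstacle is that
  \<open>vertex_barycenter\<close> averages over a set of extreme points. It becomes an average over
  triangulations only when no point \<open>x(T)\<close> is lost as non-extreme and no two coincide;
  both follow from one strictly minimising functional per triangulation. A second difficulty is that
  the definitions sort a triangle by labels whereas the trees sort it by positions. The median of
  the three labels mediates between the two, and a case distinction on which of the three positions
  carries it recurs throughout.\<close>

datatype btree = Tip | Branch btree btree

fun leaves :: "btree \<Rightarrow> nat" where
  "leaves Tip = 1"
| "leaves (Branch a b) = leaves a + leaves b"

text \<open>Leaves are the boundary edges from \<open>x\<close> to \<open>x + 1\<close>, inner nodes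
  are chords, and the root interval is the closing edge of the polygon. Boundary edges are included
  so that a triangle can be recognised by its three sides.\<close>

fun ivals :: "nat \<Rightarrow> btree \<Rightarrow> (nat \<times> nat) set" where
  "ivals p Tip = {(p, p + 1)}"
| "ivals p (Branch a b) =
     insert (p, p + leaves a + leaves b) (ivals p a \<union> ivals (p + leaves a) b)"

fun tris :: "nat \<Rightarrow> btree \<Rightarrow> (nat \<times> nat \<times> nat) set" where
  "tris p Tip = {}"
| "tris p (Branch a b) =
     insert (p, p + leaves a, p + leaves a + leaves b) (tris p a \<union> tris (p + leaves a) b)"

lemma leaves_pos [simp]: "0 < leaves t" "Suc 0 \<le> leaves t" "leaves t \<noteq> 0"
  by (induction t) auto

lemma finite_ivals [simp]: "finite (ivals p t)"
  by (induction p t rule: ivals.induct) auto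

lemma finite_tris [simp]: "finite (tris p t)"
  by (induction p t rule: tris.induct) auto

lemma ivals_bounds: "(x, y) \<in> ivals p t \<Longrightarrow> p \<le> x \<and> x < y \<and> y \<le> p + leaves t"
  by (induction p t rule: ivals.induct) (auto simp: trans_le_add1)

lemma tris_bounds: "(x, r, y) \<in> tris p t \<Longrightarrow> p \<le> x \<and> x < r \<and> r < y \<and> y \<le> p + leaves t"
  by (induction p t rule: tris.induct) (auto simp: trans_le_add1)

lemma ivals_root: "(p, p + leaves t) \<in> ivals p t"
  by (cases t) (auto simp: add.assoc)

lemma ivals_unit: "p \<le> x \<Longrightarrow> x < p + leaves t \<Longrightarrow> (x, Suc x) \<in> ivals p t"
proof (induction p t rule: ivals.induct)
  case (2 p a b)
  then show ?case by (cases "x < p + leaves a") auto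
qed auto

text \<open>Only one of the two orders in which chords cross; geometric crossing is the symmetric
  closure.\<close>

definition interleaved :: "nat \<times> nat \<Rightarrow> nat \<times> nat \<Rightarrow> bool" where
  "interleaved d e \<longleftrightarrow> fst d < fst e \<and> fst e < snd d \<and> snd d < snd e"

lemma ivals_not_interleaved:
  "(x, y) \<in> ivals p t \<Longrightarrow> (u, v) \<in> ivals p t \<Longrightarrow> \<not> interleaved (x, y) (u, v)"
proof (induction p t rule: ivals.induct)
  case (2 p a b)
  have *: "d = (p, p + leaves a + leaves b) \<or> d \<in> ivals p a \<or> d \<in> ivals (p + leaves a) b"
    if "d \<in> ivals p (Branch a b)" for d
    using that by auto
  note bnd = ivals_bounds[of x y p a] ivals_bounds[of x y "p + leaves a" b]
    ivals_bounds[of u v p a] ivals_bounds[of u v "p + leaves a" b]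
  show ?case
    using *[OF "2.prems"(1)] *[OF "2.prems"(2)]
  proof (elim disjE)
    assume "(x, y) \<in> ivals p a" "(u, v) \<in> ivals p a"
    then show ?thesis by (rule "2.IH"(1))
  next
    assume "(x, y) \<in> ivals (p + leaves a) b" "(u, v) \<in> ivals (p + leaves a) b"
    then show ?thesis by (rule "2.IH"(2))
  qed (use bnd in \<open>auto simp: interleaved_def\<close>)
qed (auto simp: interleaved_def)

text \<open>An interval with the root split strictly inside is the root interval, or else it
  interleaves with the left or the right child of the root. Every other interval falls into one
  child.\<close>

lemma ivals_maximal:
  assumes "p \<le> x" "x < y" "y \<le> p + leaves t"
    and "\<And>u v. (u, v) \<in> ivals p t \<Longrightarrow> \<not> interleaved (x, y) (u, v) \<and> \<not> interleaved (u, v) (x, y)"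
  shows "(x, y) \<in> ivals p t"
  using assms
proof (induction p t rule: ivals.induct)
  case (1 p)
  then show ?case by auto
next
  case (2 p a b)
  let ?r = "p + leaves a"
  have l: "(p, ?r) \<in> ivals p a" and r: "(?r, ?r + leaves b) \<in> ivals ?r b"
    by (rule ivals_root)+
  show ?case
  proof (cases "y \<le> ?r \<or> ?r \<le> x")
    case True
    then show ?thesis using 2 by (auto simp: add.assoc)
  next
    case False
    have "\<not> interleaved (p, ?r) (x, y)" "\<not> interleaved (x, y) (?r, ?r + leaves b)"
      using "2.prems"(4) l r by auto
    with False "2.prems"(1-3) have "x = p" "y = ?r + leaves b"
      by (auto simp: interleaved_def)
    then show ?thesis by simp
  qed
qed

text \<open>If the base is the root interval, an apex other than the root split makes a side
  interleave with a child of the root; otherwise the base, and with it both sides, lies in one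
  subtree. As \<open>triangles\<close> is defined by sides, this equivalence matches it with the
  nodes of the tree.\<close>

lemma tris_ivals:
  "(x, r, y) \<in> tris p t \<longleftrightarrow> x < r \<and> r < y \<and> {(x, r), (r, y), (x, y)} \<subseteq> ivals p t"
proof (induction p t rule: ivals.induct)
  case (1 p)
  then show ?case by auto
next
  case (2 p a b)
  let ?r = "p + leaves a" and ?q = "p + leaves a + leaves b"
  have l: "(p, ?r) \<in> ivals p a" and r: "(?r, ?q) \<in> ivals ?r b"
    by (rule ivals_root)+
  show ?case (is "?L \<longleftrightarrow> ?R")
  proof
    assume ?L
    then show ?R using 2 l r leaves_pos[of a] leaves_pos[of b] by auto
  next
    assume R: ?R
    show ?L
    proof (cases "(x, y) = (p, ?q)")
      case True
      have "\<not> interleaved (x, r) (?r, ?q)" "\<not> interleaved (p, ?r) (r, y)"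
        using R l r ivals_not_interleaved[of _ _ p "Branch a b"] by auto
      then have "r = ?r" using R True by (auto simp: interleaved_def)
      then show ?thesis using True by simp
    next
      case False
      then have "(x, y) \<in> ivals p a \<or> (x, y) \<in> ivals ?r b" using R by auto
      then have "{(x, r), (r, y), (x, y)} \<subseteq> ivals p a \<or> {(x, r), (r, y), (x, y)} \<subseteq> ivals ?r b"
      proof
        assume "(x, y) \<in> ivals p a"
        moreover have "(x, r) \<notin> ivals ?r b" "(r, y) \<notin> ivals ?r b"
          using R ivals_bounds[OF \<open>(x, y) \<in> ivals p a\<close>] ivals_bounds[of x r ?r b] ivals_bounds[of r y ?r b] by auto
        ultimately show ?thesis using R ivals_bounds[OF \<open>(x, y) \<in> ivals p a\<close>] by auto
      next
        assume "(x, y) \<in> ivals ?r b"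
        moreover have "(x, r) \<notin> ivals p a" "(r, y) \<notin> ivals p a"
          using R ivals_bounds[OF \<open>(x, y) \<in> ivals ?r b\<close>] ivals_bounds[of x r p a] ivals_bounds[of r y p a] by auto
        ultimately show ?thesis using R ivals_bounds[OF \<open>(x, y) \<in> ivals ?r b\<close>] by auto
      qed
      then show ?thesis using 2 R by auto
    qed
  qed
qed

lemma ivals_split:
  assumes "(x, y) \<in> ivals p t" "Suc x < y"
  obtains r where "(x, r, y) \<in> tris p t"
proof -
  have "(x, y) \<in> ivals p t \<Longrightarrow> Suc x < y \<Longrightarrow> \<exists>r. (x, r, y) \<in> tris p t"
    by (induction p t rule: ivals.induct) auto
  then show thesis using assms that by auto
qed

lemma tris_apex_unique: "(x, r, y) \<in> tris p t \<Longrightarrow> (x, r', y) \<in> tris p t \<Longrightarrow> r = r'"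
  using ivals_not_interleaved[of x r p t r' y] ivals_not_interleaved[of x r' p t r y]
  by (auto simp: tris_ivals interleaved_def)

lemma ivals_parent:
  assumes "(x, y) \<in> ivals p t" "(x, y) \<noteq> (p, p + leaves t)"
  shows "(\<exists>z. (x, y, z) \<in> tris p t) \<or> (\<exists>z. (z, x, y) \<in> tris p t)"
  using assms
proof (induction p t rule: ivals.induct)
  case (2 p a b)
  then consider "(x, y) \<in> ivals p a" | "(x, y) \<in> ivals (p + leaves a) b" by (auto simp: add.assoc)
  then show ?case
  proof cases
    case 1
    then show ?thesis using 2 by (cases "(x, y) = (p, p + leaves a)") auto
  next
    case b: 2
    then show ?thesis using 2
      by (cases "(x, y) = (p + leaves a, p + leaves a + leaves b)") (auto simp: add.assoc)
  qed
qed auto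

text \<open>A chord has at most one triangle on its outer side: a second one would have a side that
  interleaves with a side of the first.\<close>

lemma ivals_parent_unique:
  shows "(x, y, z) \<in> tris p t \<Longrightarrow> (x, y, z') \<in> tris p t \<Longrightarrow> z = z'"
    and "(z, x, y) \<in> tris p t \<Longrightarrow> (z', x, y) \<in> tris p t \<Longrightarrow> z = z'"
    and "(x, y, z) \<in> tris p t \<Longrightarrow> (z', x, y) \<in> tris p t \<Longrightarrow> False"
proof -
  note ni = ivals_not_interleaved[of _ _ p t]
  show "(x, y, z) \<in> tris p t \<Longrightarrow> (x, y, z') \<in> tris p t \<Longrightarrow> z = z'"
    using ni[of x z y z'] ni[of x z' y z] by (auto simp: tris_ivals interleaved_def)
  show "(z, x, y) \<in> tris p t \<Longrightarrow> (z', x, y) \<in> tris p t \<Longrightarrow> z = z'"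
    using ni[of z x z' y] ni[of z' x z y] by (auto simp: tris_ivals interleaved_def)
  show "(x, y, z) \<in> tris p t \<Longrightarrow> (z', x, y) \<in> tris p t \<Longrightarrow> False"
    using ni[of z' y x z] by (auto simp: tris_ivals interleaved_def)
qed

lemma subtree_at:
  assumes "(x, y) \<in> ivals p t"
  obtains u where "x + leaves u = y" "tris x u \<subseteq> tris p t"
proof -
  have "(x, y) \<in> ivals p t \<Longrightarrow> \<exists>u. x + leaves u = y \<and> tris x u \<subseteq> tris p t"
  proof (induction p t rule: ivals.induct)
    case (2 p a b)
    then consider "(x, y) = (p, p + leaves (Branch a b))" | "(x, y) \<in> ivals p a" | "(x, y) \<in> ivals (p + leaves a) b"
      by (auto simp: add.assoc)
    then show ?case
    proof cases
      case 1
      then show ?thesis by (intro exI[of _ "Branch a b"]) auto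
    qed (use 2 in auto)
  qed (auto intro: exI[of _ Tip])
  then show thesis using assms that by auto
qed

lemma leaves_eq_1_iff [simp]: "leaves t = Suc 0 \<longleftrightarrow> t = Tip"
  using leaves_pos(1) by (cases t) (auto simp: add_is_1)

lemma ivals_Branch_restrict:
  "ivals p a = {(i, j) \<in> ivals p (Branch a b). j \<le> p + leaves a}"
  "ivals (p + leaves a) b = {(i, j) \<in> ivals p (Branch a b). p + leaves a \<le> i}"
  using leaves_pos(1)[of a] leaves_pos(1)[of b]
  by (auto simp del: leaves_pos dest: ivals_bounds)

text \<open>The root split is the unique apex over the whole interval, hence determined by the
  intervals; restricting them to either side of it recovers the subtrees.\<close>

lemma ivals_inj: "leaves t = leaves u \<Longrightarrow> ivals p t = ivals p u \<Longrightarrow> t = u"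
proof (induction t arbitrary: u p)
  case Tip
  then show ?case using leaves_eq_1_iff[of u] by auto
next
  case (Branch a b)
  have "u \<noteq> Tip"
    using Branch.prems(1) leaves_eq_1_iff[of "Branch a b"] by auto
  then obtain c d where u: "u = Branch c d"
    by (cases u) auto
  have "(p, p + leaves a, p + leaves a + leaves b) \<in> tris p (Branch a b)"
    by simp
  then have "(p, p + leaves a, p + leaves a + leaves b) \<in> tris p u"
    unfolding tris_ivals Branch.prems(2) .
  moreover have "(p, p + leaves c, p + leaves a + leaves b) \<in> tris p u"
    using Branch.prems(1) by (simp add: u add.assoc)
  ultimately have "p + leaves a = p + leaves c"
    by (rule tris_apex_unique)
  then have ac: "leaves a = leaves c" by simp
  then have bd: "leaves b = leaves d" using Branch.prems(1) u by simp
  have "ivals p a = ivals p c"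
    using ivals_Branch_restrict(1)[of p a b] ivals_Branch_restrict(1)[of p c d] Branch.prems(2) ac
    by (simp only: u)
  moreover have "ivals (p + leaves a) b = ivals (p + leaves a) d"
    using ivals_Branch_restrict(2)[of p a b] ivals_Branch_restrict(2)[of p c d] Branch.prems(2) ac
    by (simp only: u)
  ultimately show ?case
    using Branch.IH(1)[OF ac] Branch.IH(2)[OF bd] u by simp
qed

section \<open>Counting trees, and trees that contain a given triangle\<close>

definition trees :: "nat \<Rightarrow> btree set" where
  "trees m = {t. leaves t = m}"

lemma trees_0 [simp]: "trees 0 = {}"
  by (auto simp: trees_def)

lemma trees_1 [simp]: "trees (Suc 0) = {Tip}"
  by (auto simp: trees_def)

lemma trees_rec:
  assumes "m \<ge> 2"
  shows "trees m = (\<Union>s\<in>{1..<m}. (\<lambda>(a, b). Branch a b) ` (trees s \<times> trees (m - s)))"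
proof (intro set_eqI iffI)
  fix t assume t: "t \<in> trees m"
  then have "t \<noteq> Tip" using assms by (auto simp: trees_def)
  then obtain a b where ab: "t = Branch a b" by (cases t) auto
  then have "leaves a \<in> {1..<m}" "a \<in> trees (leaves a)" "b \<in> trees (m - leaves a)"
    using t leaves_pos(1)[of a] leaves_pos(1)[of b] by (auto simp: trees_def simp del: leaves_pos)
  then show "t \<in> (\<Union>s\<in>{1..<m}. (\<lambda>(a, b). Branch a b) ` (trees s \<times> trees (m - s)))"
    unfolding ab by blast
next
  fix t assume "t \<in> (\<Union>s\<in>{1..<m}. (\<lambda>(a, b). Branch a b) ` (trees s \<times> trees (m - s)))"
  then show "t \<in> trees m" by (auto simp: trees_def)
qed

lemma finite_trees [simp]: "finite (trees m)"
proof (induction m rule: less_induct)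
  case (less m)
  consider "m = 0" | "m = 1" | "m \<ge> 2" by linarith
  then show ?case
  proof cases
    case 3
    then show ?thesis unfolding trees_rec[OF 3]
      using less by (intro finite_UN_I finite_imageI finite_cartesian_product) auto
  qed auto
qed

lemma sum_trees:
  fixes F :: "btree \<Rightarrow> 'a::comm_monoid_add"
  assumes "m \<ge> 2"
  shows "(\<Sum>t\<in>trees m. F t) = (\<Sum>s\<in>{1..<m}. \<Sum>a\<in>trees s. \<Sum>b\<in>trees (m - s). F (Branch a b))"
proof -
  have "(\<Sum>t\<in>trees m. F t) =
      (\<Sum>s\<in>{1..<m}. sum F ((\<lambda>(a, b). Branch a b) ` (trees s \<times> trees (m - s))))"
    unfolding trees_rec[OF assms]
    by (rule sum.UNION_disjoint) (simp, simp, auto simp: trees_def)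
  also have "\<dots> = (\<Sum>s\<in>{1..<m}. \<Sum>a\<in>trees s. \<Sum>b\<in>trees (m - s). F (Branch a b))"
  proof (rule sum.cong[OF refl])
    fix s
    have "inj_on (\<lambda>(a, b). Branch a b) (trees s \<times> trees (m - s))"
      by (auto simp: inj_on_def)
    then show "sum F ((\<lambda>(a, b). Branch a b) ` (trees s \<times> trees (m - s))) =
        (\<Sum>a\<in>trees s. \<Sum>b\<in>trees (m - s). F (Branch a b))"
      by (simp add: sum.reindex sum.cartesian_product case_prod_unfold o_def)
  qed
  finally show ?thesis .
qed

text \<open>The Catalan number of index \<open>m - 1\<close>, and 0 for \<open>m = 0\<close>; with
  this shift the recursion is a plain convolution.\<close>

definition num_trees :: "nat \<Rightarrow> real" where
  "num_trees m = real (card (trees m))"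

lemma num_trees_1 [simp]: "num_trees (Suc 0) = 1"
  by (simp add: num_trees_def)

lemma num_trees_rec:
  assumes "m \<ge> 2"
  shows "num_trees m = (\<Sum>s\<in>{1..<m}. num_trees s * num_trees (m - s))"
  using sum_trees[OF assms, of "\<lambda>_. 1 :: real"] by (simp add: num_trees_def)

lemma num_trees_pos:
  assumes "m \<ge> 1"
  shows "num_trees m > 0"
proof -
  have "\<exists>t. leaves t = Suc k" for k
  proof (induction k)
    case (Suc k)
    then obtain t where "leaves t = Suc k" by auto
    then show ?case by (intro exI[of _ "Branch Tip t"]) auto
  qed (auto intro: exI[of _ Tip])
  then obtain t where "leaves t = m" using assms by (metis Suc_diff_1 less_eq_Suc_le One_nat_def)
  then have "trees m \<noteq> {}" by (auto simp: trees_def)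
  then show ?thesis by (simp add: num_trees_def card_gt_0_iff)
qed

text \<open>Removing the triangle leaves three smaller polygons; the outer one has the arc from
  \<open>x\<close> to \<open>y\<close> contracted to one edge, hence \<open>m + 1 - (y - x)\<close>
  leaves. The induction distinguishes whether the triangle is the root or lies in the left or the
  right subtree.\<close>

lemma num_trees_with_tri:
  assumes "p \<le> x" "x < r" "r < y" "y \<le> p + m"
  shows "(\<Sum>t\<in>trees m. of_bool ((x, r, y) \<in> tris p t)) =
    num_trees (r - x) * num_trees (y - r) * num_trees (m + 1 - (y - x))"
  using assms
proof (induction m arbitrary: p rule: less_induct)
  case (less m)
  let ?C = "num_trees (r - x) * num_trees (y - r)"
  have m2: "m \<ge> 2" using less.prems by linarith
  note S = sum_trees[OF m2, of "\<lambda>t. of_bool ((x, r, y) \<in> tris p t) :: real"]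
  show ?case
  proof (cases "x = p \<and> y = p + m")
    case True
    have "(\<Sum>a\<in>trees s. \<Sum>b\<in>trees (m - s). of_bool ((x, r, y) \<in> tris p (Branch a b)) :: real)
       = (if s = r - x then num_trees s * num_trees (m - s) else 0)" if "s \<in> {1..<m}" for s
    proof -
      have "(x, r, y) \<in> tris p (Branch a b) \<longleftrightarrow> s = r - x" if "a \<in> trees s" "b \<in> trees (m - s)" for a b
        using that \<open>s \<in> {1..<m}\<close> True less.prems tris_bounds[of x r y p a] tris_bounds[of x r y "p + s" b]
        by (auto simp: trees_def)
      then have "(\<Sum>a\<in>trees s. \<Sum>b\<in>trees (m - s). of_bool ((x, r, y) \<in> tris p (Branch a b)) :: real)
        = (\<Sum>a\<in>trees s. \<Sum>b\<in>trees (m - s). of_bool (s = r - x))"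
        by (intro sum.cong refl) simp
      then show ?thesis by (auto simp: num_trees_def)
    qed
    then have "(\<Sum>t\<in>trees m. of_bool ((x, r, y) \<in> tris p t) :: real)
      = (\<Sum>s\<in>{1..<m}. (if s = r - x then num_trees s * num_trees (m - s) else 0))"
      unfolding S by (intro sum.cong refl) auto
    also have "\<dots> = num_trees (r - x) * num_trees (m - (r - x))"
      using True less.prems by (subst sum.delta) auto
    finally show ?thesis using True less.prems by (simp add: add.commute)
  next
    case False
    let ?d = "y - x"
    let ?K = "m + 1 - ?d"
    have d: "?d \<ge> 2" "?d < m" "?K \<ge> 2" using less.prems False by linarith+
    have "(\<Sum>a\<in>trees s. \<Sum>b\<in>trees (m - s). of_bool ((x, r, y) \<in> tris p (Branch a b)) :: real)
       = (if s \<ge> y - p then ?C * (num_trees (s + 1 - ?d) * num_trees (m - s)) else 0)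
         + (if s \<le> x - p then ?C * (num_trees s * num_trees (?K - s)) else 0)" if "s \<in> {1..<m}" for s
    proof -
      have e: "of_bool ((x, r, y) \<in> tris p (Branch a b)) =
         (of_bool ((x, r, y) \<in> tris p a) + of_bool ((x, r, y) \<in> tris (p + s) b) :: real)"
        if "a \<in> trees s" "b \<in> trees (m - s)" for a b
        using that \<open>s \<in> {1..<m}\<close> False less.prems tris_bounds[of x r y p a] tris_bounds[of x r y "p + s" b]
        by (auto simp: trees_def)
      have "(\<Sum>a\<in>trees s. \<Sum>b\<in>trees (m - s). of_bool ((x, r, y) \<in> tris p (Branch a b)) :: real)
        = (\<Sum>a\<in>trees s. \<Sum>b\<in>trees (m - s). of_bool ((x, r, y) \<in> tris p a) + of_bool ((x, r, y) \<in> tris (p + s) b))"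
        by (intro sum.cong refl e)
      also have "\<dots> = num_trees (m - s) * (\<Sum>a\<in>trees s. of_bool ((x, r, y) \<in> tris p a))
         + num_trees s * (\<Sum>b\<in>trees (m - s). of_bool ((x, r, y) \<in> tris (p + s) b))"
        by (simp add: sum.distrib num_trees_def sum_distrib_left)
      also have "(\<Sum>a\<in>trees s. of_bool ((x, r, y) \<in> tris p a)) =
          (if s \<ge> y - p then ?C * num_trees (s + 1 - ?d) else 0)"
      proof (cases "s \<ge> y - p")
        case True
        then show ?thesis using less.IH[of s p] less.prems \<open>s \<in> {1..<m}\<close> by simp
      next
        case False
        then have "(x, r, y) \<notin> tris p a" if "a \<in> trees s" for a
          using that tris_bounds[of x r y p a] by (auto simp: trees_def)
        then show ?thesis using False by simp
      qed
      also have "(\<Sum>b\<in>trees (m - s). of_bool ((x, r, y) \<in> tris (p + s) b)) =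
          (if s \<le> x - p then ?C * num_trees (?K - s) else 0)"
      proof (cases "s \<le> x - p")
        case True
        have "m - s + 1 - ?d = ?K - s" using d True less.prems by linarith
        then show ?thesis using less.IH[of "m - s" "p + s"] less.prems \<open>s \<in> {1..<m}\<close> True by simp
      next
        case False
        then have "(x, r, y) \<notin> tris (p + s) b" if "b \<in> trees (m - s)" for b
          using that tris_bounds[of x r y "p + s" b] by (auto simp: trees_def)
        then show ?thesis using False by simp
      qed
      finally show ?thesis by (simp add: algebra_simps)
    qed
    then have "(\<Sum>t\<in>trees m. of_bool ((x, r, y) \<in> tris p t) :: real) =
       (\<Sum>s\<in>{1..<m}. (if s \<ge> y - p then ?C * (num_trees (s + 1 - ?d) * num_trees (m - s)) else 0)
         + (if s \<le> x - p then ?C * (num_trees s * num_trees (?K - s)) else 0))"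
      unfolding S by (intro sum.cong refl) auto
    also have "\<dots> = (\<Sum>s\<in>{y - p..<m}. ?C * (num_trees (s + 1 - ?d) * num_trees (m - s)))
        + (\<Sum>s\<in>{1..<x - p + 1}. ?C * (num_trees s * num_trees (?K - s)))"
    proof -
      have "{s \<in> {1..<m}. s \<ge> y - p} = {y - p..<m}" "{s \<in> {1..<m}. s \<le> x - p} = {1..<x - p + 1}"
        using less.prems by auto
      then show ?thesis by (simp add: sum.distrib flip: sum.inter_filter)
    qed
    \<comment> \<open>Contracting the arc turns a left subtree of size \<open>s\<close> into one of
      size \<open>s + 1 - ?d\<close>. After this shift the two ranges of left sizes join to
      \<open>{1..<?K}\<close>, the Catalan recursion for the contracted polygon.\<close>
    also have "(\<Sum>s\<in>{y - p..<m}. ?C * (num_trees (s + 1 - ?d) * num_trees (m - s)))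
       = (\<Sum>s\<in>{x - p + 1..<?K}. ?C * (num_trees s * num_trees (?K - s)))"
      by (rule sum.reindex_bij_witness[of _ "\<lambda>s. s + ?d - 1" "\<lambda>s. s + 1 - ?d"])
         (use less.prems d in auto)
    also have "\<dots> + (\<Sum>s\<in>{1..<x - p + 1}. ?C * (num_trees s * num_trees (?K - s)))
      = (\<Sum>s\<in>{1..<?K}. ?C * (num_trees s * num_trees (?K - s)))"
      using sum.atLeastLessThan_concat[of 1 "x - p + 1" ?K "\<lambda>s. ?C * (num_trees s * num_trees (?K - s))"]
        less.prems by (simp add: add.commute)
    also have "\<dots> = ?C * num_trees ?K"
      using num_trees_rec[OF d(3)] by (simp add: sum_distrib_left)
    finally show ?thesis .
  qed
qed

text \<open>Averaging with the reflection \<open>b \<mapsto> r + 1 - b\<close> replaces the weight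
  \<open>b\<close> by \<open>(r + 1) / 2\<close>, and the Catalan recursion remains.\<close>

lemma num_trees_half:
  assumes "r \<ge> 1"
  shows "(\<Sum>b=1..r. real b * num_trees b * num_trees (r + 1 - b)) = (real r + 1) / 2 * num_trees (r + 1)"
    (is "?S = _")
proof -
  have "?S = (\<Sum>b=1..r. real (r + 1 - b) * num_trees b * num_trees (r + 1 - b))"
    by (rule sum.reindex_bij_witness[of _ "\<lambda>b. r + 1 - b" "\<lambda>b. r + 1 - b"]) auto
  then have "2 * ?S = (\<Sum>b=1..r. real b * num_trees b * num_trees (r + 1 - b)
      + real (r + 1 - b) * num_trees b * num_trees (r + 1 - b))"
    by (simp add: sum.distrib)
  also have "\<dots> = (\<Sum>b=1..r. (real r + 1) * (num_trees b * num_trees (r + 1 - b)))"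
    by (intro sum.cong refl) (auto simp: of_nat_diff algebra_simps)
  also have "\<dots> = (real r + 1) * num_trees (r + 1)"
    using num_trees_rec[of "r + 1"] assms
    by (simp add: sum_distrib_left atLeastLessThanSuc_atLeastAtMost)
  finally show ?thesis by simp
qed

text \<open>
  The sum is unchanged when \<open>(s + 1, r)\<close> is replaced by \<open>(s, r + 1)\<close>: by the previous lemma both
  replacements alter the sum over \<open>{1..s} \<times> {1..r}\<close> by the same amount.
\<close>

lemma num_trees_weighted_sum:
  assumes "s \<ge> 1" "r \<ge> 1"
  shows "(\<Sum>a=1..s. \<Sum>b=1..r. real a * real b * num_trees a * num_trees b * num_trees (s + r + 1 - a - b))
    = real (s + r) / 2 * num_trees (s + r)"
  using assms
proof (induction s arbitrary: r rule: nat_induct_at_least)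
  case base
  have "(\<Sum>b=1..r. real b * num_trees b * num_trees (Suc r - b)) = (real r + 1) / 2 * num_trees (Suc r)"
    using num_trees_half[of r] base by simp
  then show ?case by (simp add: add.commute)
next
  case (Suc s)
  let ?f = "\<lambda>n a b. real a * real b * num_trees a * num_trees b * num_trees (n - a - b)"
  \<comment> \<open>Freezing \<open>b = k + 1\<close> makes the third index
    \<open>m + 1 - a\<close>, so \<open>num_trees_half\<close> applies. The result is symmetric in
    \<open>m\<close> and \<open>k\<close>, which is why the extra row can be traded for the extra
    column.\<close>
  have *: "(\<Sum>a=1..m. ?f (m + k + 2) a (k + 1)) =
      (real k + 1) * num_trees (k + 1) * ((real m + 1) / 2 * num_trees (m + 1))" if "m \<ge> 1" for m k
    unfolding num_trees_half[OF that, symmetric] sum_distrib_left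
    by (intro sum.cong refl) (auto simp: algebra_simps Suc_diff_le)
  have "(\<Sum>a=1..Suc s. \<Sum>b=1..r. ?f (Suc s + r + 1) a b) =
    (\<Sum>a=1..s. \<Sum>b=1..r. ?f (s + r + 2) a b) + (\<Sum>b=1..r. ?f (r + s + 2) b (s + 1))"
    by (simp add: ac_simps diff_commute)
  also have "(\<Sum>b=1..r. ?f (r + s + 2) b (s + 1)) = (\<Sum>a=1..s. ?f (s + r + 2) a (r + 1))"
    unfolding *[OF Suc.prems] *[OF Suc.hyps] by simp
  also have "(\<Sum>a=1..s. \<Sum>b=1..r. ?f (s + r + 2) a b) + \<dots> = (\<Sum>a=1..s. \<Sum>b=1..Suc r. ?f (s + Suc r + 1) a b)"
    by (simp add: sum.distrib ac_simps)
  also have "\<dots> = real (s + Suc r) / 2 * num_trees (s + Suc r)"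
    by (rule Suc.IH) simp
  finally show ?case by simp
qed

section \<open>Maximal families of pairwise non-interleaved chords are trees\<close>

definition diagonals :: "nat \<Rightarrow> (nat \<times> nat) set" where
  "diagonals m = {(p, q). p + 1 < q \<and> q \<le> m \<and> (p, q) \<noteq> (0, m)}"

definition laminar :: "(nat \<times> nat) set \<Rightarrow> bool" where
  "laminar C \<longleftrightarrow> (\<forall>d\<in>C. \<forall>e\<in>C. \<not> interleaved d e)"

definition maximal_laminar :: "nat \<Rightarrow> (nat \<times> nat) set \<Rightarrow> bool" where
  "maximal_laminar m C \<longleftrightarrow> C \<subseteq> diagonals m \<and> laminar C \<and>
     (\<forall>C'. C \<subseteq> C' \<and> C' \<subseteq> diagonals m \<and> laminar C' \<longrightarrow> C' = C)"

lemma ivals_eq_diagonals: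
  "ivals 0 t = (ivals 0 t \<inter> diagonals (leaves t)) \<union> {(p, Suc p) | p. p < leaves t} \<union> {(0, leaves t)}"
proof -
  have "(x, y) \<in> diagonals (leaves t) \<or> (\<exists>p<leaves t. (x, y) = (p, Suc p)) \<or> (x, y) = (0, leaves t)"
    if "(x, y) \<in> ivals 0 t" for x y
    using ivals_bounds[OF that] by (auto simp: diagonals_def)
  then show ?thesis using ivals_unit[of 0 _ t] ivals_root[of 0 t] by auto
qed

lemma maximal_laminar_tree: "maximal_laminar (leaves t) (ivals 0 t \<inter> diagonals (leaves t))"
  unfolding maximal_laminar_def
proof (intro conjI allI impI)
  show "laminar (ivals 0 t \<inter> diagonals (leaves t))"
    using ivals_not_interleaved[of _ _ 0 t] by (auto simp: laminar_def)
  fix C assume C: "ivals 0 t \<inter> diagonals (leaves t) \<subseteq> C \<and> C \<subseteq> diagonals (leaves t) \<and> laminar C"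
  have "(x, y) \<in> ivals 0 t" if "(x, y) \<in> C" for x y
  proof (rule ivals_maximal)
    show "0 \<le> x" "x < y" "y \<le> 0 + leaves t" using that C by (auto simp: diagonals_def)
    fix u v assume uv: "(u, v) \<in> ivals 0 t"
    show "\<not> interleaved (x, y) (u, v) \<and> \<not> interleaved (u, v) (x, y)"
    proof (cases "(u, v) \<in> diagonals (leaves t)")
      case True
      then show ?thesis using uv that C unfolding laminar_def by blast
    next
      case False
      then show ?thesis using uv \<open>y \<le> 0 + leaves t\<close> ivals_bounds[OF uv]
        by (auto simp: interleaved_def diagonals_def)
    qed
  qed
  then show "C = ivals 0 t \<inter> diagonals (leaves t)" using C by auto
qed simp

text \<open>With the boundary edges and the closing edge added, every interval of length at least 2
  must split: the complement of its longest proper prefix in the family crosses nothing, so it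
  belongs to the family by maximality. Splitting recursively builds the tree.\<close>

lemma maximal_laminar_imp_tree:
  assumes "maximal_laminar m C" "m \<ge> 1"
  obtains t where "leaves t = m" "C = ivals 0 t \<inter> diagonals m"
proof -
  define E where "E = C \<union> {(p, Suc p) | p. p < m} \<union> {(0, m)}"
  have Cd: "C \<subseteq> diagonals m" and Cl: "laminar C"
    using assms by (auto simp: maximal_laminar_def)
  have E_le: "x < y \<and> y \<le> m" if "(x, y) \<in> E" for x y
    using that Cd assms(2) by (auto simp: E_def diagonals_def)
  have El: "\<not> interleaved d e" if "d \<in> E" "e \<in> E" for d e
  proof (cases "d \<in> C \<and> e \<in> C")
    case False
    then show ?thesis using that E_le[of "fst d" "snd d"] E_le[of "fst e" "snd e"]
      by (auto simp: E_def interleaved_def)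
  qed (use Cl in \<open>auto simp: laminar_def\<close>)
  have Em: "(x, y) \<in> E" if "x < y" "y \<le> m"
    and "\<And>e. e \<in> E \<Longrightarrow> \<not> interleaved (x, y) e \<and> \<not> interleaved e (x, y)" for x y
  proof (rule ccontr)
    assume "(x, y) \<notin> E"
    then have "Suc x \<noteq> y" "(x, y) \<noteq> (0, m)" using that by (auto simp: E_def)
    then have "(x, y) \<in> diagonals m" using that by (auto simp: diagonals_def)
    moreover have "laminar (insert (x, y) C)"
      using Cl that(3) by (auto simp: laminar_def E_def interleaved_def)
    ultimately have "insert (x, y) C = C"
      using assms(1) unfolding maximal_laminar_def by blast
    then show False using \<open>(x, y) \<notin> E\<close> by (auto simp: E_def)
  qed
  have build: "\<exists>t. p + leaves t = q \<and> ivals p t \<subseteq> E" if "(p, q) \<in> E" for p q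
    using that
  proof (induction "q - p" arbitrary: p q rule: less_induct)
    case less
    show ?case
    proof (cases "q = Suc p")
      case True
      then show ?thesis using less.prems by (intro exI[of _ Tip]) auto
    next
      case False
      define R where "R = {r. p < r \<and> r < q \<and> (p, r) \<in> E}"
      have "Suc p \<in> R" using False E_le[OF less.prems] by (auto simp: R_def E_def)
      moreover have "finite R" by (rule finite_subset[of _ "{..q}"]) (auto simp: R_def)
      ultimately have r: "Max R \<in> R" "\<And>s. s \<in> R \<Longrightarrow> s \<le> Max R"
        by (auto intro: Max_in)
      let ?r = "Max R"
      have "p < ?r" "?r < q" "(p, ?r) \<in> E" using r by (auto simp: R_def)
      have "(?r, q) \<in> E"
      proof (rule Em)
        show "?r < q" "q \<le> m" using \<open>?r < q\<close> E_le[OF less.prems] by auto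
        fix e assume e: "e \<in> E"
        obtain x y where xy: "e = (x, y)" by (cases e)
        have "\<not> interleaved (?r, q) (x, y)"
          using El[OF less.prems e] \<open>p < ?r\<close> by (auto simp: interleaved_def xy)
        \<comment> \<open>A chord \<open>(x, y)\<close> that crosses \<open>(?r, q)\<close> from the
          left must start at \<open>p\<close>: starting earlier it crosses \<open>(p, q)\<close>,
          starting between \<open>p\<close> and \<open>?r\<close> it crosses \<open>(p, ?r)\<close>.
          Then \<open>(p, y)\<close> is a longer prefix.\<close>
        moreover have "\<not> interleaved (x, y) (?r, q)"
        proof
          assume i: "interleaved (x, y) (?r, q)"
          then have "x = p"
            using El[OF e less.prems] El[OF \<open>(p, ?r) \<in> E\<close> e] \<open>p < ?r\<close> by (auto simp: interleaved_def xy)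
          then have "y \<in> R" using i e xy \<open>p < ?r\<close> by (auto simp: interleaved_def R_def)
          then show False using r(2)[of y] i by (simp add: interleaved_def)
        qed
        ultimately show "\<not> interleaved (?r, q) e \<and> \<not> interleaved e (?r, q)" by (simp add: xy)
      qed
      have "?r - p < q - p" "q - ?r < q - p" using \<open>p < ?r\<close> \<open>?r < q\<close> by linarith+
      obtain a where "p + leaves a = ?r" "ivals p a \<subseteq> E"
        using less.hyps[OF \<open>?r - p < q - p\<close>] \<open>(p, ?r) \<in> E\<close> by auto
      moreover obtain b where "?r + leaves b = q" "ivals ?r b \<subseteq> E"
        using less.hyps[OF \<open>q - ?r < q - p\<close>] \<open>(?r, q) \<in> E\<close> by auto
      ultimately show ?thesis using less.prems by (intro exI[of _ "Branch a b"]) auto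
    qed
  qed
  obtain t where t: "leaves t = m" "ivals 0 t \<subseteq> E" using build[of 0 m] by (auto simp: E_def)
  have "(x, y) \<in> ivals 0 t" if "(x, y) \<in> E" for x y
  proof (rule ivals_maximal)
    show "0 \<le> x" "x < y" "y \<le> 0 + leaves t" using E_le[OF that] t by auto
    show "\<not> interleaved (x, y) (u, v) \<and> \<not> interleaved (u, v) (x, y)" if "(u, v) \<in> ivals 0 t" for u v
      using El[OF \<open>(x, y) \<in> E\<close>, of "(u, v)"] El[OF _ \<open>(x, y) \<in> E\<close>, of "(u, v)"] that t by auto
  qed
  then have "ivals 0 t = E" using t by auto
  then have "C = ivals 0 t \<inter> diagonals m" using Cd by (auto simp: E_def diagonals_def)
  then show thesis using t that by blast
qed

lemma maximal_laminar_iff: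
  "m \<ge> 1 \<Longrightarrow> maximal_laminar m C \<longleftrightarrow> (\<exists>t\<in>trees m. C = ivals 0 t \<inter> diagonals m)"
  using maximal_laminar_imp_tree[of m C] maximal_laminar_tree by (auto simp: trees_def)

section \<open>Labels and rotations\<close>

text \<open>For distinct labels, \<open>b\<close> is the median of \<open>a\<close>,
  \<open>b\<close>, \<open>c\<close> iff \<open>(a < b) = (b < c)\<close>. The value is a position,
  not a label.\<close>

fun mid :: "(nat \<Rightarrow> nat) \<Rightarrow> nat \<times> nat \<times> nat \<Rightarrow> nat" where
  "mid l (p, r, q) =
     (if (l p < l r) = (l r < l q) then r else if (l r < l p) = (l p < l q) then p else q)"

text \<open>
  For a triangle with corners at the positions \<open>p < r < q\<close> of an \<open>(m + 1)\<close>-gon, the three sides cut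
  off \<open>r - p\<close>, \<open>q - r\<close> and \<open>m + 1 - (q - p)\<close> boundary edges. The middle vertex is a down vertex iff
  the labels increase along the counterclockwise path formed by the two sides that meet there.
\<close>

fun tri_val :: "(nat \<Rightarrow> nat) \<Rightarrow> nat \<Rightarrow> nat \<times> nat \<times> nat \<Rightarrow> real" where
  "tri_val l m (p, r, q) =
     (let a = real r - real p; b = real q - real r; c = real m + 1 - (real q - real p) in
      if (l p < l r) = (l r < l q) then if l p < l q then a * b else real m - a * b
      else if (l r < l p) = (l p < l q) then if l q < l r then c * a else real m - c * a
      else if l r < l p then b * c else real m - b * c)"

text \<open>The common value of the sum of \<open>tri_val\<close> over any triangulation of the part cut off by \<open>(p, q)\<close>.\<close>

definition arc_val :: "(nat \<Rightarrow> nat) \<Rightarrow> nat \<Rightarrow> nat \<times> nat \<Rightarrow> real" where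
  "arc_val l m = (\<lambda>(p, q). let d = real q - real p in
     if l p < l q then d * (d - 1) / 2
     else real m * (real m - 1) / 2 - (real m + 1 - d) * (real m - d) / 2)"

text \<open>\<open>d * (d - 1) / 2\<close> counts the pairs among the \<open>d\<close> boundary
  edges below the chord. If the arc lies above it, the other \<open>m + 1 - d\<close> edges lie
  below, and their value is subtracted from the total
  \<open>m * (m - 1) / 2 = 1 + ... + (m - 1)\<close>. With these values a triangle adds up with the
  arcs on its sides, so sums over subtrees telescope.\<close>

lemma tri_val_arc_val:
  assumes "distinct [l p, l r, l q]"
  shows "tri_val l m (p, r, q) + arc_val l m (p, r) + arc_val l m (r, q) = arc_val l m (p, q)"
  using assms
  by (auto simp: arc_val_def Let_def field_simps)

text \<open>In the quadrilateral \<open>p < r < s < q\<close> both pairs of triangles have the same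
  two middle vertices, and the flip moves an amount from one coordinate to the other. The sign
  depends on whether the arc of the diagonal lies below it (its labels increase) or above it. The
  excluded label patterns are those in which the two diagonals have disjoint label ranges and so
  could not cross.\<close>

lemma rotation:
  fixes \<tau> :: "nat \<Rightarrow> real"
  assumes "p < r" "r < s" "s < q" "q \<le> m" "distinct [l p, l r, l s, l q]"
    and "\<not> (max (l p) (l s) < min (l r) (l q))" "\<not> (max (l r) (l q) < min (l p) (l s))"
  defines "w \<equiv> \<lambda>D. \<tau> (mid l D) * tri_val l m D"
  shows "\<exists>c>0. w (p, s, q) + w (p, r, s) - (w (p, r, q) + w (r, s, q)) =
     c * (if l p < l s then \<tau> (mid l (p, s, q)) - \<tau> (mid l (p, r, s))
          else \<tau> (mid l (p, r, s)) - \<tau> (mid l (p, s, q)))" (is "\<exists>c>0. ?L = c * ?R")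
    and "\<exists>c>0. w (p, r, q) + w (r, s, q) - (w (p, s, q) + w (p, r, s)) =
     c * (if l r < l q then \<tau> (mid l (p, r, q)) - \<tau> (mid l (r, s, q))
          else \<tau> (mid l (r, s, q)) - \<tau> (mid l (p, r, q)))" (is "\<exists>c>0. ?L' = c * ?R'")
proof -
  \<comment> \<open>The numbers of boundary edges cut off by the four sides, with sum
    \<open>m + 1\<close>. The factor of the flip is a product over two opposite sides.\<close>
  define a b c d where "a = real r - real p" "b = real s - real r" "c = real q - real s"
    "d = real m + 1 - (real q - real p)"
  have pos: "a > 0" "b > 0" "c > 0" "d > 0"
    using assms(1-4) by (auto simp: a_b_c_d_def)
  have e: "real r = real p + a" "real s = real p + a + b" "real q = real p + a + b + c"
    "real m = a + b + c + d - 1"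
    by (auto simp: a_b_c_d_def)
  have ords: "x < y \<and> \<not> y < x \<or> y < x \<and> \<not> x < y" if "x \<noteq> y" for x y :: nat
    using that by linarith
  have o: "l p < l r \<and> \<not> l r < l p \<or> l r < l p \<and> \<not> l p < l r"
    "l p < l s \<and> \<not> l s < l p \<or> l s < l p \<and> \<not> l p < l s"
    "l p < l q \<and> \<not> l q < l p \<or> l q < l p \<and> \<not> l p < l q"
    "l r < l s \<and> \<not> l s < l r \<or> l s < l r \<and> \<not> l r < l s"
    "l r < l q \<and> \<not> l q < l r \<or> l q < l r \<and> \<not> l r < l q"
    "l s < l q \<and> \<not> l q < l s \<or> l q < l s \<and> \<not> l s < l q"
    using assms(5) by (auto simp: ords)
  have A: "\<not> (l p < l r \<and> l p < l q \<and> l s < l r \<and> l s < l q)" "\<not> (l r < l p \<and> l r < l s \<and> l q < l p \<and> l q < l s)"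
    using assms(6,7) by auto
  have "(?L = (a * c) * ?R \<or> ?L = (b * d) * ?R) \<and> (?L' = (a * c) * ?R' \<or> ?L' = (b * d) * ?R')"
    unfolding w_def tri_val.simps mid.simps Let_def e using o A
    by (elim disjE conjE; (linarith | (simp add: algebra_simps; fail)))
  then show "\<exists>c>0. ?L = c * ?R" "\<exists>c>0. ?L' = c * ?R'" using pos by (meson mult_pos_pos)+
qed

declare mid.simps [simp del] tri_val.simps [simp del]

section \<open>Sums over triangles, and tree rotations\<close>

lemma sum_tris_Branch:
  fixes F :: "nat \<times> nat \<times> nat \<Rightarrow> 'a::comm_monoid_add"
  shows "sum F (tris p (Branch a b)) =
    F (p, p + leaves a, p + leaves a + leaves b) + (sum F (tris p a) + sum F (tris (p + leaves a) b))"
proof -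
  have "tris p a \<inter> tris (p + leaves a) b = {}"
    using tris_bounds[of _ _ _ p a] tris_bounds[of _ _ _ "p + leaves a" b] by fastforce
  moreover have "(p, p + leaves a, p + leaves a + leaves b) \<notin> tris p a \<union> tris (p + leaves a) b"
    using tris_bounds[of p "p + leaves a" "p + leaves a + leaves b" p a]
      tris_bounds[of p "p + leaves a" _ "p + leaves a" b] by auto
  ultimately show ?thesis by (simp add: sum.union_disjoint)
qed

lemma card_tris: "card (tris p t) = leaves t - 1"
proof (induction p t rule: tris.induct)
  case (2 p a b)
  then show ?case
    using sum_tris_Branch[of "\<lambda>_. 1 :: nat" p a b] leaves_pos(1)[of a] leaves_pos(1)[of b]
    by (simp del: leaves_pos)
qed simp

text \<open>The effect of the rotation is recorded on sums of an arbitrary \<open>F\<close>, the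
  form in which a flip enters the linear functionals.\<close>

lemma tris_rotate_right:
  assumes "(x, y, z) \<in> tris p t" "(x, s, y) \<in> tris p t"
  obtains t' where "leaves t' = leaves t"
    "\<And>F :: _ \<Rightarrow> real. sum F (tris p t') + (F (x, y, z) + F (x, s, y)) =
       sum F (tris p t) + (F (x, s, z) + F (s, y, z))"
proof -
  have "(x, y, z) \<in> tris p t \<Longrightarrow> (x, s, y) \<in> tris p t \<Longrightarrow> \<exists>t'. leaves t' = leaves t \<and>
    (\<forall>F :: _ \<Rightarrow> real. sum F (tris p t') + (F (x, y, z) + F (x, s, y)) =
       sum F (tris p t) + (F (x, s, z) + F (s, y, z)))"
  proof (induction p t rule: tris.induct)
    case (2 p a b)
    let ?r = "p + leaves a"
    consider (root) "(x, y, z) = (p, ?r, ?r + leaves b)"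
      | (l) "(x, y, z) \<in> tris p a" | (r) "(x, y, z) \<in> tris ?r b"
      using "2.prems" by auto
    then show ?case
    proof cases
      case root
      then have "(x, s, y) \<in> tris p a"
        using "2.prems"(2) tris_bounds[of x s y ?r b] tris_bounds[of x s y p a] by auto
      moreover from this obtain c d where a: "a = Branch c d" by (cases a) auto
      ultimately have s: "s = p + leaves c"
        using tris_bounds[of x s y p c] tris_bounds[of x s y "p + leaves c" d] root by auto
      show ?thesis
        using root unfolding a s
        by (intro exI[of _ "Branch c (Branch d b)"]) (auto simp: sum_tris_Branch add.assoc simp del: tris.simps)
    next
      case l
      then have "(x, s, y) \<in> tris p a"
        using "2.prems"(2) tris_bounds[of x s y ?r b] tris_bounds[of x y z p a] by auto
      from "2.IH"(1)[OF l this] obtain t' where t': "leaves t' = leaves a"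
        "\<And>F :: _ \<Rightarrow> real. sum F (tris p t') + (F (x, y, z) + F (x, s, y)) =
            sum F (tris p a) + (F (x, s, z) + F (s, y, z))" by auto
      then show ?thesis
        by (intro exI[of _ "Branch t' b"]) (auto simp: sum_tris_Branch algebra_simps simp del: tris.simps)
    next
      case r
      then have "(x, s, y) \<in> tris ?r b"
        using "2.prems"(2) tris_bounds[of x s y p a] tris_bounds[of x y z ?r b] by auto
      from "2.IH"(2)[OF r this] obtain t' where t': "leaves t' = leaves b"
        "\<And>F :: _ \<Rightarrow> real. sum F (tris ?r t') + (F (x, y, z) + F (x, s, y)) =
            sum F (tris ?r b) + (F (x, s, z) + F (s, y, z))" by auto
      then show ?thesis
        by (intro exI[of _ "Branch a t'"]) (auto simp: sum_tris_Branch algebra_simps simp del: tris.simps)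
    qed
  qed auto
  then show thesis using assms that by blast
qed

lemma tris_rotate_left:
  assumes "(z, x, y) \<in> tris p t" "(x, s, y) \<in> tris p t"
  obtains t' where "leaves t' = leaves t"
    "\<And>F :: _ \<Rightarrow> real. sum F (tris p t') + (F (z, x, y) + F (x, s, y)) =
       sum F (tris p t) + (F (z, s, y) + F (z, x, s))"
proof -
  have "(z, x, y) \<in> tris p t \<Longrightarrow> (x, s, y) \<in> tris p t \<Longrightarrow> \<exists>t'. leaves t' = leaves t \<and>
    (\<forall>F :: _ \<Rightarrow> real. sum F (tris p t') + (F (z, x, y) + F (x, s, y)) =
       sum F (tris p t) + (F (z, s, y) + F (z, x, s)))"
  proof (induction p t rule: tris.induct)
    case (2 p a b)
    let ?r = "p + leaves a"
    consider (root) "(z, x, y) = (p, ?r, ?r + leaves b)"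
      | (l) "(z, x, y) \<in> tris p a" | (r) "(z, x, y) \<in> tris ?r b"
      using "2.prems" by auto
    then show ?case
    proof cases
      case root
      then have "(x, s, y) \<in> tris ?r b"
        using "2.prems"(2) tris_bounds[of x s y ?r b] tris_bounds[of x s y p a] by auto
      moreover from this obtain c d where b: "b = Branch c d" by (cases b) auto
      ultimately have s: "s = ?r + leaves c"
        using tris_bounds[of x s y ?r c] tris_bounds[of x s y "?r + leaves c" d] root by auto
      show ?thesis
        using root unfolding b s
        by (intro exI[of _ "Branch (Branch a c) d"]) (auto simp: sum_tris_Branch add.assoc simp del: tris.simps)
    next
      case l
      then have "(x, s, y) \<in> tris p a"
        using "2.prems"(2) tris_bounds[of x s y ?r b] tris_bounds[of z x y p a] by auto
      from "2.IH"(1)[OF l this] obtain t' where t': "leaves t' = leaves a"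
        "\<And>F :: _ \<Rightarrow> real. sum F (tris p t') + (F (z, x, y) + F (x, s, y)) =
            sum F (tris p a) + (F (z, s, y) + F (z, x, s))" by auto
      then show ?thesis
        by (intro exI[of _ "Branch t' b"]) (auto simp: sum_tris_Branch algebra_simps simp del: tris.simps)
    next
      case r
      then have "(x, s, y) \<in> tris ?r b"
        using "2.prems"(2) tris_bounds[of x s y p a] tris_bounds[of z x y ?r b] by auto
      from "2.IH"(2)[OF r this] obtain t' where t': "leaves t' = leaves b"
        "\<And>F :: _ \<Rightarrow> real. sum F (tris ?r t') + (F (z, x, y) + F (x, s, y)) =
            sum F (tris ?r b) + (F (z, s, y) + F (z, x, s))" by auto
      then show ?thesis
        by (intro exI[of _ "Branch a t'"]) (auto simp: sum_tris_Branch algebra_simps simp del: tris.simps)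
    qed
  qed auto
  then show thesis using assms that by blast
qed

section \<open>Labels of the nodes cut off by a chord\<close>

definition arc_inner :: "(nat \<Rightarrow> nat) \<Rightarrow> nat \<times> nat \<Rightarrow> nat set" where
  "arc_inner l = (\<lambda>(p, q). {v \<in> {p..q}. (\<exists>x\<in>{p..q}. l x < l v) \<and> (\<exists>y\<in>{p..q}. l v < l y)})"

text \<open>By injectivity exactly one position carries the least and one the greatest label of the
  arc; only these two are missing.\<close>

lemma card_arc_inner:
  assumes "inj_on l {p..q}" "p < q"
  shows "card (arc_inner l (p, q)) = q - p - 1"
proof -
  obtain a b where ab: "a \<in> {p..q}" "b \<in> {p..q}" "\<And>x. x \<in> {p..q} \<Longrightarrow> l a \<le> l x" "\<And>x. x \<in> {p..q} \<Longrightarrow> l x \<le> l b"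
  proof -
    have "finite (l ` {p..q})" "l ` {p..q} \<noteq> {}" using assms(2) by auto
    then have "Min (l ` {p..q}) \<in> l ` {p..q}" "Max (l ` {p..q}) \<in> l ` {p..q}" by (rule Min_in, rule Max_in)
    then obtain a b where "a \<in> {p..q}" "b \<in> {p..q}" "l a = Min (l ` {p..q})" "l b = Max (l ` {p..q})"
      unfolding image_iff by metis
    then show thesis using that by simp
  qed
  have less: "l a < l x" if "x \<in> {p..q}" "x \<noteq> a" for x
    using ab(1) ab(3)[of x] that assms(1) by (auto dest: inj_onD simp: order_less_le)
  have greater: "l x < l b" if "x \<in> {p..q}" "x \<noteq> b" for x
    using ab(2) ab(4)[of x] that assms(1) by (auto dest: inj_onD simp: order_less_le)
  have "arc_inner l (p, q) = {p..q} - {a, b}"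
  proof (intro set_eqI iffI)
    fix v assume "v \<in> arc_inner l (p, q)"
    then obtain x y where "v \<in> {p..q}" "x \<in> {p..q}" "y \<in> {p..q}" "l x < l v" "l v < l y"
      unfolding arc_inner_def by blast
    then show "v \<in> {p..q} - {a, b}" using ab(3)[of x] ab(4)[of y] by auto
  next
    fix v assume "v \<in> {p..q} - {a, b}"
    then show "v \<in> arc_inner l (p, q)" using ab(1,2) less[of v] greater[of v] unfolding arc_inner_def by blast
  qed
  moreover have "a \<noteq> b"
  proof
    assume "a = b"
    then have "l p = l q" using ab(3,4)[of p] ab(3,4)[of q] assms(2) by auto
    then show False using assms by (auto dest: inj_onD)
  qed
  ultimately show ?thesis using ab(1,2) by (simp add: card_Diff_subset)
qed

lemma arc_innerI: "i \<le> v \<Longrightarrow> v \<le> j \<Longrightarrow> a \<in> {i..j} \<Longrightarrow> b \<in> {i..j} \<Longrightarrow> l a < l v \<Longrightarrow> l v < l b \<Longrightarrow>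
    v \<in> arc_inner l (i, j)"
  by (auto simp: arc_inner_def)

text \<open>In the polygon, \<open>M\<close> is the position of the rightmost vertex: up to it the
  labels run along the lower hull, after it along the upper hull. Nothing but injectivity relates
  the two runs.\<close>

locale unimodal_labels =
  fixes l :: "nat \<Rightarrow> nat" and m M :: nat
  assumes inj: "inj_on l {..m}"
    and rise: "\<And>p q. p < q \<Longrightarrow> q \<le> M \<Longrightarrow> q \<le> m \<Longrightarrow> l p < l q"
    and fall: "\<And>p q. M < p \<Longrightarrow> p < q \<Longrightarrow> q \<le> m \<Longrightarrow> l q < l p"
begin

lemma l_neq: "p < q \<Longrightarrow> q \<le> m \<Longrightarrow> l p \<noteq> l q"
  using inj_onD[OF inj, of p q] by auto

lemma l_distinct: "p < r \<Longrightarrow> r < q \<Longrightarrow> q \<le> m \<Longrightarrow> distinct [l p, l r, l q]"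
  using l_neq[of p r] l_neq[of r q] l_neq[of p q] by auto

text \<open>Both patterns contain a valley, at \<open>s\<close> or at \<open>r\<close>; a sequence
  that rises and then falls has none.\<close>

lemma no_alternation:
  assumes "p < r" "r < s" "s < q" "q \<le> m"
  shows "\<not> (max (l p) (l s) < min (l r) (l q))" "\<not> (max (l r) (l q) < min (l p) (l s))"
proof -
  show "\<not> (max (l p) (l s) < min (l r) (l q))"
    using rise[of r s] fall[of s q] assms by (cases "s \<le> M") auto
  show "\<not> (max (l r) (l q) < min (l p) (l s))"
    using rise[of p r] fall[of r s] assms by (cases "r \<le> M") auto
qed

lemma mid_cases:
  assumes "p < r" "r < q" "q \<le> m"
  obtains "mid l (p, r, q) = r" "l p < l r \<and> l r < l q \<or> l q < l r \<and> l r < l p"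
  | "mid l (p, r, q) = p" "l r < l p \<and> l p < l q \<or> l q < l p \<and> l p < l r"
  | "mid l (p, r, q) = q" "l r < l q \<and> l q < l p \<or> l p < l q \<and> l q < l r"
  using l_distinct[OF assms] by (cases "(l p < l r) = (l r < l q)"; cases "(l r < l p) = (l p < l q)") (auto simp: mid.simps not_less_iff_gr_or_eq)

lemma mid_arc_inner:
  assumes "p < r" "r < q" "q \<le> m"
  shows "mid l (p, r, q) \<in> arc_inner l (p, q)"
  using assms by (cases rule: mid_cases[OF assms]) (auto simp: arc_inner_def)

lemma arc_inner_mono: "p \<le> p' \<Longrightarrow> q' \<le> q \<Longrightarrow> arc_inner l (p', q') \<subseteq> arc_inner l (p, q)"
  unfolding arc_inner_def by fastforce

text \<open>Strictly inside an arc, a label that is extreme for the arc is extreme overall: on the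
  rising run \<open>P\<close> has a smaller label, and a larger label beyond \<open>Q\<close> forces
  \<open>l u < l Q\<close>; on the falling run the ends exchange roles.\<close>

lemma arc_inner_interior:
  assumes "P < u" "u < Q" "Q \<le> m" "w \<le> m" "w' \<le> m" "l w < l u" "l u < l w'"
  shows "u \<in> arc_inner l (P, Q)"
proof (cases "u \<le> M")
  case True
  then have "l P < l u" using assms rise by auto
  moreover have "\<exists>y\<in>{P..Q}. l u < l y"
  proof (cases "w' \<le> Q")
    case True
    then have "P \<le> w'" using assms rise[of w' u] \<open>u \<le> M\<close> by (cases "w' < u") auto
    then show ?thesis using assms True by auto
  next
    case False
    then have "l u < l Q"
      using assms rise[of u Q] fall[of Q w'] by (cases "Q \<le> M") auto
    then show ?thesis using assms by auto
  qed
  ultimately show ?thesis using assms arc_innerI[of P u Q P] by auto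
next
  case False
  then have "l Q < l u" using assms fall by auto
  moreover have "\<exists>y\<in>{P..Q}. l u < l y"
  proof (cases "P \<le> w'")
    case True
    then have "w' < u" using assms fall[of u w'] False by (cases "w' = u"; cases "u < w'") auto
    then show ?thesis using assms True by auto
  next
    case P: False
    then have "l u < l P"
      using assms False rise[of w' P] fall[of P u] by (cases "P \<le> M") auto
    then show ?thesis using assms by auto
  qed
  ultimately show ?thesis using assms arc_innerI[of P u Q Q] by auto
qed

text \<open>With \<open>u\<close> above \<open>P\<close>, only a smaller label is in question. A
  vertex of the arc below \<open>P\<close> must be on the falling run, which then brings
  \<open>Q\<close> below \<open>P\<close> as well.\<close>

lemma arc_inner_left:
  assumes "P < u" "u < Q" "Q \<le> m" "l P < l u"
  shows "P \<in> arc_inner l (P, Q) \<longleftrightarrow> l Q < l P"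
proof
  assume "P \<in> arc_inner l (P, Q)"
  then obtain x where x: "P \<le> x" "x \<le> Q" "l x < l P" by (auto simp: arc_inner_def)
  then have "P < x" by (cases "x = P") auto
  show "l Q < l P"
    using x \<open>P < x\<close> assms rise[of P x] fall[of x Q] by (cases "x \<le> M"; cases "x = Q") auto
next
  assume "l Q < l P"
  then show "P \<in> arc_inner l (P, Q)" using assms by (intro arc_innerI[of P P Q Q u]) auto
qed

lemma arc_inner_right:
  assumes "P < u" "u < Q" "Q \<le> m" "l Q < l u"
  shows "Q \<in> arc_inner l (P, Q) \<longleftrightarrow> l P < l Q"
proof
  assume "Q \<in> arc_inner l (P, Q)"
  then obtain x where x: "P \<le> x" "x \<le> Q" "l x < l Q" by (auto simp: arc_inner_def)
  then have "x < Q" by (cases "x = Q") auto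
  show "l P < l Q"
    using x \<open>x < Q\<close> assms rise[of P x] fall[of x Q] by (cases "x \<le> M"; cases "x = P") auto
next
  assume "l P < l Q"
  then show "Q \<in> arc_inner l (P, Q)" using assms by (intro arc_innerI[of P Q Q P u]) auto
qed

lemma arc_inner_outside: "v < P \<or> Q < v \<Longrightarrow> v \<notin> arc_inner l (P, Q)"
  by (auto simp: arc_inner_def)

text \<open>Interior vertices stay inner in their own half. A corner that is not the median of
  \<open>p\<close>, \<open>r\<close>, \<open>q\<close> is below or above both other corners; the
  witness on the other side then lies in a half containing that corner, since elsewhere it would
  create an alternation.\<close>

lemma arc_inner_split:
  assumes "p < r" "r < q" "q \<le> m"
  shows "arc_inner l (p, q) \<subseteq> insert (mid l (p, r, q)) (arc_inner l (p, r) \<union> arc_inner l (r, q))"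
proof
  fix v assume "v \<in> arc_inner l (p, q)"
  then obtain x y where v: "p \<le> v" "v \<le> q" "p \<le> x" "x \<le> q" "p \<le> y" "y \<le> q" "l x < l v" "l v < l y"
    by (auto simp: arc_inner_def)
  have "v \<le> m" "x \<le> m" "y \<le> m" using v assms by auto
  have alt: "\<not> (l a < l b \<and> l a < l d \<and> l c < l b \<and> l c < l d)" "\<not> (l b < l a \<and> l d < l a \<and> l b < l c \<and> l d < l c)"
    if "p \<le> a" "a < b" "b < c" "c < d" "d \<le> q" for a b c d
    using no_alternation[of a b c d] that assms by simp_all
  note mem = arc_innerI[where l = l and v = v]
  consider "p < v" "v < r" | "r < v" "v < q" | "v = p" | "v = r" | "v = q"
    using v by linarith
  then show "v \<in> insert (mid l (p, r, q)) (arc_inner l (p, r) \<union> arc_inner l (r, q))"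
  proof cases
    case 1
    then show ?thesis using arc_inner_interior[of p v r x y] v assms \<open>x \<le> m\<close> \<open>y \<le> m\<close> by auto
  next
    case 2
    then show ?thesis using arc_inner_interior[of r v q x y] v assms \<open>x \<le> m\<close> \<open>y \<le> m\<close> by auto
  next
    case 3
    have "p < x" "p < y" using v 3 by (auto simp: order_le_less)
    consider "mid l (p, r, q) = p" | "l p < l r" "l p < l q" | "l r < l p" "l q < l p"
      using l_distinct[OF assms] by (cases "l p < l r"; cases "l p < l q"; cases "l r < l q") (auto simp: mid.simps)
    then show ?thesis
    proof cases
      case a: 2
      then have "x \<noteq> r" "x \<noteq> q" using v 3 by auto
      then have "\<not> (r < x \<and> x < q)" using alt(1)[of p r x q] a v 3 assms by auto
      then have "x < r" using v \<open>x \<noteq> r\<close> \<open>x \<noteq> q\<close> by linarith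
      then show ?thesis using mem[of p r x r] 3 v \<open>p < x\<close> a assms by auto
    next
      case a: 3
      then have "y \<noteq> r" "y \<noteq> q" using v 3 by auto
      then have "\<not> (r < y \<and> y < q)" using alt(2)[of p r y q] a v 3 assms by auto
      then have "y < r" using v \<open>y \<noteq> r\<close> \<open>y \<noteq> q\<close> by linarith
      then show ?thesis using mem[of p r r y] 3 v \<open>p < y\<close> a assms by auto
    qed (use 3 in auto)
  next
    case 4
    consider "mid l (p, r, q) = r" | "l r < l p" "l r < l q" | "l p < l r" "l q < l r"
      using l_distinct[OF assms] by (cases "l p < l r"; cases "l p < l q"; cases "l r < l q") (auto simp: mid.simps)
    then show ?thesis
    proof cases
      case a: 2
      then show ?thesis using mem[of p r x p] mem[of r q x q] 4 v assms by (cases "x \<le> r") auto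
    next
      case a: 3
      then show ?thesis using mem[of p r p y] mem[of r q q y] 4 v assms by (cases "y \<le> r") auto
    qed (use 4 in auto)
  next
    case 5
    have "x < q" "y < q" using v 5 by (auto simp: order_le_less)
    consider "mid l (p, r, q) = q" | "l q < l r" "l q < l p" | "l r < l q" "l p < l q"
      using l_distinct[OF assms] by (cases "l p < l r"; cases "l p < l q"; cases "l r < l q") (auto simp: mid.simps)
    then show ?thesis
    proof cases
      case a: 2
      then have "x \<noteq> r" "x \<noteq> p" using v 5 by auto
      then have "\<not> (p < x \<and> x < r)" using alt(2)[of p x r q] a v 5 assms by auto
      then have "r < x" using v \<open>x \<noteq> r\<close> \<open>x \<noteq> p\<close> by linarith
      then show ?thesis using mem[of r q x r] 5 v \<open>x < q\<close> a assms by auto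
    next
      case a: 3
      then have "y \<noteq> r" "y \<noteq> p" using v 5 by auto
      then have "\<not> (p < y \<and> y < r)" using alt(1)[of p y r q] a v 5 assms by auto
      then have "r < y" using v \<open>y \<noteq> r\<close> \<open>y \<noteq> p\<close> by linarith
      then show ?thesis using mem[of r q r y] 5 v \<open>y < q\<close> a assms by auto
    qed (use 5 in auto)
  qed
qed

text \<open>Surjectivity comes from splitting the arc at each node; both sides have
  \<open>leaves t - 1\<close> elements, so injectivity follows by counting. Thus every inner label
  belongs to exactly one node of the spine, and the inner labels of an arc are those of the nodes
  cut off by its chord.\<close>

lemma mid_bij_betw:
  assumes "p + leaves t \<le> m"
  shows "bij_betw (mid l) (tris p t) (arc_inner l (p, p + leaves t))"
proof -
  have sub: "mid l ` tris p t \<subseteq> arc_inner l (p, p + leaves t)"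
  proof
    fix v assume "v \<in> mid l ` tris p t"
    then obtain x r y where D: "(x, r, y) \<in> tris p t" "v = mid l (x, r, y)" by auto
    from tris_bounds[OF D(1)] mid_arc_inner[of x r y] show "v \<in> arc_inner l (p, p + leaves t)"
      using arc_inner_mono[of p x y "p + leaves t"] assms unfolding D(2) by auto
  qed
  have sup: "arc_inner l (p, p + leaves t) \<subseteq> mid l ` tris p t"
    using assms
  proof (induction p t rule: tris.induct)
    case (1 p)
    then show ?case using card_arc_inner[of l p "p + 1"] inj by (auto simp: arc_inner_def le_Suc_eq)
  next
    case (2 p a b)
    then show ?case
      using arc_inner_split[of p "p + leaves a" "p + leaves a + leaves b"]
      by (auto simp: add.assoc)
  qed
  have "card (arc_inner l (p, p + leaves t)) = leaves t - 1"
    using card_arc_inner[of l p "p + leaves t"] inj_on_subset[OF inj, of "{p..p + leaves t}"] assms by auto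
  then have "inj_on (mid l) (tris p t)"
    using sub sup by (intro eq_card_imp_inj_on) (auto simp: card_tris subset_antisym)
  then show ?thesis using sub sup by (auto simp: bij_betw_def)
qed

lemma sum_tri_val:
  assumes "p + leaves t \<le> m"
  shows "sum (tri_val l m) (tris p t) = arc_val l m (p, p + leaves t)"
  using assms
proof (induction p t rule: tris.induct)
  case (2 p a b)
  then show ?case
    using tri_val_arc_val[of l p "p + leaves a" "p + leaves a + leaves b" m]
      l_distinct[of p "p + leaves a" "p + leaves a + leaves b"]
    by (simp add: sum_tris_Branch add.assoc del: tris.simps)
qed (simp add: arc_val_def)

end

section \<open>Minimal trees and the triangles crossed by a chord\<close>

context unimodal_labels
begin

text \<open>The linear functional with coefficients \<open>\<tau>\<close> at the point
  \<open>x(T)\<close>, summed over triangles instead of coordinates.\<close>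

definition tree_weight :: "(nat \<Rightarrow> real) \<Rightarrow> btree \<Rightarrow> real" where
  "tree_weight \<tau> t = (\<Sum>D\<in>tris 0 t. \<tau> (mid l D) * tri_val l m D)"

text \<open>Flipping \<open>(x, y)\<close> cannot decrease the functional, and by
  \<open>rotation\<close> the change is a positive multiple of a difference of two coefficients. So
  coefficients do not increase along the spine arc dual to \<open>(x, y)\<close>; the order of
  \<open>l x\<close> and \<open>l y\<close> tells which of the two triangles is the lower
  one.\<close>

lemma minimal_tree_right:
  assumes "leaves t = m" "\<And>t'. leaves t' = m \<Longrightarrow> tree_weight \<tau> t \<le> tree_weight \<tau> t'"
    and "(x, y, z) \<in> tris 0 t" "(x, s, y) \<in> tris 0 t"
  shows "if l x < l y then \<tau> (mid l (x, y, z)) \<le> \<tau> (mid l (x, s, y))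
         else \<tau> (mid l (x, s, y)) \<le> \<tau> (mid l (x, y, z))"
proof -
  have ord: "x < s" "s < y" "y < z" "z \<le> m"
    using tris_bounds[OF assms(3)] tris_bounds[OF assms(4)] assms(1) by auto
  have "distinct [l x, l s, l y, l z]"
    using l_neq[of x s] l_neq[of x y] l_neq[of x z] l_neq[of s y] l_neq[of s z] l_neq[of y z] ord by auto
  from rotation(1)[OF ord this no_alternation[OF ord], of \<tau>]
  obtain c where c: "c > 0"
    "\<tau> (mid l (x, y, z)) * tri_val l m (x, y, z) + \<tau> (mid l (x, s, y)) * tri_val l m (x, s, y) -
     (\<tau> (mid l (x, s, z)) * tri_val l m (x, s, z) + \<tau> (mid l (s, y, z)) * tri_val l m (s, y, z)) =
     c * (if l x < l y then \<tau> (mid l (x, y, z)) - \<tau> (mid l (x, s, y))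
          else \<tau> (mid l (x, s, y)) - \<tau> (mid l (x, y, z)))" by blast
  obtain t' where t': "leaves t' = leaves t" "\<And>F :: _ \<Rightarrow> real. sum F (tris 0 t') + (F (x, y, z) + F (x, s, y)) =
       sum F (tris 0 t) + (F (x, s, z) + F (s, y, z))"
    using tris_rotate_right[OF assms(3,4)] by blast
  have "tree_weight \<tau> t \<le> tree_weight \<tau> t'" using assms(1,2) t'(1) by simp
  then have "c * (if l x < l y then \<tau> (mid l (x, y, z)) - \<tau> (mid l (x, s, y))
          else \<tau> (mid l (x, s, y)) - \<tau> (mid l (x, y, z))) \<le> 0"
    using t'(2)[of "\<lambda>D. \<tau> (mid l D) * tri_val l m D"] c(2) unfolding tree_weight_def by linarith
  then show ?thesis using c(1) by (auto simp: mult_le_0_iff split: if_splits)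
qed

lemma minimal_tree_left:
  assumes "leaves t = m" "\<And>t'. leaves t' = m \<Longrightarrow> tree_weight \<tau> t \<le> tree_weight \<tau> t'"
    and "(z, x, y) \<in> tris 0 t" "(x, s, y) \<in> tris 0 t"
  shows "if l x < l y then \<tau> (mid l (z, x, y)) \<le> \<tau> (mid l (x, s, y))
         else \<tau> (mid l (x, s, y)) \<le> \<tau> (mid l (z, x, y))"
proof -
  have ord: "z < x" "x < s" "s < y" "y \<le> m"
    using tris_bounds[OF assms(3)] tris_bounds[OF assms(4)] assms(1) by auto
  have "distinct [l z, l x, l s, l y]"
    using l_neq[of x s] l_neq[of x y] l_neq[of z x] l_neq[of s y] l_neq[of z s] l_neq[of z y] ord by auto
  from rotation(2)[OF ord this no_alternation[OF ord], of \<tau>]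
  obtain c where c: "c > 0"
    "\<tau> (mid l (z, x, y)) * tri_val l m (z, x, y) + \<tau> (mid l (x, s, y)) * tri_val l m (x, s, y) -
     (\<tau> (mid l (z, s, y)) * tri_val l m (z, s, y) + \<tau> (mid l (z, x, s)) * tri_val l m (z, x, s)) =
     c * (if l x < l y then \<tau> (mid l (z, x, y)) - \<tau> (mid l (x, s, y))
          else \<tau> (mid l (x, s, y)) - \<tau> (mid l (z, x, y)))" by blast
  obtain t' where t': "leaves t' = leaves t" "\<And>F :: _ \<Rightarrow> real. sum F (tris 0 t') + (F (z, x, y) + F (x, s, y)) =
       sum F (tris 0 t) + (F (z, s, y) + F (z, x, s))"
    using tris_rotate_left[OF assms(3,4)] by blast
  have "tree_weight \<tau> t \<le> tree_weight \<tau> t'" using assms(1,2) t'(1) by simp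
  then have "c * (if l x < l y then \<tau> (mid l (z, x, y)) - \<tau> (mid l (x, s, y))
          else \<tau> (mid l (x, s, y)) - \<tau> (mid l (z, x, y))) \<le> 0"
    using t'(2)[of "\<lambda>D. \<tau> (mid l D) * tri_val l m D"] c(2) unfolding tree_weight_def by linarith
  then show ?thesis using c(1) by (auto simp: mult_le_0_iff split: if_splits)
qed

lemma rise_fall: "p < q \<Longrightarrow> q \<le> m \<Longrightarrow> (q \<le> M \<longrightarrow> l p < l q) \<and> (M < p \<longrightarrow> l q < l p)"
  using rise fall by auto

lemma arc_inner_left_top:
  assumes "M < P" "Q \<le> m"
  shows "P \<notin> arc_inner l (P, Q)"
proof -
  have "l y \<le> l P" if "y \<in> {P..Q}" for y
    using fall[of P y] assms that by (cases "y = P") auto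
  then show ?thesis by (auto simp: arc_inner_def not_less[symmetric])
qed

lemma arc_inner_right_top:
  assumes "Q \<le> M" "Q \<le> m"
  shows "Q \<notin> arc_inner l (P, Q)"
proof -
  have "l y \<le> l Q" if "y \<in> {P..Q}" for y
    using rise[of y Q] assms that by (cases "y = Q") auto
  then show ?thesis by (auto simp: arc_inner_def not_less[symmetric])
qed

text \<open>
  Here \<open>u\<close>, \<open>u'\<close> lie strictly inside the arc from \<open>P\<close> to \<open>Q\<close> and \<open>w\<close>, \<open>w'\<close> strictly outside, so
  that every chord \<open>(u, w)\<close> crosses \<open>(P, Q)\<close>. The condition \<open>(l u < l w) = (l P < l Q)\<close> records on
  which side of the chord \<open>(u, w)\<close> the vertex \<open>P\<close> lies.
\<close>

lemma crossing_start:
  shows "P < u \<Longrightarrow> u < Q \<Longrightarrow> Q < w \<Longrightarrow> w \<le> m \<Longrightarrow>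
      mid l (P, u, w) \<in> arc_inner l (P, Q) \<longleftrightarrow> (l u < l w) = (l P < l Q)"
    and "w < P \<Longrightarrow> P < u \<Longrightarrow> u < Q \<Longrightarrow> Q \<le> m \<Longrightarrow>
      mid l (w, P, u) \<in> arc_inner l (P, Q) \<longleftrightarrow> (l u < l w) = (l P < l Q)"
proof -
  assume o: "P < u" "u < Q" "Q < w" "w \<le> m"
  then have o': "u < w" "P < w" "P < Q" "Q \<le> m" "u \<le> m" "P \<le> m" by auto
  note rf = rise_fall[OF o(1) o'(5)] rise_fall[OF o(2) o'(4)] rise_fall[OF o(3,4)]
    rise_fall[OF o'(3,4)] rise_fall[OF o'(2) o(4)] rise_fall[OF o'(1) o(4)] l_neq[OF o'(3,4)]
  show "mid l (P, u, w) \<in> arc_inner l (P, Q) \<longleftrightarrow> (l u < l w) = (l P < l Q)"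
  proof (cases rule: mid_cases[OF o(1) o'(1) o(4)])
    case 1
    have "u \<in> arc_inner l (P, Q)"
      using 1(2) arc_inner_interior[OF o(1,2) o'(4), of P w] arc_inner_interior[OF o(1,2) o'(4), of w P] o o' by blast
    moreover have "(l u < l w) = (l P < l Q)" using 1(2) rf by (metis leI less_trans less_asym)
    ultimately show ?thesis using 1(1) by simp
  next
    case 2
    have lt: "l P < l u" using 2(2) rf by (metis leI less_trans less_asym)
    then have "\<not> l u < l w" using 2(2) by auto
    then show ?thesis using 2(1) arc_inner_left[OF o(1,2) o'(4) lt] l_neq[OF o'(3,4)] by auto
  next
    case 3
    have "(l u < l w) \<noteq> (l P < l Q)" using 3(2) rf by (metis leI less_trans less_asym)
    then show ?thesis using 3(1) arc_inner_outside[of w P Q] o by simp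
  qed
next
  assume o: "w < P" "P < u" "u < Q" "Q \<le> m"
  then have o': "w < u" "P < Q" "w < Q" "u \<le> m" "w \<le> m" "P \<le> m" by auto
  note rf = rise_fall[OF o(1) o'(6)] rise_fall[OF o'(1,4)] rise_fall[OF o'(3) o(4)]
    rise_fall[OF o(2) o'(4)] rise_fall[OF o'(2) o(4)] rise_fall[OF o(3,4)] l_neq[OF o'(2) o(4)]
  show "mid l (w, P, u) \<in> arc_inner l (P, Q) \<longleftrightarrow> (l u < l w) = (l P < l Q)"
  proof (cases rule: mid_cases[OF o(1,2) o'(4)])
    case 1
    show ?thesis
    proof (cases "l P < l u")
      case True
      then have "\<not> l u < l w" using 1(2) by auto
      then show ?thesis using 1(1) arc_inner_left[OF o(2,3,4) True] l_neq[OF o'(2) o(4)] by auto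
    next
      case False
      then have "M < P" "l u < l w" using 1(2) rf(1) by auto
      then show ?thesis using 1(1) arc_inner_left_top[of P Q] rf(5) o by auto
    qed
  next
    case 2
    have "(l u < l w) \<noteq> (l P < l Q)" using 2(2) rf by (metis leI less_trans less_asym)
    then show ?thesis using 2(1) arc_inner_outside[of w P Q] o by simp
  next
    case 3
    have "u \<in> arc_inner l (P, Q)"
      using 3(2) arc_inner_interior[OF o(2,3,4), of P w] arc_inner_interior[OF o(2,3,4), of w P] o o' by blast
    moreover have "(l u < l w) = (l P < l Q)" using 3(2) rf by (metis leI less_trans less_asym)
    ultimately show ?thesis using 3(1) by simp
  qed
qed

text \<open>Counterpart of \<open>crossing_start\<close> at the other endpoint, with the opposite
  truth value. This reversal is what a set closed under the spine cannot accommodate along the whole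
  chord.\<close>

lemma crossing_end:
  shows "P < u \<Longrightarrow> u < Q \<Longrightarrow> Q < w \<Longrightarrow> w \<le> m \<Longrightarrow>
      mid l (u, Q, w) \<in> arc_inner l (P, Q) \<longleftrightarrow> (l u < l w) \<noteq> (l P < l Q)"
    and "w < P \<Longrightarrow> P < u \<Longrightarrow> u < Q \<Longrightarrow> Q \<le> m \<Longrightarrow>
      mid l (w, u, Q) \<in> arc_inner l (P, Q) \<longleftrightarrow> (l u < l w) \<noteq> (l P < l Q)"
proof -
  assume o: "P < u" "u < Q" "Q < w" "w \<le> m"
  then have o': "u < w" "P < w" "P < Q" "Q \<le> m" "u \<le> m" "P \<le> m" by auto
  note rf = rise_fall[OF o(1) o'(5)] rise_fall[OF o(2) o'(4)] rise_fall[OF o(3,4)]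
    rise_fall[OF o'(3,4)] rise_fall[OF o'(2) o(4)] rise_fall[OF o'(1) o(4)] l_neq[OF o'(3,4)]
  show "mid l (u, Q, w) \<in> arc_inner l (P, Q) \<longleftrightarrow> (l u < l w) \<noteq> (l P < l Q)"
  proof (cases rule: mid_cases[OF o(2,3,4)])
    case 2
    have "u \<in> arc_inner l (P, Q)"
      using 2(2) arc_inner_interior[OF o(1,2) o'(4), of Q w] arc_inner_interior[OF o(1,2) o'(4), of w Q] o o' by blast
    moreover have "(l u < l w) \<noteq> (l P < l Q)" using 2(2) rf by (metis leI less_trans less_asym)
    ultimately show ?thesis using 2(1) by simp
  next
    case 1
    show ?thesis
    proof (cases "l Q < l u")
      case True
      then have "\<not> l u < l w" using 1(2) by auto
      then show ?thesis using 1(1) arc_inner_right[OF o(1,2) o'(4) True] l_neq[OF o'(3,4)] by auto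
    next
      case False
      then have "Q \<le> M" "l u < l w" using 1(2) rf(3) by auto
      then show ?thesis using 1(1) arc_inner_right_top[of Q P] rf(4) o' by auto
    qed
  next
    case 3
    have "(l u < l w) = (l P < l Q)" using 3(2) rf by (metis leI less_trans less_asym)
    then show ?thesis using 3(1) arc_inner_outside[of w P Q] o by simp
  qed
next
  assume o: "w < P" "P < u" "u < Q" "Q \<le> m"
  then have o': "w < u" "P < Q" "w < Q" "u \<le> m" "w \<le> m" "P \<le> m" by auto
  note rf = rise_fall[OF o(1) o'(6)] rise_fall[OF o'(1,4)] rise_fall[OF o'(3) o(4)]
    rise_fall[OF o(2) o'(4)] rise_fall[OF o'(2) o(4)] rise_fall[OF o(3,4)] l_neq[OF o'(2) o(4)]
  show "mid l (w, u, Q) \<in> arc_inner l (P, Q) \<longleftrightarrow> (l u < l w) \<noteq> (l P < l Q)"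
  proof (cases rule: mid_cases[OF o'(1) o(3,4)])
    case 3
    have lt: "l Q < l u" using 3(2) rf by (metis leI less_trans less_asym)
    then have "\<not> l u < l w" using 3(2) by auto
    then show ?thesis using 3(1) arc_inner_right[OF o(2,3,4) lt] l_neq[OF o'(2) o(4)] by auto
  next
    case 2
    have "(l u < l w) = (l P < l Q)" using 2(2) rf by (metis leI less_trans less_asym)
    then show ?thesis using 2(1) arc_inner_outside[of w P Q] o by simp
  next
    case 1
    have "u \<in> arc_inner l (P, Q)"
      using 1(2) arc_inner_interior[OF o(2,3,4), of Q w] arc_inner_interior[OF o(2,3,4), of w Q] o o' by blast
    moreover have "(l u < l w) \<noteq> (l P < l Q)" using 1(2) rf by (metis leI less_trans less_asym)
    ultimately show ?thesis using 1(1) by simp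
  qed
qed

text \<open>
  In a triangle crossed by \<open>(P, Q)\<close> through two of its sides: the first of the two chords in the
  conclusions below is the side that is closer to \<open>P\<close>.
\<close>

lemma crossing_middle_inside:
  assumes "P < u" "u < u'" "u' < Q" "Q \<le> m" "w \<le> m" "D = (w, u, u') \<and> w < P \<or> D = (u, u', w) \<and> Q < w"
  shows "mid l D \<in> arc_inner l (P, Q) \<Longrightarrow> (l u < l w) = (l P < l Q) \<Longrightarrow> (l u' < l w) = (l P < l Q)"
    and "mid l D \<notin> arc_inner l (P, Q) \<Longrightarrow> (l u < l w) \<noteq> (l P < l Q) \<Longrightarrow> (l u' < l w) \<noteq> (l P < l Q)"
proof -
  have nw: "w \<notin> arc_inner l (P, Q)" using arc_inner_outside[of w P Q] assms by auto
  have o: "u < Q" "P < u'" "P < Q" "u \<le> m" "u' \<le> m" "P \<le> m" using assms by auto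
  have ins: "x \<in> arc_inner l (P, Q)" if "x = u \<or> x = u'" "l a < l x" "l x < l b" "a \<le> m" "b \<le> m" for x a b
    using arc_inner_interior[of P x Q a b] that assms o by auto
  note rf = rise_fall[of P u] rise_fall[of P u'] rise_fall[of u u'] rise_fall[of u Q] rise_fall[of u' Q]
    rise_fall[of P Q] l_neq[of P Q]
  \<comment> \<open>If the median is \<open>u\<close> or \<open>u'\<close>, it is inner and
    \<open>l w\<close> is on the same side of both labels; otherwise it is \<open>w\<close>, which
    lies off the arc.\<close>
  have "(mid l D \<in> arc_inner l (P, Q) \<and> (l u < l w) = (l u' < l w)) \<or>
     (mid l D = w \<and> (l u < l w \<and> l w < l u' \<or> l u' < l w \<and> l w < l u))"
    using assms(6)
  proof (elim disjE conjE)
    assume D: "D = (w, u, u')" "w < P"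
    then have "w < u" using assms by auto
    show ?thesis unfolding D(1)
      by (cases rule: mid_cases[OF \<open>w < u\<close> assms(2) \<open>u' \<le> m\<close>]) (use ins[of u w u'] ins[of u u' w] ins[of u' w u] ins[of u' u w] assms(5) o in auto)
  next
    assume D: "D = (u, u', w)" "Q < w"
    then have "u' < w" using assms by auto
    show ?thesis unfolding D(1)
      by (cases rule: mid_cases[OF assms(2) \<open>u' < w\<close> assms(5)]) (use ins[of u w u'] ins[of u u' w] ins[of u' w u] ins[of u' u w] assms(5) o in auto)
  qed
  \<comment> \<open>With \<open>l w\<close> between \<open>l u\<close> and \<open>l u'\<close>, the
    absence of valleys fixes the runs on which the vertices lie, and thereby the order of
    \<open>l P\<close> and \<open>l Q\<close>.\<close>
  moreover have "(l u < l w) = (l P < l Q)" if w: "l u < l w \<and> l w < l u' \<or> l u' < l w \<and> l w < l u"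
    using assms(6)
  proof (elim disjE conjE)
    assume "D = (w, u, u')" and "w < P"
    then have "w < u" "w < u'" using assms(1,2) by auto
    then have "l w < l u" using w rise[of w u] fall[of u u'] assms(2) o by (cases "u \<le> M") auto
    then have "l u' < l w" using w by auto
    then have "M < u'" using rise[of w u'] \<open>w < u'\<close> o by (cases "u' \<le> M") auto
    then have "l Q < l w" using fall[of u' Q] \<open>l u' < l w\<close> assms(3,4) by auto
    moreover have "l w < l P"
      using rise[of w P] fall[of P u] \<open>l w < l u\<close> \<open>w < P\<close> assms(1) o by (cases "P \<le> M") auto
    ultimately show ?thesis using \<open>l w < l u\<close> by auto
  next
    assume "D = (u, u', w)" and "Q < w"
    then have "u' < w" using assms(3) by auto
    then have "l w < l u'" using w rise[of u u'] fall[of u' w] assms(2,5) o by (cases "u' \<le> M") auto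
    then have "l u < l w" using w by auto
    then have "u \<le> M" using fall[of u u'] \<open>l w < l u'\<close> assms(2) o by (cases "u \<le> M") auto
    then have "l P < l w" using rise[of P u] \<open>l u < l w\<close> assms(1) o by auto
    moreover have "l w < l Q"
      using rise[of u' Q] fall[of Q w] \<open>l w < l u'\<close> \<open>Q < w\<close> assms(3-5) by (cases "Q \<le> M") auto
    ultimately show ?thesis using \<open>l u < l w\<close> by auto
  qed
  ultimately show
    "mid l D \<in> arc_inner l (P, Q) \<Longrightarrow> (l u < l w) = (l P < l Q) \<Longrightarrow> (l u' < l w) = (l P < l Q)"
    "mid l D \<notin> arc_inner l (P, Q) \<Longrightarrow> (l u < l w) \<noteq> (l P < l Q) \<Longrightarrow> (l u' < l w) \<noteq> (l P < l Q)"
    using nw by auto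
qed

text \<open>Now one corner is inside the arc and two are outside, and the median is inner exactly
  when it is \<open>u\<close>.\<close>

lemma crossing_middle_outside:
  assumes "P < u" "u < Q" "Q \<le> m" "w \<le> m" "w' \<le> m"
    "D = (w', w, u) \<and> w' < w \<and> w < P \<or> D = (w, u, w') \<and> w < P \<and> Q < w' \<or> D = (u, w', w) \<and> Q < w' \<and> w' < w"
  shows "mid l D \<in> arc_inner l (P, Q) \<Longrightarrow> (l u < l w) = (l P < l Q) \<Longrightarrow> (l u < l w') = (l P < l Q)"
    and "mid l D \<notin> arc_inner l (P, Q) \<Longrightarrow> (l u < l w) \<noteq> (l P < l Q) \<Longrightarrow> (l u < l w') \<noteq> (l P < l Q)"
proof -
  have nw: "w \<notin> arc_inner l (P, Q)" "w' \<notin> arc_inner l (P, Q)" using arc_inner_outside[of w P Q] arc_inner_outside[of w' P Q] assms by auto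
  have o: "P < Q" "u \<le> m" "P \<le> m" using assms by auto
  have ins: "u \<in> arc_inner l (P, Q)" if "l a < l u" "l u < l b" "a \<le> m" "b \<le> m" for a b
    using arc_inner_interior[of P u Q a b] that assms o by auto
  note rf = rise_fall[of P u] rise_fall[of u Q] rise_fall[of P Q] l_neq[of P Q]
  have "(mid l D \<notin> arc_inner l (P, Q) \<and> (l u < l w) = (l u < l w')) \<or>
     (mid l D \<in> arc_inner l (P, Q) \<and> (l w < l u \<and> l u < l w' \<or> l w' < l u \<and> l u < l w))"
    using assms(6)
  proof (elim disjE conjE)
    assume D: "D = (w', w, u)" "w' < w" "w < P"
    then have "w < u" using assms by auto
    show ?thesis unfolding D(1)
      by (cases rule: mid_cases[OF D(2) \<open>w < u\<close> \<open>u \<le> m\<close>]) (use ins[of w w'] ins[of w' w] nw assms(4,5) in auto)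
  next
    assume D: "D = (w, u, w')" "w < P" "Q < w'"
    then have "w < u" "u < w'" using assms by auto
    show ?thesis unfolding D(1)
      by (cases rule: mid_cases[OF \<open>w < u\<close> \<open>u < w'\<close> \<open>w' \<le> m\<close>]) (use ins[of w w'] ins[of w' w] nw assms(4,5) in auto)
  next
    assume D: "D = (u, w', w)" "Q < w'" "w' < w"
    then have "u < w'" using assms by auto
    show ?thesis unfolding D(1)
      by (cases rule: mid_cases[OF \<open>u < w'\<close> D(3) \<open>w \<le> m\<close>]) (use ins[of w w'] ins[of w' w] nw assms(4,5) in auto)
  qed
  moreover have "(l u < l w') = (l P < l Q)" if w: "l w < l u \<and> l u < l w' \<or> l w' < l u \<and> l u < l w"
  proof -
    have above: "l Q < l P" if "w < P" "l u < l w"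
    proof -
      have "M < u" using rise[of w u] that assms(1) o by (cases "u \<le> M") auto
      then have "l Q < l u" using fall[of u Q] assms(2,3) by auto
      moreover have "l u < l P"
        using rise[of w P] fall[of P u] that assms(1) o by (cases "P \<le> M") auto
      ultimately show ?thesis by auto
    qed
    have below: "l P < l Q" if "Q < w'" "l u < l w'"
    proof -
      have "u \<le> M" using fall[of u w'] that assms(2,5) by (cases "u \<le> M") auto
      then have "l P < l u" using rise[of P u] assms(1) o by auto
      moreover have "l u < l Q"
        using rise[of u Q] fall[of Q w'] that assms(2,3,5) by (cases "Q \<le> M") auto
      ultimately show ?thesis by auto
    qed
    show ?thesis
      using assms(6)
    proof (elim disjE conjE)
      assume "D = (w', w, u)" and o': "w' < w" "w < P"
      have "\<not> l w < l u \<or> \<not> l u < l w'"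
        using rise[of w' w] fall[of w u] o' assms(1) o by (cases "w \<le> M") auto
      then show ?thesis using w above[OF o'(2)] by auto
    next
      assume "D = (w, u, w')" and "w < P" "Q < w'"
      then show ?thesis using w above below by auto
    next
      assume "D = (u, w', w)" and o': "Q < w'" "w' < w"
      have "\<not> l w' < l u \<or> \<not> l u < l w"
        using rise[of u w'] fall[of w' w] o' assms(2,4,5) by (cases "w' \<le> M") auto
      then show ?thesis using w below[OF o'(1)] by auto
    qed
  qed
  ultimately show
    "mid l D \<in> arc_inner l (P, Q) \<Longrightarrow> (l u < l w) = (l P < l Q) \<Longrightarrow> (l u < l w') = (l P < l Q)"
    "mid l D \<notin> arc_inner l (P, Q) \<Longrightarrow> (l u < l w) \<noteq> (l P < l Q) \<Longrightarrow> (l u < l w') \<noteq> (l P < l Q)"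
    by auto
qed

end

section \<open>The functionals that separate triangulations\<close>

context unimodal_labels
begin

text \<open>For \<open>up\<close> the set is a down-set of the spine, otherwise an up-set. The two
  clauses treat a chord that is the left or the right child of its parent triangle.\<close>

definition closed_under_spine :: "nat set \<Rightarrow> bool \<Rightarrow> btree \<Rightarrow> bool" where
  "closed_under_spine B up t \<longleftrightarrow>
     (\<forall>x y z s. ((x, y, z) \<in> tris 0 t \<longrightarrow> (x, s, y) \<in> tris 0 t \<longrightarrow>
        (if (l x < l y) = up then mid l (x, y, z) \<in> B \<longrightarrow> mid l (x, s, y) \<in> B
         else mid l (x, s, y) \<in> B \<longrightarrow> mid l (x, y, z) \<in> B)) \<and>
      ((z, x, y) \<in> tris 0 t \<longrightarrow> (x, s, y) \<in> tris 0 t \<longrightarrow>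
        (if (l x < l y) = up then mid l (z, x, y) \<in> B \<longrightarrow> mid l (x, s, y) \<in> B
         else mid l (x, s, y) \<in> B \<longrightarrow> mid l (z, x, y) \<in> B)))"

text \<open>Walk along \<open>(P, Q)\<close> and take \<open>l P < l Q\<close>; the other case is
  the mirror image. At \<open>P\<close> a triangle is inner iff the walk leaves it downwards, by
  closure the next one is inner iff it was entered downwards, and the crossing lemmas turn this into
  being left downwards. At \<open>Q\<close> the last triangle would be inner iff it was entered
  upwards.\<close>

lemma closed_under_spine_imp_chord:
  assumes t: "leaves t = m" and PQ: "P < Q" "Q \<le> m"
    and cl: "closed_under_spine (arc_inner l (P, Q)) (l P < l Q) t"
  shows "(P, Q) \<in> ivals 0 t"
proof (rule ccontr)
  assume not: "(P, Q) \<notin> ivals 0 t"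
  let ?I = "arc_inner l (P, Q)"
  have bnd: "x < r \<and> r < y \<and> y \<le> m" if "(x, r, y) \<in> tris 0 t" for x r y
    using tris_bounds[OF that] t by auto
  have clR: "((l x < l y) = (l P < l Q) \<longrightarrow> mid l (x, y, z) \<in> ?I \<longrightarrow> mid l (x, s, y) \<in> ?I) \<and>
      ((l x < l y) \<noteq> (l P < l Q) \<longrightarrow> mid l (x, s, y) \<in> ?I \<longrightarrow> mid l (x, y, z) \<in> ?I)"
    if "(x, y, z) \<in> tris 0 t" "(x, s, y) \<in> tris 0 t" for x y z s
    using cl that unfolding closed_under_spine_def by meson
  have clL: "((l x < l y) = (l P < l Q) \<longrightarrow> mid l (z, x, y) \<in> ?I \<longrightarrow> mid l (x, s, y) \<in> ?I) \<and>
      ((l x < l y) \<noteq> (l P < l Q) \<longrightarrow> mid l (x, s, y) \<in> ?I \<longrightarrow> mid l (z, x, y) \<in> ?I)"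
    if "(z, x, y) \<in> tris 0 t" "(x, s, y) \<in> tris 0 t" for x y z s
    using cl that unfolding closed_under_spine_def by meson
  have flip: "(l x < l y) \<noteq> (l y < l x)" if "x < y" "y \<le> m" for x y
    using l_neq[OF that] by linarith
  \<comment> \<open>The walk from \<open>P\<close> through the triangles inside the arc
    \<open>(p, r)\<close>; the triangle on \<open>(p, r)\<close> is the last of them and is left
    through this chord.\<close>
  have left: "mid l (p, s, r) \<in> ?I \<longleftrightarrow> (l r < l p) = (l P < l Q)"
    if "(p, s, r) \<in> tris 0 t" "p < P" "P < r" "r < Q" for p s r
    using that
  proof (induction "r - p" arbitrary: p s r rule: less_induct)
    case less
    note D = less.prems(1) and o = less.prems(2-4)
    have b: "p < s" "s < r" "r \<le> m" using bnd[OF D] by auto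
    have sides: "(p, s) \<in> ivals 0 t" "(s, r) \<in> ivals 0 t" using D by (auto simp: tris_ivals)
    consider "s = P" | "P < s" | "s < P" by linarith
    then show ?case
    proof cases
      case 1
      then show ?thesis using crossing_start(2)[OF o PQ(2)] by blast
    next
      case 2
      obtain k where k: "(p, k, s) \<in> tris 0 t"
        using ivals_split[OF sides(1)] 2 o by auto
      have IH: "mid l (p, k, s) \<in> ?I \<longleftrightarrow> (l s < l p) = (l P < l Q)"
        using less.hyps[OF _ k] 2 b o by auto
      have fl: "(l p < l s) \<noteq> (l s < l p)" by (rule flip) (use b in auto)
      have "mid l (p, s, r) \<in> ?I \<longleftrightarrow> (l s < l p) = (l P < l Q)"
        using IH clR[OF D k] fl by blast
      moreover have pm: "p \<le> m" "(p, s, r) = (p, s, r) \<and> p < P \<or> (p, s, r) = (s, r, p) \<and> Q < p"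
        using 2 b o PQ by auto
      note crossing_middle_inside[OF 2 b(2) o(3) PQ(2) pm]
      ultimately show ?thesis by blast
    next
      case 3
      obtain k where k: "(s, k, r) \<in> tris 0 t"
        using ivals_split[OF sides(2)] 3 o by auto
      have IH: "mid l (s, k, r) \<in> ?I \<longleftrightarrow> (l r < l s) = (l P < l Q)"
        using less.hyps[OF _ k] 3 b o by auto
      have fl: "(l s < l r) \<noteq> (l r < l s)" by (rule flip) (use b in auto)
      have "mid l (p, s, r) \<in> ?I \<longleftrightarrow> (l r < l s) = (l P < l Q)"
        using IH clL[OF D k] fl by blast
      moreover have pm: "s \<le> m" "p \<le> m"
        "(p, s, r) = (p, s, r) \<and> p < s \<and> s < P \<or> (p, s, r) = (s, r, p) \<and> s < P \<and> Q < p \<or> (p, s, r) = (r, p, s) \<and> Q < p \<and> p < s"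
        using 3 b o PQ by auto
      note crossing_middle_outside[OF o(2,3) PQ(2) pm]
      ultimately show ?thesis by blast
    qed
  qed
  \<comment> \<open>The same walk read backwards from \<open>Q\<close>; the opposite sign is that of
    \<open>crossing_end\<close>.\<close>
  have right: "mid l (r, s, q) \<in> ?I \<longleftrightarrow> (l r < l q) \<noteq> (l P < l Q)"
    if "(r, s, q) \<in> tris 0 t" "P < r" "r < Q" "Q < q" for r s q
    using that
  proof (induction "q - r" arbitrary: r s q rule: less_induct)
    case less
    note D = less.prems(1) and o = less.prems(2-4)
    have b: "r < s" "s < q" "q \<le> m" using bnd[OF D] by auto
    have sides: "(r, s) \<in> ivals 0 t" "(s, q) \<in> ivals 0 t" using D by (auto simp: tris_ivals)
    consider "s = Q" | "Q < s" | "s < Q" by linarith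
    then show ?case
    proof cases
      case 1
      then show ?thesis using crossing_end(1)[OF o b(3)] by blast
    next
      case 2
      obtain k where k: "(r, k, s) \<in> tris 0 t"
        using ivals_split[OF sides(1)] 2 o by auto
      have IH: "mid l (r, k, s) \<in> ?I \<longleftrightarrow> (l r < l s) \<noteq> (l P < l Q)"
        using less.hyps[OF _ k] 2 b o by auto
      have "mid l (r, s, q) \<in> ?I \<longleftrightarrow> (l r < l s) \<noteq> (l P < l Q)"
        using IH clR[OF D k] by blast
      moreover have pm: "q \<le> m" "s \<le> m"
        "(r, s, q) = (s, q, r) \<and> s < q \<and> q < P \<or> (r, s, q) = (q, r, s) \<and> q < P \<and> Q < s \<or> (r, s, q) = (r, s, q) \<and> Q < s \<and> s < q"
        using 2 b o PQ by auto
      note crossing_middle_outside[OF o(1,2) PQ(2) pm]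
      ultimately show ?thesis by blast
    next
      case 3
      obtain k where k: "(s, k, q) \<in> tris 0 t"
        using ivals_split[OF sides(2)] 3 o by auto
      have IH: "mid l (s, k, q) \<in> ?I \<longleftrightarrow> (l s < l q) \<noteq> (l P < l Q)"
        using less.hyps[OF _ k] 3 b o by auto
      have "mid l (r, s, q) \<in> ?I \<longleftrightarrow> (l s < l q) \<noteq> (l P < l Q)"
        using IH clL[OF D k] by blast
      moreover have pm: "q \<le> m" "(r, s, q) = (q, r, s) \<and> q < P \<or> (r, s, q) = (r, s, q) \<and> Q < q"
        using 3 b o PQ by auto
      note crossing_middle_inside[OF o(1) b(1) 3 PQ(2) pm]
      ultimately show ?thesis by blast
    qed
  qed
  \<comment> \<open>The least interval that covers both \<open>P\<close> and \<open>Q\<close> splits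
    strictly between them; its triangle is where the two walks meet.\<close>
  define X where "X = {(p, q) \<in> ivals 0 t. p \<le> P \<and> Q \<le> q}"
  have "(0, m) \<in> X" using ivals_root[of 0 t] t PQ by (simp add: X_def)
  then obtain p q where pq: "(p, q) \<in> X" "\<And>p' q'. (p', q') \<in> X \<Longrightarrow> q - p \<le> q' - p'"
    using ex_has_least_nat[of "\<lambda>e. e \<in> X" "(0, m)" "\<lambda>(p, q). q - p"] by auto
  then have e: "(p, q) \<in> ivals 0 t" "p \<le> P" "Q \<le> q" by (auto simp: X_def)
  then have "(p, q) \<noteq> (P, Q)" using not by auto
  then have "Suc p < q" using e PQ by auto
  then obtain r where D: "(p, r, q) \<in> tris 0 t" using ivals_split[OF e(1)] by blast
  have b: "p < r" "r < q" "q \<le> m" using bnd[OF D] by auto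
  have sides: "(p, r) \<in> ivals 0 t" "(r, q) \<in> ivals 0 t" using D by (auto simp: tris_ivals)
  have "(p, r) \<notin> X" "(r, q) \<notin> X" using pq(2)[of p r] pq(2)[of r q] b by auto
  then have r: "P < r" "r < Q" using sides e by (auto simp: X_def)
  have L: "mid l (p, r, q) \<in> ?I \<longleftrightarrow> (l r < l p) = (l P < l Q)" if pP: "p < P"
  proof -
    obtain k where k: "(p, k, r) \<in> tris 0 t" using ivals_split[OF sides(1)] pP r by auto
    have "(l p < l r) \<noteq> (l r < l p)" by (rule flip) (use b in auto)
    then show ?thesis using clR[OF D k] left[OF k pP r] by blast
  qed
  have R: "mid l (p, r, q) \<in> ?I \<longleftrightarrow> (l r < l q) \<noteq> (l P < l Q)" if Qq: "Q < q"
  proof -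
    obtain k where k: "(r, k, q) \<in> tris 0 t" using ivals_split[OF sides(2)] Qq r by auto
    show ?thesis using clL[OF D k] right[OF k r Qq] by blast
  qed
  consider "p = P" "Q < q" | "p < P" "q = Q" | "p < P" "Q < q"
    using e \<open>(p, q) \<noteq> (P, Q)\<close> by (cases "p = P"; cases "q = Q") auto
  then show False
  proof cases
    case 1
    then show ?thesis using crossing_start(1)[OF r 1(2) b(3)] R[OF 1(2)] by blast
  next
    case 2
    then show ?thesis using crossing_end(2)[OF 2(1) r PQ(2)] L[OF 2(1)] by blast
  next
    case 3
    then have pm: "p \<le> m" "q \<le> m" "(p, r, q) = (q, p, r) \<and> q < p \<and> p < P \<or> (p, r, q) = (p, r, q) \<and> p < P \<and> Q < q \<or> (p, r, q) = (r, q, p) \<and> Q < q \<and> q < p"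
      using b by auto
    show ?thesis
      using crossing_middle_outside[OF r PQ(2) pm] L[OF 3(1)] R[OF 3(2)] by blast
  qed
qed

text \<open>The functional is the sum over the labels below the chord, or minus the sum over those
  above it. As the sum of all coordinates is constant, minimising it means minimising the part below
  in both cases.\<close>

definition arc_sign :: "nat \<times> nat \<Rightarrow> nat \<Rightarrow> real" where
  "arc_sign e v = (if v \<in> arc_inner l e then if l (fst e) < l (snd e) then 1 else - 1 else 0)"

definition arc_bound :: "nat \<times> nat \<Rightarrow> real" where
  "arc_bound e = (if l (fst e) < l (snd e) then 1 else - 1) * arc_val l m e"

text \<open>The subtree over \<open>(P, Q)\<close> uses exactly the inner labels of the arc, and
  injectivity of \<open>mid\<close> keeps all other triangles out.\<close>

lemma tree_weight_chord:
  assumes "leaves t = m" "(P, Q) \<in> ivals 0 t"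
  shows "tree_weight (arc_sign (P, Q)) t = arc_bound (P, Q)"
proof -
  obtain u where u: "P + leaves u = Q" "tris P u \<subseteq> tris 0 t"
    using subtree_at[OF assms(2)] by blast
  have "Q \<le> m" using ivals_bounds[OF assms(2)] assms(1) by auto
  have bt: "inj_on (mid l) (tris 0 t)"
    using mid_bij_betw[of 0 t] assms(1) by (auto simp: bij_betw_def)
  have bu: "mid l ` tris P u = arc_inner l (P, Q)"
    using mid_bij_betw[of P u] u(1) \<open>Q \<le> m\<close> by (auto simp: bij_betw_def)
  have "mid l D \<notin> arc_inner l (P, Q)" if "D \<in> tris 0 t - tris P u" for D
  proof
    assume "mid l D \<in> arc_inner l (P, Q)"
    then obtain D' where "D' \<in> tris P u" "mid l D = mid l D'" using bu by blast
    then show False using that u(2) bt by (metis DiffE inj_onD subsetD)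
  qed
  then have "tree_weight (arc_sign (P, Q)) t =
      (\<Sum>D\<in>tris P u. arc_sign (P, Q) (mid l D) * tri_val l m D)"
    unfolding tree_weight_def
    by (intro sum.mono_neutral_right u(2)) (simp_all add: arc_sign_def)
  also have "\<dots> = (\<Sum>D\<in>tris P u. (if l P < l Q then 1 else - 1) * tri_val l m D)"
    using bu by (intro sum.cong refl) (auto simp: arc_sign_def)
  also have "\<dots> = arc_bound (P, Q)"
    using sum_tri_val[of P u] u(1) \<open>Q \<le> m\<close> by (simp add: arc_bound_def flip: sum_distrib_left)
  finally show ?thesis .
qed

lemma minimal_tree_chord:
  assumes "leaves t = m" "\<And>t'. leaves t' = m \<Longrightarrow> tree_weight (arc_sign (P, Q)) t \<le> tree_weight (arc_sign (P, Q)) t'"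
    and "P < Q" "Q \<le> m"
  shows "(P, Q) \<in> ivals 0 t"
proof (rule closed_under_spine_imp_chord[OF assms(1,3,4)])
  show "closed_under_spine (arc_inner l (P, Q)) (l P < l Q) t"
    unfolding closed_under_spine_def
  proof (intro allI conjI impI)
    fix x y z s
    assume "(x, y, z) \<in> tris 0 t" "(x, s, y) \<in> tris 0 t"
    from minimal_tree_right[OF assms(1,2) this]
    show "if (l x < l y) = (l P < l Q) then mid l (x, y, z) \<in> arc_inner l (P, Q) \<longrightarrow> mid l (x, s, y) \<in> arc_inner l (P, Q)
         else mid l (x, s, y) \<in> arc_inner l (P, Q) \<longrightarrow> mid l (x, y, z) \<in> arc_inner l (P, Q)"
      by (auto simp: arc_sign_def split: if_splits)
  next
    fix x y z s
    assume "(z, x, y) \<in> tris 0 t" "(x, s, y) \<in> tris 0 t"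
    from minimal_tree_left[OF assms(1,2) this]
    show "if (l x < l y) = (l P < l Q) then mid l (z, x, y) \<in> arc_inner l (P, Q) \<longrightarrow> mid l (x, s, y) \<in> arc_inner l (P, Q)
         else mid l (x, s, y) \<in> arc_inner l (P, Q) \<longrightarrow> mid l (z, x, y) \<in> arc_inner l (P, Q)"
      by (auto simp: arc_sign_def split: if_splits)
  qed
qed

text \<open>No tree through the chord is constructed: some minimiser exists by finiteness, it must
  contain the chord, and all trees that contain it share the value
  \<open>arc_bound (P, Q)\<close>.\<close>

lemma tree_weight_arc:
  assumes "leaves t = m" "P < Q" "Q \<le> m"
  shows "arc_bound (P, Q) \<le> tree_weight (arc_sign (P, Q)) t"
    and "tree_weight (arc_sign (P, Q)) t = arc_bound (P, Q) \<longleftrightarrow> (P, Q) \<in> ivals 0 t"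
proof -
  let ?w = "tree_weight (arc_sign (P, Q))"
  have "t \<in> trees m" using assms(1) by (simp add: trees_def)
  then have "Min (?w ` trees m) \<in> ?w ` trees m" by (intro Min_in) auto
  then obtain t0 where t0': "t0 \<in> trees m" "?w t0 = Min (?w ` trees m)" by auto
  have t0: "leaves t0 = m" "\<And>t'. leaves t' = m \<Longrightarrow> ?w t0 \<le> ?w t'"
  proof -
    show "leaves t0 = m" using t0'(1) by (simp add: trees_def)
    fix t' assume "leaves t' = m"
    then have "t' \<in> trees m" by (simp add: trees_def)
    then show "?w t0 \<le> ?w t'" unfolding t0'(2) by simp
  qed
  have "(P, Q) \<in> ivals 0 t0" by (rule minimal_tree_chord[OF t0 assms(2,3)])
  then have w0: "?w t0 = arc_bound (P, Q)" by (rule tree_weight_chord[OF t0(1)])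
  then show "arc_bound (P, Q) \<le> ?w t" using t0(2)[OF assms(1)] by simp
  show "?w t = arc_bound (P, Q) \<longleftrightarrow> (P, Q) \<in> ivals 0 t"
  proof
    assume "?w t = arc_bound (P, Q)"
    then show "(P, Q) \<in> ivals 0 t"
      using minimal_tree_chord[OF assms(1) _ assms(2,3)] t0(2) w0 by simp
  qed (rule tree_weight_chord[OF assms(1)])
qed

text \<open>Every summand is minimal at \<open>t\<close>. By maximality a different tree misses a
  chord of \<open>t\<close>, and the summand of that chord is strictly larger there.\<close>

lemma tree_weight_unique_min:
  assumes "leaves t = m" "leaves t' = m" "t' \<noteq> t"
  shows "tree_weight (\<lambda>v. \<Sum>e\<in>ivals 0 t. arc_sign e v) t < tree_weight (\<lambda>v. \<Sum>e\<in>ivals 0 t. arc_sign e v) t'"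
proof -
  have w: "tree_weight (\<lambda>v. \<Sum>e\<in>ivals 0 t. arc_sign e v) u = (\<Sum>e\<in>ivals 0 t. tree_weight (arc_sign e) u)" for u
    unfolding tree_weight_def sum_distrib_right by (rule sum.swap)
  have b: "P < Q" "Q \<le> m" if "(P, Q) \<in> ivals 0 t" for P Q
    using ivals_bounds[OF that] assms(1) by auto
  have "\<not> ivals 0 t \<subseteq> ivals 0 t'"
  proof
    assume sub: "ivals 0 t \<subseteq> ivals 0 t'"
    have "ivals 0 t = ivals 0 t'"
    proof (intro antisym sub subsetI)
      fix e assume e: "e \<in> ivals 0 t'"
      obtain x y where xy: "e = (x, y)" by (cases e)
      show "e \<in> ivals 0 t"
        unfolding xy
      proof (rule ivals_maximal)
        show "0 \<le> x" "x < y" "y \<le> 0 + leaves t" using ivals_bounds[of x y 0 t'] e xy assms by auto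
        show "\<not> interleaved (x, y) (u, v) \<and> \<not> interleaved (u, v) (x, y)" if "(u, v) \<in> ivals 0 t" for u v
          using ivals_not_interleaved[of x y 0 t' u v] ivals_not_interleaved[of u v 0 t' x y] that sub e xy by auto
      qed
    qed
    then show False using ivals_inj[of t t' 0] assms by simp
  qed
  then obtain e where e: "e \<in> ivals 0 t" "e \<notin> ivals 0 t'" by blast
  have le: "tree_weight (arc_sign e) t \<le> tree_weight (arc_sign e) t'" if "e \<in> ivals 0 t" for e
    using that tree_weight_chord[of t "fst e" "snd e"] tree_weight_arc(1)[of t' "fst e" "snd e"]
      b[of "fst e" "snd e"] assms by simp
  have "tree_weight (arc_sign e) t < tree_weight (arc_sign e) t'"
    using e tree_weight_chord[of t "fst e" "snd e"] tree_weight_arc[of t' "fst e" "snd e"]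
      b[of "fst e" "snd e"] assms by (simp add: order_less_le)
  then have "(\<Sum>e\<in>ivals 0 t. tree_weight (arc_sign e) t) < (\<Sum>e\<in>ivals 0 t. tree_weight (arc_sign e) t')"
    using le e by (intro sum_strict_mono_ex1) auto
  then show ?thesis unfolding w .
qed

end

section \<open>Coordinates and their sums over all trees\<close>

context unimodal_labels
begin

text \<open>For an inner label of a tree with \<open>m\<close> leaves the sum has a single term;
  written as a sum, it can be exchanged with the sum over trees.\<close>

definition tree_coord :: "btree \<Rightarrow> nat \<Rightarrow> real" where
  "tree_coord t v = (\<Sum>D | D \<in> tris 0 t \<and> mid l D = v. tri_val l m D)"

definition triples :: "(nat \<times> nat \<times> nat) set" where
  "triples = {(p, r, q). p < r \<and> r < q \<and> q \<le> m}"

definition tri_count :: "nat \<times> nat \<times> nat \<Rightarrow> real" where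
  "tri_count = (\<lambda>(p, r, q). num_trees (r - p) * num_trees (q - r) * num_trees (m + 1 - (q - p)))"

lemma finite_triples [simp]: "finite triples"
  by (rule finite_subset[of _ "{..m} \<times> {..m} \<times> {..m}"]) (auto simp: triples_def)

lemma sum_trees_tris:
  fixes F :: "nat \<times> nat \<times> nat \<Rightarrow> real"
  shows "(\<Sum>t\<in>trees m. \<Sum>D | D \<in> tris 0 t \<and> mid l D = v. F D) =
    (\<Sum>D | D \<in> triples \<and> mid l D = v. F D * tri_count D)"
proof -
  let ?T = "{D \<in> triples. mid l D = v}"
  have sub: "tris 0 t \<subseteq> triples" if "t \<in> trees m" for t
    using that by (auto simp: trees_def triples_def dest: tris_bounds)
  have "(\<Sum>t\<in>trees m. \<Sum>D | D \<in> tris 0 t \<and> mid l D = v. F D) =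
      (\<Sum>t\<in>trees m. \<Sum>D\<in>?T. F D * of_bool (D \<in> tris 0 t))"
  proof (rule sum.cong[OF refl])
    fix t assume t: "t \<in> trees m"
    have "{D. D \<in> tris 0 t \<and> mid l D = v} = {D \<in> ?T. D \<in> tris 0 t}"
      using sub[OF t] by auto
    then have "(\<Sum>D | D \<in> tris 0 t \<and> mid l D = v. F D) = (\<Sum>D | D \<in> ?T \<and> D \<in> tris 0 t. F D)"
      by simp
    also have "\<dots> = (\<Sum>D\<in>?T. if D \<in> tris 0 t then F D else 0)"
      by (rule sum.inter_filter) simp
    also have "\<dots> = (\<Sum>D\<in>?T. F D * of_bool (D \<in> tris 0 t))"
      by (intro sum.cong refl) simp
    finally show "(\<Sum>D | D \<in> tris 0 t \<and> mid l D = v. F D) = (\<Sum>D\<in>?T. F D * of_bool (D \<in> tris 0 t))" .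
  qed
  also have "\<dots> = (\<Sum>D\<in>?T. F D * (\<Sum>t\<in>trees m. of_bool (D \<in> tris 0 t)))"
    by (subst sum.swap) (simp only: sum_distrib_left)
  also have "\<dots> = (\<Sum>D\<in>?T. F D * tri_count D)"
  proof (rule sum.cong[OF refl])
    fix D assume "D \<in> ?T"
    then obtain p r q where "D = (p, r, q)" "p < r" "r < q" "q \<le> m" by (auto simp: triples_def)
    then show "F D * (\<Sum>t\<in>trees m. of_bool (D \<in> tris 0 t)) = F D * tri_count D"
      using num_trees_with_tri[of 0 p r q m] by (simp add: tri_count_def)
  qed
  finally show ?thesis .
qed

lemma sum_tri_count:
  assumes "v \<in> arc_inner l (0, m)"
  shows "(\<Sum>D | D \<in> triples \<and> mid l D = v. tri_count D) = num_trees m"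
proof -
  have "(\<Sum>D | D \<in> tris 0 t \<and> mid l D = v. 1 :: real) = 1" if "t \<in> trees m" for t
  proof -
    have bij: "bij_betw (mid l) (tris 0 t) (arc_inner l (0, m))"
      using mid_bij_betw[of 0 t] that by (simp add: trees_def)
    then have "v \<in> mid l ` tris 0 t" using assms by (simp add: bij_betw_def)
    then obtain D where "D \<in> tris 0 t" "mid l D = v" by blast
    moreover have "D' = D" if "D' \<in> tris 0 t" "mid l D' = v" for D'
      using inj_onD[OF bij_betw_imp_inj_on[OF bij], of D' D] that \<open>D \<in> tris 0 t\<close> \<open>mid l D = v\<close> by simp
    ultimately have "{D. D \<in> tris 0 t \<and> mid l D = v} = {D}" by blast
    then show ?thesis by simp
  qed
  then have "num_trees m = (\<Sum>t\<in>trees m. \<Sum>D | D \<in> tris 0 t \<and> mid l D = v. 1)"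
    by (simp add: num_trees_def)
  then show ?thesis unfolding sum_trees_tris by simp
qed

fun mid_product :: "nat \<Rightarrow> nat \<times> nat \<times> nat \<Rightarrow> real" where
  "mid_product v (p, r, q) =
     (if v = r then real (r - p) * real (q - r)
      else if v = p then real (m + 1 - (q - p)) * real (r - p)
      else real (q - r) * real (m + 1 - (q - p)))"

text \<open>\<open>tri_val\<close> decides between down and up by comparing labels; unimodality
  turns this into the position relative to \<open>M\<close>.\<close>

lemma tri_val_mid_product:
  assumes "D \<in> triples" "mid l D = v"
  shows "tri_val l m D = (if v \<le> M then mid_product v D else real m - mid_product v D)"
proof -
  obtain p r q where D: "D = (p, r, q)" and o: "p < r" "r < q" "q \<le> m"
    using assms(1) by (auto simp: triples_def)
  have e: "real (r - p) = real r - real p" "real (q - r) = real q - real r"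
    "real (m + 1 - (q - p)) = real m + 1 - (real q - real p)"
    using o by (auto simp: of_nat_diff)
  have rf: "(r \<le> M \<longrightarrow> l p < l r) \<and> (M < p \<longrightarrow> l r < l p)" "(q \<le> M \<longrightarrow> l r < l q) \<and> (M < r \<longrightarrow> l q < l r)"
    "(q \<le> M \<longrightarrow> l p < l q) \<and> (M < p \<longrightarrow> l q < l p)"
    using rise_fall[of p r] rise_fall[of r q] rise_fall[of p q] o by auto
  show ?thesis
  proof (cases rule: mid_cases[OF o])
    case 1
    then have "v = r" using assms(2) D by simp
    have "if r \<le> M then l p < l r \<and> l r < l q else l q < l r \<and> l r < l p" using 1(2) rf by auto
    then show ?thesis using \<open>v = r\<close> unfolding D by (auto simp: tri_val.simps Let_def e split: if_splits)
  next
    case 2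
    then have "v = p" using assms(2) D by simp
    have "p \<le> M \<and> l q < l p \<and> l p < l r" using 2(2) rf o by auto
    then show ?thesis using \<open>v = p\<close> o unfolding D by (auto simp: tri_val.simps Let_def e)
  next
    case 3
    then have "v = q" using assms(2) D by simp
    have "M < q \<and> l p < l q \<and> l q < l r" using 3(2) rf o by auto
    then show ?thesis using \<open>v = q\<close> o unfolding D by (auto simp: tri_val.simps Let_def e)
  qed
qed

lemma mid_eq_iff:
  assumes "p < r" "r < q" "q \<le> m"
  shows "mid l (p, r, q) = v \<longleftrightarrow> (v = r \<and> (l p < l r \<longleftrightarrow> l r < l q)) \<or> (v = p \<and> (l r < l p \<longleftrightarrow> l p < l q))
    \<or> (v = q \<and> (l r < l q \<longleftrightarrow> l q < l p))"
  using assms by (cases rule: mid_cases[OF assms]) auto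

text \<open>The positions with a label above \<open>l v\<close> form a block adjacent to
  \<open>v\<close>, and a triangle has middle \<open>v\<close> iff one of its other corners is in
  the block and one outside. The distances to them, measured in opposite directions around the
  polygon, run independently through \<open>{1..s}\<close> and \<open>{1..r}\<close>.\<close>

lemma sum_mid_product:
  assumes "v \<in> arc_inner l (0, m)"
  shows "(\<Sum>D | D \<in> triples \<and> mid l D = v. mid_product v D * tri_count D) = real m / 2 * num_trees m"
proof -
  let ?g = "\<lambda>(a, b). real a * real b * num_trees a * num_trees b * num_trees (m + 1 - a - b)"
  obtain x0 y0 where xy: "v \<le> m" "x0 \<le> m" "y0 \<le> m" "l x0 < l v" "l v < l y0"
    using assms by (auto simp: arc_inner_def)
  have "\<exists>s r. s \<ge> 1 \<and> r \<ge> 1 \<and> s + r = m \<and>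
    (\<Sum>D | D \<in> triples \<and> mid l D = v. mid_product v D * tri_count D) = sum ?g ({1..s} \<times> {1..r})"
  proof (cases "v \<le> M")
    case True
    define k where "k = Max {x. x \<le> m \<and> l v < l x}"
    have fin: "finite {x. x \<le> m \<and> l v < l x}" by auto
    have ne: "{x. x \<le> m \<and> l v < l x} \<noteq> {}" using xy by auto
    have k: "k \<le> m" "l v < l k" "\<And>x. x \<le> m \<Longrightarrow> l v < l x \<Longrightarrow> x \<le> k"
      using Max_in[OF fin ne] Max_ge[OF fin] unfolding k_def by auto
    have "v < k" using k(2) rise[of k v] True xy(1) by (cases "k < v"; cases "k = v") auto
    have large: "l v < l x" if "v < x" "x \<le> k" for x
      using that k rise[of v x] fall[of x k] by (cases "x \<le> M"; cases "x = k") auto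
    have small: "l x < l v" if "x < v \<or> k < x" "x \<le> m" for x
    proof (cases "x < v")
      case False
      then show ?thesis using that k(3)[of x] l_neq[of v x] \<open>v < k\<close> by linarith
    qed (use rise True xy(1) in auto)
    have cmp: "(l v < l x \<longleftrightarrow> v < x \<and> x \<le> k) \<and> (l x < l v \<longleftrightarrow> \<not> (v < x \<and> x \<le> k))" if "x \<le> m" "x \<noteq> v" for x
      using that large[of x] small[of x] by (cases "v < x \<and> x \<le> k") auto
    have iff: "mid l (p, r, q) = v \<longleftrightarrow> r = v \<and> q \<le> k \<or> p = v \<and> r \<le> k \<and> k < q"
      if "p < r" "r < q" "q \<le> m" for p r q
      unfolding mid_eq_iff[OF that]
      using that cmp[of p] cmp[of r] cmp[of q]
      by (cases "v = r"; cases "v = p"; cases "v = q") auto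
    have set_eq: "{D. D \<in> triples \<and> mid l D = v} =
        {(p, r, q). p < r \<and> r < q \<and> q \<le> m \<and> (r = v \<and> q \<le> k \<or> p = v \<and> r \<le> k \<and> k < q)}" (is "?L = ?R")
    proof (rule set_eqI)
      fix D :: "nat \<times> nat \<times> nat"
      obtain p r q where D: "D = (p, r, q)" by (cases D)
      show "D \<in> ?L \<longleftrightarrow> D \<in> ?R"
        unfolding D triples_def mem_Collect_eq prod.case using iff[of p r q] by blast
    qed
    \<comment> \<open>Going backwards from \<open>v\<close>, a distance \<open>a > v\<close> wraps
      around past position 0 to the corner \<open>m + 1 + v - a\<close>.\<close>
    have "(\<Sum>D | D \<in> triples \<and> mid l D = v. mid_product v D * tri_count D)
       = sum ?g ({1..v + (m - k)} \<times> {1..k - v})"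
      unfolding set_eq
      by (rule sum.reindex_bij_witness[of _
            "\<lambda>(a, b). if a \<le> v then (v - a, v, v + b) else (v, v + b, m + 1 + v - a)"
            "\<lambda>(p, r, q). if r = v then (v - p, q - v) else (m + 1 - q + v, r - v)"])
         (use \<open>v < k\<close> k(1) in \<open>auto simp: tri_count_def split: if_splits\<close>)
    moreover have "v + (m - k) \<ge> 1"
    proof -
      have "x0 \<noteq> v" "\<not> (v < x0 \<and> x0 \<le> k)" using large[of x0] xy(4) by auto
      then show ?thesis using xy(2) by arith
    qed
    ultimately show ?thesis using \<open>v < k\<close> k(1) by (intro exI[of _ "v + (m - k)"] exI[of _ "k - v"]) auto
  next
    case False
    define k where "k = Min {x. x \<le> m \<and> l v < l x}"
    have fin: "finite {x. x \<le> m \<and> l v < l x}" by auto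
    have ne: "{x. x \<le> m \<and> l v < l x} \<noteq> {}" using xy by auto
    have k: "k \<le> m" "l v < l k" "\<And>x. x \<le> m \<Longrightarrow> l v < l x \<Longrightarrow> k \<le> x"
      using Min_in[OF fin ne] Min_le[OF fin] unfolding k_def by auto
    have "k < v" using k(1,2) fall[of v k] False xy(1) by (cases "v < k"; cases "k = v") auto
    have large: "l v < l x" if "k \<le> x" "x < v" for x
      using that k rise[of k x] fall[of x v] xy(1) by (cases "x \<le> M"; cases "x = k") auto
    have small: "l x < l v" if "x < k \<or> v < x" "x \<le> m" for x
    proof (cases "v < x")
      case False
      then show ?thesis using that k(3)[of x] l_neq[of x v] \<open>k < v\<close> xy(1) by linarith
    qed (use fall False that in auto)
    have cmp: "(l v < l x \<longleftrightarrow> k \<le> x \<and> x < v) \<and> (l x < l v \<longleftrightarrow> \<not> (k \<le> x \<and> x < v))" if "x \<le> m" "x \<noteq> v" for x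
      using that large[of x] small[of x] by (cases "k \<le> x \<and> x < v") auto
    have iff: "mid l (p, r, q) = v \<longleftrightarrow> r = v \<and> k \<le> p \<or> q = v \<and> p < k \<and> k \<le> r"
      if "p < r" "r < q" "q \<le> m" for p r q
      unfolding mid_eq_iff[OF that]
      using that cmp[of p] cmp[of r] cmp[of q]
      by (cases "v = r"; cases "v = p"; cases "v = q") auto
    have set_eq: "{D. D \<in> triples \<and> mid l D = v} =
        {(p, r, q). p < r \<and> r < q \<and> q \<le> m \<and> (r = v \<and> k \<le> p \<or> q = v \<and> p < k \<and> k \<le> r)}" (is "?L = ?R")
    proof (rule set_eqI)
      fix D :: "nat \<times> nat \<times> nat"
      obtain p r q where D: "D = (p, r, q)" by (cases D)
      show "D \<in> ?L \<longleftrightarrow> D \<in> ?R"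
        unfolding D triples_def mem_Collect_eq prod.case using iff[of p r q] by blast
    qed
    \<comment> \<open>Mirror image on the falling run: a forward distance \<open>b > m - v\<close>
      wraps around past position \<open>m\<close> to the corner
      \<open>v + b - m - 1\<close>.\<close>
    have "(\<Sum>D | D \<in> triples \<and> mid l D = v. mid_product v D * tri_count D)
       = sum ?g ({1..v - k} \<times> {1..m - v + k})"
      unfolding set_eq
      by (rule sum.reindex_bij_witness[of _
            "\<lambda>(a, b). if b \<le> m - v then (v - a, v, v + b) else (v + b - m - 1, v - a, v)"
            "\<lambda>(p, r, q). if r = v then (v - p, q - v) else (v - r, m + 1 - v + p)"])
         (use \<open>k < v\<close> k(1) xy(1) in \<open>auto simp: tri_count_def split: if_splits\<close>)
    moreover have "m - v + k \<ge> 1"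
    proof -
      have "x0 \<noteq> v" "\<not> (k \<le> x0 \<and> x0 < v)" using large[of x0] xy(4) by auto
      then show ?thesis using xy(2) by arith
    qed
    ultimately show ?thesis using \<open>k < v\<close> xy(1) by (intro exI[of _ "v - k"] exI[of _ "m - v + k"]) auto
  qed
  then obtain s r where sr: "s \<ge> 1" "r \<ge> 1" "s + r = m"
    "(\<Sum>D | D \<in> triples \<and> mid l D = v. mid_product v D * tri_count D) = sum ?g ({1..s} \<times> {1..r})" by blast
  have "sum ?g ({1..s} \<times> {1..r}) = (\<Sum>a=1..s. \<Sum>b=1..r. ?g (a, b))"
    by (simp add: sum.cartesian_product)
  also have "\<dots> = real m / 2 * num_trees m"
    using num_trees_weighted_sum[OF sr(1,2)] unfolding sr(3) by simp
  finally show ?thesis using sr(4) by simp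
qed

lemma sum_tree_coord:
  assumes "v \<in> arc_inner l (0, m)"
  shows "(\<Sum>t\<in>trees m. tree_coord t v) = real m / 2 * num_trees m"
proof -
  let ?T = "{D. D \<in> triples \<and> mid l D = v}"
  have "(\<Sum>t\<in>trees m. tree_coord t v) = (\<Sum>D\<in>?T. tri_val l m D * tri_count D)"
    unfolding tree_coord_def by (rule sum_trees_tris)
  also have "\<dots> = real m / 2 * num_trees m"
  proof (cases "v \<le> M")
    case True
    then have "(\<Sum>D\<in>?T. tri_val l m D * tri_count D) = (\<Sum>D\<in>?T. mid_product v D * tri_count D)"
      by (intro sum.cong) (auto simp: tri_val_mid_product)
    then show ?thesis using sum_mid_product[OF assms] by simp
  next
    case False
    then have "(\<Sum>D\<in>?T. tri_val l m D * tri_count D) =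
        (\<Sum>D\<in>?T. real m * tri_count D - mid_product v D * tri_count D)"
      by (intro sum.cong) (auto simp: tri_val_mid_product algebra_simps)
    also have "\<dots> = real m * num_trees m - real m / 2 * num_trees m"
      unfolding sum_subtractf sum_mid_product[OF assms] by (simp flip: sum_distrib_left add: sum_tri_count[OF assms])
    finally show ?thesis by simp
  qed
  finally show ?thesis .
qed

end

section \<open>Paths in blossoming trees\<close>

text \<open>
  \<open>A v e\<close> is the set of blossoms that lie beyond the edge \<open>e\<close> when seen from the node \<open>v\<close>. The
  axioms about it force the graph to be a tree.
\<close>

locale blossoming_tree =
  fixes G :: "('v, 'e) blossoming_graph" and A :: "'v \<Rightarrow> 'e \<Rightarrow> 'e set"
  assumes finite_blossoms: "finite (blossoms G)"
    and blossoms_not_arcs: "blossoms G \<inter> arcs G = {}"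
    and incident_edges: "\<And>v. v \<in> nodes G \<Longrightarrow> incident G v \<subseteq> arcs G \<union> blossoms G"
    and degree: "\<And>v e e'. v \<in> nodes G \<Longrightarrow> \<exists>d\<in>incident G v. d \<noteq> e \<and> d \<noteq> e'"
    and cover: "\<And>v. v \<in> nodes G \<Longrightarrow> (\<Union>e\<in>incident G v. A v e) = blossoms G"
    and disj: "\<And>v e e'. v \<in> nodes G \<Longrightarrow> e \<in> incident G v \<Longrightarrow> e' \<in> incident G v \<Longrightarrow> e \<noteq> e' \<Longrightarrow> A v e \<inter> A v e' = {}"
    and nonempty: "\<And>v e. v \<in> nodes G \<Longrightarrow> e \<in> incident G v \<Longrightarrow> A v e \<noteq> {}"
    and opposite: "\<And>v w e. v \<in> nodes G \<Longrightarrow> w \<in> nodes G \<Longrightarrow> v \<noteq> w \<Longrightarrow> e \<in> incident G v \<Longrightarrow>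
      e \<in> incident G w \<Longrightarrow> A w e = blossoms G - A v e"
    and other_end: "\<And>v e. v \<in> nodes G \<Longrightarrow> e \<in> arcs G \<Longrightarrow> e \<in> incident G v \<Longrightarrow>
      \<exists>w\<in>nodes G. w \<noteq> v \<and> e \<in> incident G w"
    and at_blossom: "\<And>v e. v \<in> nodes G \<Longrightarrow> e \<in> blossoms G \<Longrightarrow> e \<in> incident G v \<Longrightarrow> A v e = {e}"
begin

lemma A_subset: "v \<in> nodes G \<Longrightarrow> e \<in> incident G v \<Longrightarrow> A v e \<subseteq> blossoms G"
  using cover[of v] by blast

lemma finite_A: "v \<in> nodes G \<Longrightarrow> e \<in> incident G v \<Longrightarrow> finite (A v e)"
  using A_subset finite_blossoms finite_subset by blast

text \<open>Walking across \<open>e\<close> from \<open>v\<close> to \<open>w\<close>, the set of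
  blossoms ahead shrinks strictly because \<open>w\<close> has a third edge. This excludes cycles
  and is the measure for constructing paths.\<close>

lemma A_psubset:
  assumes "v \<in> nodes G" "w \<in> nodes G" "v \<noteq> w" "e \<in> incident G v" "e \<in> incident G w"
    "e' \<in> incident G w" "e' \<noteq> e"
  shows "A w e' \<subset> A v e"
proof -
  have e: "A v e = blossoms G - A w e" using opposite[of w v e] assms by auto
  obtain d where d: "d \<in> incident G w" "d \<noteq> e" "d \<noteq> e'" using degree[OF assms(2), of e e'] by blast
  have "A w e' \<inter> A w e = {}" "A w d \<inter> A w e = {}" "A w d \<inter> A w e' = {}" "A w d \<noteq> {}"
    using disj[OF assms(2)] nonempty[OF assms(2)] d assms(5-7) by auto
  then show ?thesis
    using A_subset[OF assms(2), of e'] A_subset[OF assms(2), of d] d assms(6) unfolding e by blast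
qed

text \<open>Both nodes would see \<open>{e}\<close> beyond \<open>e\<close>, although what they see
  must be complementary.\<close>

lemma blossom_node_unique:
  assumes "v \<in> nodes G" "w \<in> nodes G" "e \<in> blossoms G" "e \<in> incident G v" "e \<in> incident G w"
  shows "v = w"
proof (rule ccontr)
  assume "v \<noteq> w"
  then have "A w e = blossoms G - A v e" using opposite assms by blast
  then show False using at_blossom assms by auto
qed

lemma arc_node_unique:
  assumes "u \<in> nodes G" "v \<in> nodes G" "w \<in> nodes G"
    "e \<in> incident G u" "e \<in> incident G v" "e \<in> incident G w" "v \<noteq> u" "w \<noteq> u"
  shows "v = w"
proof (rule ccontr)
  assume "v \<noteq> w"
  then have "A w e = blossoms G - A v e" "A v e = blossoms G - A u e" "A w e = blossoms G - A u e"
    using opposite[of v w e] opposite[of u v e] opposite[of u w e] assms by auto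
  then show False using nonempty[OF assms(3,6)] A_subset[OF assms(3,6)] by blast
qed

context
  fixes vs es
  assumes path: "blossom_path G vs es"
begin

lemma path_length: "length es = Suc (length vs)" "0 < length vs" "vs \<noteq> []" "es \<noteq> []"
  using path by (auto simp: blossom_path_def length_Suc_conv)

lemma path_ends: "hd es = es ! 0" "last es = es ! length vs"
  using path_length by (auto simp: hd_conv_nth last_conv_nth)

lemma path_step:
  assumes "i < length vs"
  shows "vs ! i \<in> nodes G" "es ! i \<in> incident G (vs ! i)" "es ! Suc i \<in> incident G (vs ! i)" "es ! i \<noteq> es ! Suc i"
  using path assms path_length by (auto simp: blossom_path_def nth_eq_iff_index_eq)

lemma path_next:
  assumes "Suc i < length vs"
  shows "vs ! Suc i \<noteq> vs ! i" "es ! Suc i \<in> arcs G"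
  using path assms by (auto simp: blossom_path_def nth_eq_iff_index_eq)

lemma path_start_mem: "i < length vs \<Longrightarrow> hd es \<in> A (vs ! i) (es ! i)"
proof (induction i)
  case 0
  then show ?case
    using at_blossom[of "vs ! 0" "es ! 0"] path_step[of 0] path path_ends by (auto simp: blossom_path_def)
next
  case (Suc i)
  have "A (vs ! i) (es ! i) \<inter> A (vs ! i) (es ! Suc i) = {}"
    by (rule disj) (use path_step[of i] Suc.prems in auto)
  moreover have "A (vs ! Suc i) (es ! Suc i) = blossoms G - A (vs ! i) (es ! Suc i)"
    by (rule opposite) (use path_step[of i] path_step[of "Suc i"] path_next[of i] Suc.prems in auto)
  ultimately show ?case using Suc path by (auto simp: blossom_path_def)
qed

lemma path_end_mem:
  assumes "i < length vs"
  shows "last es \<in> A (vs ! i) (es ! Suc i)"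
  using assms
proof (induction "length vs - Suc i" arbitrary: i)
  case 0
  then have "Suc i = length vs" by simp
  then show ?case
    using at_blossom[of "vs ! i" "es ! Suc i"] path_step[of i] path path_ends by (auto simp: blossom_path_def)
next
  case (Suc k)
  then have i: "Suc i < length vs" by simp
  have "last es \<in> A (vs ! Suc i) (es ! Suc (Suc i))"
    using Suc.hyps(1)[of "Suc i"] Suc.hyps(2) i by simp
  moreover have "A (vs ! Suc i) (es ! Suc (Suc i)) \<subset> A (vs ! i) (es ! Suc i)"
    by (rule A_psubset) (use path_step[of i] path_step[of "Suc i"] path_next[OF i] i in auto)
  ultimately show ?case by blast
qed

lemma path_ends_blossoms: "set es \<inter> blossoms G = {hd es, last es}"
proof
  show "{hd es, last es} \<subseteq> set es \<inter> blossoms G"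
    using path path_length by (auto simp: blossom_path_def)
  show "set es \<inter> blossoms G \<subseteq> {hd es, last es}"
  proof
    fix e assume "e \<in> set es \<inter> blossoms G"
    then obtain i where i: "i < length es" "e = es ! i" "e \<in> blossoms G" by (auto simp: in_set_conv_nth)
    then have "\<not> (0 < i \<and> i < length vs)"
      using path blossoms_not_arcs by (auto simp: blossom_path_def)
    then have "i = 0 \<or> i = length vs" using i(1) path_length by auto
    then show "e \<in> {hd es, last es}" using i(2) path_ends by auto
  qed
qed

text \<open>Paths are recorded by their sets of nodes and edges only, so it has to be shown that an
  edge of the path at a node is one of the two used in passing through that node.\<close>

lemma path_incident_edges:
  assumes "i < length vs" "e \<in> set es" "e \<in> incident G (vs ! i)"
  shows "e = es ! i \<or> e = es ! Suc i"
proof -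
  obtain k where k: "k < length es" "e = es ! k" using assms(2) by (auto simp: in_set_conv_nth)
  have dist: "distinct vs" using path by (simp add: blossom_path_def)
  consider "k = 0" | "k = length vs" | "0 < k" "k < length vs" using k(1) path_length by linarith
  then show ?thesis
  proof cases
    case 1
    then have "vs ! i = vs ! 0"
      using blossom_node_unique[of "vs ! i" "vs ! 0" e] path_step[of i] path_step[of 0] path_length assms k path path_ends
      by (auto simp: blossom_path_def)
    then have "i = 0" using dist path_length assms(1) by (simp add: nth_eq_iff_index_eq)
    then show ?thesis using k 1 by simp
  next
    case 2
    then obtain j where j: "length vs = Suc j" using path_length by (cases "length vs") auto
    then have "vs ! i = vs ! j"
      using blossom_node_unique[of "vs ! i" "vs ! j" e] path_step[of i] path_step[of j] path_length assms k path path_ends 2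
      by (auto simp: blossom_path_def)
    then have "i = j" using dist j assms(1) by (simp add: nth_eq_iff_index_eq)
    then show ?thesis using k 2 j by simp
  next
    case 3
    then obtain j where j: "k = Suc j" by (cases k) auto
    have "vs ! i = vs ! j \<or> vs ! i = vs ! k"
      using arc_node_unique[of "vs ! j" "vs ! i" "vs ! k" e] path_step[of i] path_step[of j] path_step[of k]
        path_next[of j] assms k 3 j by auto
    then have "i = j \<or> i = k" using dist j 3 assms(1) by (auto simp: nth_eq_iff_index_eq)
    then show ?thesis using k j by auto
  qed
qed

lemma path_rev: "blossom_path G (rev vs) (rev es)"
  unfolding blossom_path_def
proof (intro conjI allI impI)
  show "length (rev es) = Suc (length (rev vs))" "distinct (rev vs)" "distinct (rev es)" "set (rev vs) \<subseteq> nodes G"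
    "hd (rev es) \<in> blossoms G" "last (rev es) \<in> blossoms G" "hd (rev es) \<noteq> last (rev es)"
    using path path_length by (auto simp: blossom_path_def hd_rev last_rev)
next
  fix i assume "0 < i \<and> i < length (rev vs)"
  then show "rev es ! i \<in> arcs G"
    using path path_length by (simp add: blossom_path_def rev_nth)
next
  fix i assume i: "i < length (rev vs)"
  then have "length es - Suc i = Suc (length vs - Suc i)" "length es - Suc (Suc i) = length vs - Suc i"
    using path_length by auto
  then show "rev es ! i \<in> incident G (rev vs ! i)" "rev es ! Suc i \<in> incident G (rev vs ! i)"
    using path_step[of "length vs - Suc i"] i path_length by (auto simp: rev_nth)
qed

end

text \<open>At a common node the edge towards the last blossom is unique by disjointness, and an arc
  has only one other end; so the two paths proceed in step.\<close>

lemma path_prefix: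
  assumes p: "blossom_path G vs es" and q: "blossom_path G vs' es'"
    and ends: "hd es = hd es'" "last es = last es'"
  shows "i < length vs \<Longrightarrow> i < length vs' \<and> vs ! i = vs' ! i \<and> es ! Suc i = es' ! Suc i"
proof (induction i)
  case 0
  have "hd es \<in> blossoms G" using p by (simp add: blossom_path_def)
  then have v: "vs ! 0 = vs' ! 0"
    using blossom_node_unique[of "vs ! 0" "vs' ! 0" "hd es"] path_step[OF p, of 0] path_step[OF q, of 0]
      path_length[OF p] path_length[OF q] path_ends[OF p] path_ends[OF q] ends by simp
  moreover have "es ! Suc 0 = es' ! Suc 0"
    using disj[of "vs ! 0" "es ! Suc 0" "es' ! Suc 0"] path_end_mem[OF p, of 0] path_end_mem[OF q, of 0]
      path_step[OF p, of 0] path_step[OF q, of 0] path_length[OF p] path_length[OF q] v ends by auto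
  ultimately show ?case using path_length[OF q] by simp
next
  case (Suc i)
  then have IH: "i < length vs'" "vs ! i = vs' ! i" "es ! Suc i = es' ! Suc i" by auto
  have arc: "es ! Suc i \<in> arcs G" "vs ! Suc i \<noteq> vs ! i" using path_next[OF p Suc.prems] by auto
  have "Suc i \<noteq> length vs'"
  proof
    assume "Suc i = length vs'"
    then have "last es' = es' ! Suc i" using path_ends[OF q] by simp
    then show False using arc(1) IH(3) q blossoms_not_arcs by (auto simp: blossom_path_def)
  qed
  then have len: "Suc i < length vs'" using IH by simp
  have v: "vs ! Suc i = vs' ! Suc i"
    using arc_node_unique[of "vs ! i" "vs ! Suc i" "vs' ! Suc i" "es ! Suc i"]
      path_step[OF p, of i] path_step[OF p, of "Suc i"] path_step[OF q, of i] path_step[OF q, of "Suc i"]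
      path_next[OF q len] arc IH len Suc.prems by auto
  moreover have "es ! Suc (Suc i) = es' ! Suc (Suc i)"
    using disj[of "vs ! Suc i" "es ! Suc (Suc i)" "es' ! Suc (Suc i)"]
      path_end_mem[OF p Suc.prems] path_end_mem[OF q len] path_step[OF p Suc.prems] path_step[OF q len] v ends by auto
  ultimately show ?case using len by simp
qed

lemma path_unique:
  assumes p: "blossom_path G vs es" and q: "blossom_path G vs' es'"
    and ends: "hd es = hd es'" "last es = last es'"
  shows "vs = vs'" "es = es'"
proof -
  note pq = path_prefix[OF p q ends] and qp = path_prefix[OF q p ends[symmetric]]
  have "length vs = length vs'"
    using pq[of "length vs - 1"] qp[of "length vs' - 1"] path_length[OF p] path_length[OF q] by auto
  moreover have "es ! i = es' ! i" if "i < length es" for i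
    using that pq[of "i - 1"] path_length[OF p] path_ends[OF p] path_ends[OF q] ends by (cases i) auto
  ultimately show "vs = vs'" "es = es'"
    using pq path_length[OF p] path_length[OF q] by (auto intro: nth_equalityI)
qed

text \<open>A walk from \<open>e\<close> that never turns back, extended at its end only; simplicity
  is not demanded but proved.\<close>

inductive trail :: "'e \<Rightarrow> 'v list \<Rightarrow> 'e list \<Rightarrow> bool" for e where
  start: "trail e [] [e]"
| extend: "trail e vs es \<Longrightarrow> v \<in> nodes G \<Longrightarrow> last es \<in> incident G v \<Longrightarrow> d \<in> incident G v \<Longrightarrow> d \<noteq> last es \<Longrightarrow>
    (vs \<noteq> [] \<Longrightarrow> last vs \<noteq> v \<and> last es \<in> arcs G) \<Longrightarrow> trail e (vs @ [v]) (es @ [d])"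

text \<open>The last conjunct is the reason for simplicity: what lies ahead at the end of the walk
  is contained in what lay ahead at each earlier step, strictly so after an extension. A repeated
  node or edge would contradict this inclusion.\<close>

lemma trail_properties:
  assumes "trail e vs es" "e \<in> blossoms G"
  shows "length es = Suc (length vs) \<and> es ! 0 = e \<and> set vs \<subseteq> nodes G \<and> distinct vs \<and> distinct es \<and>
    (\<forall>i. 0 < i \<and> i < length vs \<longrightarrow> es ! i \<in> arcs G) \<and>
    (\<forall>i < length vs. es ! i \<in> incident G (vs ! i) \<and> es ! Suc i \<in> incident G (vs ! i)) \<and>
    (\<forall>i < length vs. A (last vs) (last es) \<subseteq> A (vs ! i) (es ! Suc i))"
  using assms
proof (induction rule: trail.induct)
  case (extend vs es v d)
  then have IH: "length es = Suc (length vs)" "es ! 0 = e" "set vs \<subseteq> nodes G" "distinct vs" "distinct es"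
    "\<And>i. 0 < i \<Longrightarrow> i < length vs \<Longrightarrow> es ! i \<in> arcs G"
    "\<And>i. i < length vs \<Longrightarrow> es ! i \<in> incident G (vs ! i)"
    "\<And>i. i < length vs \<Longrightarrow> es ! Suc i \<in> incident G (vs ! i)"
    "\<And>i. i < length vs \<Longrightarrow> A (last vs) (last es) \<subseteq> A (vs ! i) (es ! Suc i)" by auto
  have le: "last es = es ! length vs" using IH(1) by (metis diff_Suc_1 last_conv_nth length_0_conv nat.distinct(1))
  have sub: "A v d \<subset> A (vs ! i) (es ! Suc i)" if i: "i < length vs" for i
  proof -
    have ne: "vs \<noteq> []" using i by auto
    then have lv: "last vs \<in> nodes G" "last es \<in> incident G (last vs)"
      using IH(3) IH(8)[of "length vs - 1"] le by (auto simp: last_conv_nth)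
    have "A v d \<subset> A (last vs) (last es)"
      using A_psubset[OF lv(1) extend.hyps(2) _ lv(2) extend.hyps(3,4,5)] extend.hyps(6)[OF ne] by blast
    then show ?thesis using IH(9)[OF i] by blast
  qed
  have "v \<notin> set vs"
  proof
    assume "v \<in> set vs"
    then obtain i where i: "i < length vs" "v = vs ! i" by (auto simp: in_set_conv_nth)
    show False
    proof (cases "d = es ! Suc i")
      case True
      then show ?thesis using sub[OF i(1)] i(2) by simp
    next
      case False
      then have "A v d \<inter> A v (es ! Suc i) = {}"
        using disj[OF extend.hyps(2,4)] IH(8)[OF i(1)] i(2) by blast
      then show ?thesis using sub[OF i(1)] i(2) nonempty[OF extend.hyps(2,4)] by blast
    qed
  qed
  moreover have "d \<notin> set es"
  proof
    assume "d \<in> set es"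
    then obtain k where k: "k < length es" "d = es ! k" by (auto simp: in_set_conv_nth)
    show False
    proof (cases k)
      case 0
      then have de: "d = e" using k IH(2) by simp
      show False
      proof (cases "vs = []")
        case True
        then show ?thesis using extend.hyps(5) le IH(2) de by simp
      next
        case False
        then have z: "0 < length vs" by simp
        have v0: "vs ! 0 \<in> nodes G" using IH(3) z by auto
        have "A v d = {e}" using at_blossom[OF extend.hyps(2)] extend.prems extend.hyps(4) de by simp
        then have "e \<in> A (vs ! 0) (es ! Suc 0)" using sub[OF z] by blast
        moreover have "A (vs ! 0) (es ! 0) = {e}"
          using at_blossom[OF v0 extend.prems] IH(7)[OF z] IH(2) by simp
        moreover have "es ! 0 \<noteq> es ! Suc 0" using IH(1,5) z by (simp add: nth_eq_iff_index_eq)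
        ultimately show ?thesis using disj[OF v0 IH(7)[OF z] IH(8)[OF z]] by blast
      qed
    next
      case (Suc i)
      then have i: "i < length vs" using k IH(1) by simp
      have vi: "vs ! i \<in> nodes G" "vs ! i \<noteq> v" using IH(3) nth_mem[OF i] \<open>v \<notin> set vs\<close> by auto
      have "A v d = blossoms G - A (vs ! i) d"
        using opposite[OF vi(1) extend.hyps(2) vi(2)] IH(8)[OF i] extend.hyps(4) k Suc by simp
      then show ?thesis using sub[OF i] k Suc nonempty[OF extend.hyps(2,4)] by blast
    qed
  qed
  moreover have "(es @ [d]) ! i \<in> arcs G" if "0 < i" "i < length (vs @ [v])" for i
  proof (cases "i < length vs")
    case True
    then show ?thesis using IH(1,6) that by (simp add: nth_append)
  next
    case False
    then have "i = length vs" "vs \<noteq> []" using that by auto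
    then show ?thesis using extend.hyps(6) le IH(1) by (simp add: nth_append)
  qed
  moreover have "(es @ [d]) ! i \<in> incident G ((vs @ [v]) ! i) \<and> (es @ [d]) ! Suc i \<in> incident G ((vs @ [v]) ! i)"
    if "i < length (vs @ [v])" for i
    using that IH(1,7,8) extend.hyps(3,4) le by (cases "i < length vs") (auto simp: nth_append not_less less_Suc_eq)
  moreover have "A v d \<subseteq> A ((vs @ [v]) ! i) ((es @ [d]) ! Suc i)" if "i < length (vs @ [v])" for i
    using that IH(1) sub[of i] by (cases "i < length vs") (auto simp: nth_append not_less less_Suc_eq)
  ultimately show ?case
    using IH(1-5) extend.hyps(2) by (auto simp: nth_append)
qed auto

lemma trail_blossom_path:
  assumes "trail e vs es" "e \<in> blossoms G" "last es \<in> blossoms G" "vs \<noteq> []"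
  shows "blossom_path G vs es" "hd es = e"
proof -
  note t = trail_properties[OF assms(1,2)]
  have ends: "hd es = es ! 0" "last es = es ! length vs"
  proof -
    have "es \<noteq> []" using t by auto
    then show "hd es = es ! 0" "last es = es ! length vs" using t by (simp_all add: hd_conv_nth last_conv_nth)
  qed
  show "hd es = e" using t ends by simp
  have "es ! 0 \<noteq> es ! length vs" using t assms(4) nth_eq_iff_index_eq[of es 0 "length vs"] by auto
  then show "blossom_path G vs es"
    using t ends assms(2,3) unfolding blossom_path_def by simp
qed

text \<open>Step across \<open>d\<close> to its other end \<open>u\<close> and to the edge
  \<open>c\<close> of \<open>u\<close> that points to \<open>e\<close>: the set beyond shrinks, and
  the walk that reaches \<open>c\<close> by induction is extended over \<open>d\<close>.\<close>

lemma trail_to: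
  assumes "v \<in> nodes G" "d \<in> incident G v" "e \<in> A v d"
  shows "\<exists>vs es. trail e vs es \<and> last es = d \<and> (vs \<noteq> [] \<longrightarrow> last vs \<noteq> v \<and> d \<in> arcs G)"
  using assms
proof (induction "card (A v d)" arbitrary: v d rule: less_induct)
  case less
  show ?case
  proof (cases "d \<in> blossoms G")
    case True
    then have "d = e" using at_blossom less.prems by auto
    then show ?thesis using trail.start by fastforce
  next
    case False
    then have d: "d \<in> arcs G" using incident_edges[OF less.prems(1)] less.prems(2) by auto
    then obtain u where u: "u \<in> nodes G" "u \<noteq> v" "d \<in> incident G u"
      using other_end[OF less.prems(1) d less.prems(2)] by auto
    have "A u d = blossoms G - A v d"
      using opposite[of v u d] u less.prems(1,2) by auto
    moreover have "e \<in> blossoms G" using A_subset less.prems by blast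
    ultimately have "e \<in> blossoms G - A u d" using less.prems(3) by blast
    then obtain c where c: "c \<in> incident G u" "e \<in> A u c" "c \<noteq> d" using cover[OF u(1)] by blast
    have "A u c \<subset> A v d"
      by (rule A_psubset) (use less.prems u c in auto)
    then have "card (A u c) < card (A v d)"
      by (intro psubset_card_mono finite_A less.prems)
    from less.hyps[OF this u(1) c(1,2)] obtain vs es where
      *: "trail e vs es" "last es = c" "vs \<noteq> [] \<longrightarrow> last vs \<noteq> u \<and> c \<in> arcs G" by blast
    have "trail e (vs @ [u]) (es @ [d])"
      by (rule trail.extend) (use * u c in auto)
    then show ?thesis using u(2) d by (intro exI[of _ "vs @ [u]"] exI[of _ "es @ [d]"]) auto
  qed
qed

lemma trail_from:
  assumes "trail e vs es" "vs \<noteq> []" "last vs \<in> nodes G" "last es \<in> incident G (last vs)" "f \<in> A (last vs) (last es)"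
  shows "\<exists>vs' es'. trail e vs' es' \<and> last es' = f \<and> set vs \<subseteq> set vs' \<and> set es \<subseteq> set es' \<and> vs' \<noteq> []"
  using assms
proof (induction "card (A (last vs) (last es))" arbitrary: vs es rule: less_induct)
  case less
  let ?v = "last vs" and ?d = "last es"
  show ?case
  proof (cases "?d \<in> blossoms G")
    case True
    then have "?d = f" using at_blossom less.prems by auto
    then show ?thesis using less.prems by blast
  next
    case False
    then have d: "?d \<in> arcs G" using incident_edges[OF less.prems(3)] less.prems(4) by auto
    then obtain u where u: "u \<in> nodes G" "u \<noteq> ?v" "?d \<in> incident G u"
      using other_end[OF less.prems(3) d less.prems(4)] by auto
    have "A u ?d = blossoms G - A ?v ?d"
      using opposite[of ?v u ?d] u less.prems(3,4) by auto
    moreover have "f \<in> blossoms G" using A_subset less.prems by blast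
    ultimately have "f \<in> blossoms G - A u ?d" using less.prems(5) by blast
    then obtain c where c: "c \<in> incident G u" "f \<in> A u c" "c \<noteq> ?d" using cover[OF u(1)] by blast
    have "A u c \<subset> A ?v ?d"
      by (rule A_psubset) (use less.prems u c in auto)
    then have "card (A u c) < card (A ?v ?d)"
      by (intro psubset_card_mono finite_A less.prems)
    moreover have "trail e (vs @ [u]) (es @ [c])"
      by (rule trail.extend) (use less.prems u c d in auto)
    ultimately obtain vs' es' where "trail e vs' es'" "last es' = f" "set (vs @ [u]) \<subseteq> set vs'"
        "set (es @ [c]) \<subseteq> set es'" "vs' \<noteq> []"
      using less.hyps[of "vs @ [u]" "es @ [c]"] u c by auto
    then show ?thesis by auto
  qed
qed

text \<open>One end of such a path lies in \<open>A v d1\<close>, the other in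
  \<open>A v d2\<close>; the ends determine the path, and trails realise every pair. As a path is
  stored without direction, a representative is reversed if necessary so that it starts in
  \<open>A v d1\<close>.\<close>

lemma card_paths_through:
  assumes v: "v \<in> nodes G" and d: "d1 \<in> incident G v" "d2 \<in> incident G v" "d1 \<noteq> d2"
  shows "card {(V, E) \<in> blossom_paths G. v \<in> V \<and> {d1, d2} \<subseteq> E} = card (A v d1) * card (A v d2)"
proof -
  let ?S = "{(V, E) \<in> blossom_paths G. v \<in> V \<and> {d1, d2} \<subseteq> E}"
  have sub: "A v d1 \<subseteq> blossoms G" "A v d2 \<subseteq> blossoms G" and dj: "A v d1 \<inter> A v d2 = {}"
    using A_subset[OF v] disj[OF v] d by auto
  have rep: "\<exists>vs es. blossom_path G vs es \<and> V = set vs \<and> E = set es \<and> hd es \<in> A v d1 \<and> last es \<in> A v d2"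
    if VE: "(V, E) \<in> ?S" for V E
  proof -
    obtain vs es where p: "blossom_path G vs es" "V = set vs" "E = set es" "v \<in> set vs" "d1 \<in> set es" "d2 \<in> set es"
      using VE by (auto simp: blossom_paths_def)
    obtain i where i: "i < length vs" "vs ! i = v" using p(4) by (auto simp: in_set_conv_nth)
    have "d1 = es ! i \<or> d1 = es ! Suc i" "d2 = es ! i \<or> d2 = es ! Suc i"
      using path_incident_edges[OF p(1) i(1)] p(5,6) d i(2) by auto
    then consider "d1 = es ! i" "d2 = es ! Suc i" | "d2 = es ! i" "d1 = es ! Suc i" using d(3) by blast
    then show ?thesis
    proof cases
      case 1
      then show ?thesis
        using path_start_mem[OF p(1) i(1)] path_end_mem[OF p(1) i(1)] p i(2) by blast
    next
      case 2
      have "hd (rev es) = last es" "last (rev es) = hd es"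
        using path_length[OF p(1)] by (auto simp: hd_rev last_rev)
      then show ?thesis
        using path_start_mem[OF p(1) i(1)] path_end_mem[OF p(1) i(1)] p i(2) 2 path_rev[OF p(1)]
        by (intro exI[of _ "rev vs"] exI[of _ "rev es"]) auto
    qed
  qed
  \<comment> \<open>The ends are recovered from the edge set alone: its only blossoms are the two
    ends, one on each side.\<close>
  let ?h = "\<lambda>(V, E). (the_elem (E \<inter> A v d1), the_elem (E \<inter> A v d2))"
  have h: "?h (set vs, set es) = (hd es, last es)"
    if "blossom_path G vs es" "hd es \<in> A v d1" "last es \<in> A v d2" for vs es
  proof -
    have "set es \<inter> A v d1 = (set es \<inter> blossoms G) \<inter> A v d1" "set es \<inter> A v d2 = (set es \<inter> blossoms G) \<inter> A v d2"
      using sub by auto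
    moreover have "{hd es, last es} \<inter> A v d1 = {hd es}" "{hd es, last es} \<inter> A v d2 = {last es}"
      using dj that(2,3) by auto
    ultimately have "set es \<inter> A v d1 = {hd es}" "set es \<inter> A v d2 = {last es}"
      unfolding path_ends_blossoms[OF that(1)] by simp_all
    then show ?thesis by simp
  qed
  have "bij_betw ?h ?S (A v d1 \<times> A v d2)"
    unfolding bij_betw_def
  proof
    show "inj_on ?h ?S"
    proof (rule inj_onI)
      fix x y assume x: "x \<in> ?S" and y: "y \<in> ?S" and e: "?h x = ?h y"
      obtain vs es where p: "blossom_path G vs es" "x = (set vs, set es)" "hd es \<in> A v d1" "last es \<in> A v d2"
        using rep[of "fst x" "snd x"] x by (metis prod.collapse)
      obtain vs' es' where q: "blossom_path G vs' es'" "y = (set vs', set es')" "hd es' \<in> A v d1" "last es' \<in> A v d2"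
        using rep[of "fst y" "snd y"] y by (metis prod.collapse)
      have "(hd es, last es) = (hd es', last es')"
        using h[OF p(1,3,4)] h[OF q(1,3,4)] e unfolding p(2) q(2) by simp
      then show "x = y" using path_unique[OF p(1) q(1)] p(2) q(2) by simp
    qed
    show "?h ` ?S = A v d1 \<times> A v d2"
    proof (intro antisym subsetI)
      fix z assume "z \<in> ?h ` ?S"
      then obtain x where x: "x \<in> ?S" "z = ?h x" by blast
      obtain vs es where p: "blossom_path G vs es" "x = (set vs, set es)" "hd es \<in> A v d1" "last es \<in> A v d2"
        using rep[of "fst x" "snd x"] x(1) by (metis prod.collapse)
      show "z \<in> A v d1 \<times> A v d2" using h[OF p(1,3,4)] p x(2) by simp
    next
      fix z assume "z \<in> A v d1 \<times> A v d2"
      then obtain e f where ef: "z = (e, f)" "e \<in> A v d1" "f \<in> A v d2" by auto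
      obtain vs es where t: "trail e vs es" "last es = d1" "vs \<noteq> [] \<longrightarrow> last vs \<noteq> v \<and> d1 \<in> arcs G"
        using trail_to[OF v d(1) ef(2)] by blast
      have "trail e (vs @ [v]) (es @ [d2])"
        by (rule trail.extend) (use t v d in auto)
      then obtain vs' es' where t': "trail e vs' es'" "last es' = f" "set (vs @ [v]) \<subseteq> set vs'"
          "set (es @ [d2]) \<subseteq> set es'" "vs' \<noteq> []"
        using trail_from[of e "vs @ [v]" "es @ [d2]" f] v d ef by auto
      have "es \<noteq> []" using t(1) by (cases rule: trail.cases) auto
      then have "d1 \<in> set es" using t(2) last_in_set by blast
      have p: "blossom_path G vs' es'" "hd es' = e"
        using trail_blossom_path[OF t'(1)] t' sub ef by auto
      then have "(set vs', set es') \<in> ?S"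
        using t' \<open>d1 \<in> set es\<close> by (auto simp: blossom_paths_def)
      moreover have "?h (set vs', set es') = z" using h[OF p(1)] p(2) t'(2) ef by simp
      ultimately show "z \<in> ?h ` ?S" by blast
    qed
  qed
  then show ?thesis by (simp add: bij_betw_same_card card_cartesian_product)
qed

end

section \<open>Orientation of points in the plane\<close>

text \<open>Twice the signed area of the triangle, positive if \<open>a\<close>, \<open>b\<close>,
  \<open>c\<close> run counterclockwise.\<close>

definition orient :: "real ^ 2 \<Rightarrow> real ^ 2 \<Rightarrow> real ^ 2 \<Rightarrow> real" where
  "orient a b c = (b $ 1 - a $ 1) * (c $ 2 - a $ 2) - (b $ 2 - a $ 2) * (c $ 1 - a $ 1)"

definition left_normal :: "real ^ 2 \<Rightarrow> real ^ 2 \<Rightarrow> real ^ 2" where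
  "left_normal a b = vector [a $ 2 - b $ 2, b $ 1 - a $ 1]"

lemma orient_inner: "orient a b c = left_normal a b \<bullet> c - left_normal a b \<bullet> a"
  by (simp add: orient_def left_normal_def inner_vec_def sum_2 algebra_simps)

lemma orient_rotate: "orient b c a = orient a b c"
  by (simp add: orient_def algebra_simps)

lemma orient_swap: "orient a c b = - orient a b c" "orient b a c = - orient a b c"
  by (simp_all add: orient_def algebra_simps)

lemma orient_refl [simp]: "orient a b a = 0" "orient a b b = 0" "orient a a b = 0"
  by (simp_all add: orient_def)

lemma orient_affine: "orient a b ((1 - t) *\<^sub>R c + t *\<^sub>R d) = (1 - t) * orient a b c + t * orient a b d"
  by (simp add: orient_def algebra_simps)

lemma orient_le_iff:
  assumes "a $ 1 < b $ 1"
  shows "c $ 2 \<le> line_height a b (c $ 1) \<longleftrightarrow> orient a b c \<le> 0"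
    and "line_height a b (c $ 1) \<le> c $ 2 \<longleftrightarrow> 0 \<le> orient a b c"
  using assms by (auto simp: line_height_def orient_def field_simps)

lemma orient_above:
  assumes "a $ 1 < b $ 1" "y $ 1 = z $ 1"
  shows "orient a b y < orient a b z \<longleftrightarrow> y $ 2 < z $ 2" "orient a b y \<le> orient a b z \<longleftrightarrow> y $ 2 \<le> z $ 2"
  using assms by (auto simp: orient_def)

lemma point_on_chord:
  assumes "a $ 1 \<le> x" "x \<le> b $ 1" "a $ 1 < b $ 1"
  obtains z where "z \<in> closed_segment a b" "z $ 1 = x" "orient a b z = 0"
proof
  define t where "t = (x - a $ 1) / (b $ 1 - a $ 1)"
  let ?z = "(1 - t) *\<^sub>R a + t *\<^sub>R b"
  have "0 \<le> t" "t \<le> 1" using assms by (auto simp: t_def)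
  then show "?z \<in> closed_segment a b" by (auto simp: in_segment)
  have "?z $ 1 = a $ 1 + t * (b $ 1 - a $ 1)" by (simp add: algebra_simps)
  also have "t * (b $ 1 - a $ 1) = x - a $ 1" using assms(3) by (simp add: t_def)
  finally show "?z $ 1 = x" by simp
  show "orient a b ?z = 0" by (simp add: orient_affine)
qed

lemma vertical_convex:
  fixes v :: "real ^ 2"
  assumes "convex S" "y \<in> S" "z \<in> S" "y $ 1 = v $ 1" "z $ 1 = v $ 1" "y $ 2 \<le> v $ 2" "v $ 2 \<le> z $ 2"
  shows "v \<in> closed_segment y z" "v \<in> S"
proof -
  have "\<exists>t. 0 \<le> t \<and> t \<le> 1 \<and> v = (1 - t) *\<^sub>R y + t *\<^sub>R z"
  proof (cases "y $ 2 = z $ 2")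
    case True
    then have "v = y" using assms by (simp add: vec_eq_iff forall_2)
    then show ?thesis by (intro exI[of _ 0]) auto
  next
    case False
    define t where "t = (v $ 2 - y $ 2) / (z $ 2 - y $ 2)"
    have "0 \<le> t" "t \<le> 1" using False assms by (auto simp: t_def)
    moreover have "v $ 2 = (1 - t) * y $ 2 + t * z $ 2"
    proof -
      have "(1 - t) * y $ 2 + t * z $ 2 = y $ 2 + t * (z $ 2 - y $ 2)" by (simp add: algebra_simps)
      also have "t * (z $ 2 - y $ 2) = v $ 2 - y $ 2" using False by (simp add: t_def)
      finally show ?thesis by simp
    qed
    moreover have "v $ 1 = (1 - t) * y $ 1 + t * z $ 1" using assms by (simp add: algebra_simps)
    ultimately show ?thesis by (intro exI[of _ t]) (simp add: vec_eq_iff forall_2)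
  qed
  then show "v \<in> closed_segment y z" by (auto simp: closed_segment_def)
  then show "v \<in> S" using assms(1-3) closed_segment_subset by blast
qed

text \<open>For consecutive vertices \<open>a\<close>, \<open>b\<close> of a convex polygon, in counterclockwise order.\<close>

locale polygon_edge =
  fixes W :: "(real ^ 2) set" and a b :: "real ^ 2"
  assumes finite_W: "finite W" and ab: "a \<in> W" "b \<in> W" "a \<noteq> b"
    and left: "\<And>c. c \<in> W \<Longrightarrow> c \<noteq> a \<Longrightarrow> c \<noteq> b \<Longrightarrow> 0 < orient a b c"
begin

lemma hull_left: "z \<in> convex hull W \<Longrightarrow> 0 \<le> orient a b z"
proof -
  have "W \<subseteq> {z. left_normal a b \<bullet> z \<ge> left_normal a b \<bullet> a}"
  proof
    fix c assume "c \<in> W"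
    then have "0 \<le> orient a b c" using left[of c] by (cases "c = a \<or> c = b") auto
    then show "c \<in> {z. left_normal a b \<bullet> z \<ge> left_normal a b \<bullet> a}" by (simp add: orient_inner)
  qed
  then have "convex hull W \<subseteq> {z. left_normal a b \<bullet> z \<ge> left_normal a b \<bullet> a}"
    by (rule hull_minimal) (rule convex_halfspace_ge)
  then show "z \<in> convex hull W \<Longrightarrow> 0 \<le> orient a b z" by (auto simp: orient_inner)
qed

lemma segment_subset: "closed_segment a b \<subseteq> convex hull W"
  by (intro closed_segment_subset) (use ab in \<open>auto intro: hull_inc\<close>)

lemma segment_orient: "z \<in> closed_segment a b \<Longrightarrow> orient a b z = 0"
  by (auto simp: closed_segment_def orient_affine)

lemma left_normal_nonzero: "left_normal a b \<noteq> 0"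
  using ab(3) by (auto simp: left_normal_def vec_eq_iff forall_2)

text \<open>The supporting line through \<open>a\<close> and \<open>b\<close> cuts out a face, which
  is the hull of the elements of \<open>W\<close> on it; strictness on the left leaves only
  \<open>a\<close> and \<open>b\<close>.\<close>

lemma face: "closed_segment a b face_of convex hull W"
proof -
  let ?H = "{z. left_normal a b \<bullet> z = left_normal a b \<bullet> a}"
  have f: "(convex hull W \<inter> ?H) face_of (convex hull W)"
    by (rule face_of_Int_supporting_hyperplane_ge) (use hull_left in \<open>auto simp: orient_inner\<close>)
  obtain W' where W': "W' \<subseteq> W" "convex hull W \<inter> ?H = convex hull W'"
    using face_of_convex_hull_subset[OF finite_imp_compact[OF finite_W] f] by blast
  have "W' \<subseteq> {a, b}"
  proof
    fix c assume c: "c \<in> W'"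
    then have "c \<in> ?H" using W'(2) hull_inc[of c W' convex] by blast
    then have "orient a b c = 0" by (simp add: orient_inner)
    then show "c \<in> {a, b}" using left[of c] c W'(1) by fastforce
  qed
  then have "convex hull W \<inter> ?H \<subseteq> closed_segment a b"
    unfolding W'(2) segment_convex_hull by (rule hull_mono)
  moreover have "closed_segment a b \<subseteq> convex hull W \<inter> ?H"
  proof
    fix z assume "z \<in> closed_segment a b"
    then show "z \<in> convex hull W \<inter> ?H"
      using segment_subset segment_orient[of z] by (simp add: orient_inner subset_iff)
  qed
  ultimately show ?thesis using f by simp
qed

lemma edge: "closed_segment a b edge_of convex hull W"
  unfolding edge_of_def using face ab(3) by (simp add: segment_convex_hull aff_dim_convex_hull aff_dim_2)

lemma not_interior: "\<not> open_segment a b \<subseteq> interior (convex hull W)"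
proof
  assume sub: "open_segment a b \<subseteq> interior (convex hull W)"
  let ?z = "midpoint a b"
  have "?z \<in> open_segment a b" using ab(3) by simp
  moreover have "interior (convex hull W) \<subseteq> interior {z. left_normal a b \<bullet> z \<ge> left_normal a b \<bullet> a}"
    by (rule interior_mono) (use hull_left in \<open>auto simp: orient_inner\<close>)
  ultimately have "?z \<in> interior {z. left_normal a b \<bullet> z \<ge> left_normal a b \<bullet> a}"
    using sub by blast
  then have "left_normal a b \<bullet> ?z > left_normal a b \<bullet> a"
    using left_normal_nonzero by (simp add: interior_halfspace_ge)
  moreover have "?z \<in> closed_segment a b" by simp
  ultimately show False using segment_orient[of ?z] by (simp add: orient_inner)
qed

lemma lower:
  assumes "a $ 1 < b $ 1"
  shows "closed_segment a b \<subseteq> lower_hull (convex hull W)"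
proof
  fix z assume z: "z \<in> closed_segment a b"
  have "z $ 2 \<le> q $ 2" if "q \<in> convex hull W" "q $ 1 = z $ 1" for q
    using orient_above(2)[OF assms, of z q] hull_left[OF that(1)] segment_orient[OF z] that(2) by simp
  then show "z \<in> lower_hull (convex hull W)" using z segment_subset by (auto simp: lower_hull_def)
qed

lemma upper:
  assumes "b $ 1 < a $ 1"
  shows "closed_segment a b \<subseteq> upper_hull (convex hull W)"
proof
  fix z assume z: "z \<in> closed_segment a b"
  have "q $ 2 \<le> z $ 2" if "q \<in> convex hull W" "q $ 1 = z $ 1" for q
    using orient_above(2)[OF assms, of q z] hull_left[OF that(1)] segment_orient[OF z] that(2) orient_swap(2)[of a b] by simp
  then show "z \<in> upper_hull (convex hull W)" using z segment_subset by (auto simp: upper_hull_def)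
qed

text \<open>Moving slightly from the midpoint of the edge towards \<open>c\<close> gives a point
  strictly to the left that is still vertically over or under the edge. It shows that an edge cannot
  belong to both hulls.\<close>

lemma strictly_left_over_segment:
  assumes "c \<in> W" "c \<noteq> a" "c \<noteq> b" "a $ 1 \<noteq> b $ 1"
  obtains e e' where "e \<in> convex hull W" "e' \<in> closed_segment a b" "e $ 1 = e' $ 1" "0 < orient a b e"
proof -
  let ?z = "midpoint a b"
  let ?s = "\<bar>b $ 1 - a $ 1\<bar>" and ?K = "\<bar>c $ 1 - ?z $ 1\<bar>"
  \<comment> \<open>Small enough that the abscissa moves by at most half the width
    \<open>?s\<close>; the summand \<open>?s\<close> in the denominator keeps it positive and
    \<open>\<epsilon>\<close> at most 1.\<close>
  define \<epsilon> where "\<epsilon> = ?s / (2 * (?s + ?K))"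
  have s: "?s > 0" "?K \<ge> 0" using assms(4) by auto
  then have sK: "0 < ?s + ?K" by (rule add_pos_nonneg)
  have eps: "0 < \<epsilon>" unfolding \<epsilon>_def using s(1) sK by (intro divide_pos_pos mult_pos_pos) auto
  have "?s \<le> 2 * (?s + ?K)" using s by (simp add: algebra_simps)
  then have eps1: "\<epsilon> \<le> 1" unfolding \<epsilon>_def using sK by (subst divide_le_eq_1_pos) auto
  have "?K / (?s + ?K) \<le> 1" using s sK by (subst divide_le_eq_1_pos) auto
  then have "(?s / 2) * (?K / (?s + ?K)) \<le> (?s / 2) * 1" using s by (intro mult_left_mono) auto
  then have "\<epsilon> * ?K \<le> ?s / 2" by (simp add: \<epsilon>_def)
  define e where "e = (1 - \<epsilon>) *\<^sub>R ?z + \<epsilon> *\<^sub>R c"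
  have "?z \<in> convex hull W" using segment_subset by auto
  then have e: "e \<in> convex hull W"
    unfolding e_def using eps eps1 assms(1) by (intro convexD_alt) (auto intro: hull_inc)
  have oe: "0 < orient a b e"
    unfolding e_def orient_affine using left[OF assms(1-3)] eps segment_orient[of ?z] by simp
  have z1: "?z $ 1 = (a $ 1 + b $ 1) / 2" by (simp add: midpoint_def)
  have "e $ 1 - ?z $ 1 = \<epsilon> * (c $ 1 - ?z $ 1)" by (simp add: e_def algebra_simps)
  then have "\<bar>e $ 1 - ?z $ 1\<bar> \<le> ?s / 2"
    using \<open>\<epsilon> * ?K \<le> ?s / 2\<close> eps by (simp add: abs_mult)
  then have "min (a $ 1) (b $ 1) \<le> e $ 1 \<and> e $ 1 \<le> max (a $ 1) (b $ 1)"
    unfolding z1 by (auto simp: min_def max_def abs_if field_simps split: if_splits)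
  then obtain e' where "e' \<in> closed_segment a b" "e' $ 1 = e $ 1"
  proof (cases "a $ 1 < b $ 1")
    case True
    then show thesis
      using point_on_chord[of a "e $ 1" b] \<open>min _ _ \<le> _ \<and> _\<close> that by (auto simp: min_def max_def split: if_splits)
  next
    case False
    then show thesis
      using point_on_chord[of b "e $ 1" a] \<open>min _ _ \<le> _ \<and> _\<close> that assms(4)
      by (auto simp: min_def max_def closed_segment_commute split: if_splits)
  qed
  then show thesis using that e oe by metis
qed

lemma not_upper:
  assumes "a $ 1 < b $ 1" "c \<in> W" "c \<noteq> a" "c \<noteq> b"
  shows "\<not> closed_segment a b \<subseteq> upper_hull (convex hull W)"
proof
  assume sub: "closed_segment a b \<subseteq> upper_hull (convex hull W)"
  obtain e e' where e: "e \<in> convex hull W" "e' \<in> closed_segment a b" "e $ 1 = e' $ 1" "0 < orient a b e"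
    using strictly_left_over_segment[OF assms(2-4)] assms(1) by auto
  then have "e $ 2 \<le> e' $ 2" using sub by (auto simp: upper_hull_def)
  then show False using orient_above(2)[OF assms(1) e(3)] e segment_orient by auto
qed

lemma not_lower:
  assumes "b $ 1 < a $ 1" "c \<in> W" "c \<noteq> a" "c \<noteq> b"
  shows "\<not> closed_segment a b \<subseteq> lower_hull (convex hull W)"
proof
  assume sub: "closed_segment a b \<subseteq> lower_hull (convex hull W)"
  obtain e e' where e: "e \<in> convex hull W" "e' \<in> closed_segment a b" "e $ 1 = e' $ 1" "0 < orient a b e"
    using strictly_left_over_segment[OF assms(2-4)] assms(1) by auto
  then have "e' $ 2 \<le> e $ 2" using sub by (auto simp: lower_hull_def)
  then show False using orient_above(2)[OF assms(1) e(3)[symmetric]] e segment_orient orient_swap(2)[of a b] by auto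
qed

end

text \<open>A non-interior point \<open>z\<close> of the hull minimises some nonzero functional over
  it; if the hull is flat, one that is constant on the hull serves. As \<open>z\<close> is strictly
  between \<open>a\<close> and \<open>b\<close>, the functional is constant on their line, hence a
  multiple of \<open>left_normal a b\<close>, and the points \<open>c\<close>, \<open>d\<close> on
  both sides leave only the multiple 0.\<close>

lemma diagonal_interior:
  assumes "finite W" "a \<in> W" "b \<in> W" "c \<in> W" "d \<in> W" "a \<noteq> b" "orient a b c < 0" "0 < orient a b d"
  shows "open_segment a b \<subseteq> interior (convex hull W)"
proof
  fix z assume z: "z \<in> open_segment a b"
  let ?P = "convex hull W"
  have in_P: "a \<in> ?P" "b \<in> ?P" "c \<in> ?P" "d \<in> ?P" using assms by (auto intro: hull_inc)
  have zP: "z \<in> ?P"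
    using z in_P closed_segment_subset[of a ?P b] open_closed_segment by blast
  show "z \<in> interior ?P"
  proof (rule ccontr)
    assume nz: "z \<notin> interior ?P"
    obtain n where n: "n \<noteq> 0" "\<And>y. y \<in> ?P \<Longrightarrow> n \<bullet> z \<le> n \<bullet> y"
    proof -
      have "\<exists>n. n \<noteq> 0 \<and> (\<forall>y\<in>?P. n \<bullet> z \<le> n \<bullet> y)"
      proof (cases "aff_dim ?P = DIM(real ^ 2)")
        case True
        then have "z \<notin> rel_interior ?P" using nz by (simp add: interior_rel_interior_gen)
        then show ?thesis
          using supporting_hyperplane_rel_boundary[OF convex_convex_hull zP] by metis
      next
        case False
        then have "aff_dim ?P < DIM(real ^ 2)" using aff_dim_le_DIM[of ?P] by linarith
        then obtain n r where "n \<noteq> 0" "?P \<subseteq> {x. n \<bullet> x = r}"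
          using aff_lowdim_subset_hyperplane[of ?P] by blast
        then have "n \<bullet> y = r" if "y \<in> ?P" for y using that by blast
        then show ?thesis using zP \<open>n \<noteq> 0\<close> by (intro exI[of _ n]) auto
      qed
      then show thesis using that by blast
    qed
    obtain t where t: "0 < t" "t < 1" "z = (1 - t) *\<^sub>R a + t *\<^sub>R b" using z by (auto simp: in_segment)
    have nz_eq: "n \<bullet> z = (1 - t) * (n \<bullet> a) + t * (n \<bullet> b)" by (simp add: t(3) inner_add_right)
    have le: "n \<bullet> z \<le> n \<bullet> a" "n \<bullet> z \<le> n \<bullet> b" using n(2) in_P by auto
    have eq: "n \<bullet> a = n \<bullet> z" "n \<bullet> b = n \<bullet> z"
    proof -
      have "(1 - t) * (n \<bullet> a - n \<bullet> z) + t * (n \<bullet> b - n \<bullet> z) = 0" using nz_eq by (simp add: algebra_simps)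
      moreover have "(1 - t) * (n \<bullet> a - n \<bullet> z) \<ge> 0" "t * (n \<bullet> b - n \<bullet> z) \<ge> 0" using le t by auto
      ultimately have "(1 - t) * (n \<bullet> a - n \<bullet> z) = 0" "t * (n \<bullet> b - n \<bullet> z) = 0" by linarith+
      then show "n \<bullet> a = n \<bullet> z" "n \<bullet> b = n \<bullet> z" using t by auto
    qed
    have perp: "n $ 1 * (b $ 1 - a $ 1) + n $ 2 * (b $ 2 - a $ 2) = 0"
      using eq by (simp add: inner_vec_def sum_2 algebra_simps)
    obtain \<mu> where mu: "n = \<mu> *\<^sub>R left_normal a b"
    proof -
      have "b $ 1 - a $ 1 \<noteq> 0 \<or> b $ 2 - a $ 2 \<noteq> 0" using assms(6) by (auto simp: vec_eq_iff forall_2)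
      then have "\<exists>\<mu>. n $ 1 = \<mu> * (a $ 2 - b $ 2) \<and> n $ 2 = \<mu> * (b $ 1 - a $ 1)"
      proof
        assume "b $ 1 - a $ 1 \<noteq> 0"
        then show ?thesis using perp by (intro exI[of _ "n $ 2 / (b $ 1 - a $ 1)"]) (auto simp: field_simps)
      next
        assume "b $ 2 - a $ 2 \<noteq> 0"
        then show ?thesis using perp by (intro exI[of _ "n $ 1 / (a $ 2 - b $ 2)"]) (auto simp: field_simps)
      qed
      then show thesis using that by (auto simp: left_normal_def vec_eq_iff forall_2)
    qed
    have "\<mu> * orient a b c \<ge> 0" "\<mu> * orient a b d \<ge> 0"
      using n(2)[OF in_P(3)] n(2)[OF in_P(4)] eq by (auto simp: mu orient_inner algebra_simps)
    then have "\<mu> = 0" using assms(7,8) by (auto simp: zero_le_mult_iff)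
    then show False using n(1) mu by simp
  qed
qed

lemma interior_not_edge:
  fixes a b :: "real ^ 2"
  assumes "a \<noteq> b" "convex S" "open_segment a b \<subseteq> interior S"
  shows "\<not> closed_segment a b edge_of S"
proof
  assume e: "closed_segment a b edge_of S"
  have m: "midpoint a b \<in> open_segment a b" using assms(1) by simp
  then have ne: "interior S \<noteq> {}" using assms(3) by auto
  have f: "closed_segment a b face_of S" "aff_dim (closed_segment a b) = 1" using e by (auto simp: edge_of_def)
  have "closed_segment a b \<noteq> S"
  proof
    assume "closed_segment a b = S"
    then have "aff_dim S = 1" using f(2) by simp
    moreover have "aff_dim S = 2" using aff_dim_nonempty_interior[OF ne] by simp
    ultimately show False by simp
  qed
  then have "closed_segment a b \<inter> interior S = {}" using face_of_disjoint_interior f(1) by blast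
  then show False using m assms(3) open_closed_segment[OF m] by blast
qed

section \<open>The polygon with its vertices ordered by abscissa\<close>

locale generic_polygon =
  fixes n :: nat and P :: "(real ^ 2) set"
  assumes n_pos: "n \<ge> 1" and polytope: "polytope P" and card_vertices: "card (vertices P) = n + 3"
    and generic: "inj_on (\<lambda>v. v $ 1) (vertices P)"
begin

lemma finite_vertices: "finite (vertices P)"
  using card_vertices by (intro card_ge_0_finite) simp

lemma P_hull: "P = convex hull (vertices P)"
  unfolding vertices_def
  by (rule Krein_Milman_Minkowski) (use polytope in \<open>auto intro: polytope_imp_compact polytope_imp_convex\<close>)

lemma vertices_in_P: "v \<in> vertices P \<Longrightarrow> v \<in> P"
  by (auto simp: vertices_def extreme_point_of_def)

lemma vertex_not_in_hull:
  assumes "v \<in> vertices P"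
  shows "v \<notin> convex hull (vertices P - {v})"
proof -
  have "convex (P - {v})"
    using assms extreme_point_of_stillconvex[of P v] polytope_imp_convex[OF polytope] by (auto simp: vertices_def)
  moreover have "vertices P - {v} \<subseteq> P - {v}" using vertices_in_P by auto
  ultimately have "convex hull (vertices P - {v}) \<subseteq> P - {v}" by (rule hull_minimal[rotated])
  then show ?thesis by auto
qed

definition rank :: "real ^ 2 \<Rightarrow> nat" where
  "rank v = card {u \<in> vertices P. u $ 1 < v $ 1}"

lemma rank_less:
  assumes "u \<in> vertices P" "u $ 1 < v $ 1"
  shows "rank u < rank v"
  unfolding rank_def
  by (rule psubset_card_mono) (use assms finite_vertices in \<open>auto intro: less_trans\<close>)

lemma rank_bij: "bij_betw rank (vertices P) {..n + 2}"
proof -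
  have inj: "inj_on rank (vertices P)"
  proof (rule inj_onI)
    fix u v assume uv: "u \<in> vertices P" "v \<in> vertices P" "rank u = rank v"
    then have "u $ 1 = v $ 1" using rank_less[of u v] rank_less[of v u] by force
    then show "u = v" using generic uv by (auto dest: inj_onD)
  qed
  have "rank v < n + 3" if "v \<in> vertices P" for v
    unfolding rank_def card_vertices[symmetric]
    by (rule psubset_card_mono) (use that finite_vertices in auto)
  then have "rank ` vertices P \<subseteq> {..n + 2}" by fastforce
  moreover have "card (rank ` vertices P) = card {..n + 2}" using card_image[OF inj] card_vertices by simp
  ultimately have "rank ` vertices P = {..n + 2}" by (intro card_subset_eq) auto
  then show ?thesis using inj by (simp add: bij_betw_def)
qed

lemma vtx_rank:
  assumes "k \<le> n + 2"
  shows "vtx P k \<in> vertices P" "rank (vtx P k) = k"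
proof -
  have "k \<in> rank ` vertices P" using rank_bij assms by (simp add: bij_betw_def)
  then obtain v where v: "v \<in> vertices P" "rank v = k" by auto
  have "vtx P k \<in> vertices P \<and> rank (vtx P k) = k"
    unfolding vtx_def rank_def
    by (rule theI[of _ v]) (use v rank_bij in \<open>auto simp: rank_def[symmetric] bij_betw_def dest: inj_onD\<close>)
  then show "vtx P k \<in> vertices P" "rank (vtx P k) = k" by auto
qed

lemma vtx_bij: "bij_betw (vtx P) {..n + 2} (vertices P)"
proof -
  have "inj_on (vtx P) {..n + 2}"
    using vtx_rank(2) by (intro inj_on_inverseI[of _ rank]) auto
  moreover have "v \<in> vtx P ` {..n + 2}" if "v \<in> vertices P" for v
  proof -
    have "rank v \<le> n + 2" using rank_bij that by (auto simp: bij_betw_def)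
    then have "vtx P (rank v) = v"
      using vtx_rank[of "rank v"] rank_bij that by (auto simp: bij_betw_def dest: inj_onD)
    then show ?thesis using \<open>rank v \<le> n + 2\<close> by force
  qed
  ultimately show ?thesis using vtx_rank(1) by (auto simp: bij_betw_def)
qed

lemma vtx_less: "i < j \<Longrightarrow> j \<le> n + 2 \<Longrightarrow> vtx P i $ 1 < vtx P j $ 1"
proof (rule ccontr)
  assume a: "i < j" "j \<le> n + 2" "\<not> vtx P i $ 1 < vtx P j $ 1"
  have v: "vtx P i \<in> vertices P" "vtx P j \<in> vertices P" "rank (vtx P i) = i" "rank (vtx P j) = j"
    using vtx_rank a by auto
  have "vtx P i $ 1 \<noteq> vtx P j $ 1" using inj_onD[OF generic _ v(1,2)] v a(1) by auto
  then have "rank (vtx P j) < rank (vtx P i)" using rank_less[OF v(2), of "vtx P i"] a(3) by auto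
  then show False using v a by simp
qed

lemma vtx_neq: "i \<noteq> j \<Longrightarrow> i \<le> n + 2 \<Longrightarrow> j \<le> n + 2 \<Longrightarrow> vtx P i \<noteq> vtx P j"
  using vtx_bij by (auto simp: bij_betw_def dest: inj_onD)

text \<open>
  A vertex cannot lie between two chords of other vertices: it would not be extreme. So whether
  a vertex is below or above a chord whose endpoints are to its left and right is independent of
  the chord.
\<close>

lemma same_side:
  assumes "i < j" "j < k" "k \<le> n + 2" "i' < j" "j < k'" "k' \<le> n + 2"
    "0 \<le> orient (vtx P i) (vtx P k) (vtx P j)" "orient (vtx P i') (vtx P k') (vtx P j) \<le> 0"
  shows False
proof -
  let ?v = "vtx P j" and ?S = "convex hull (vertices P - {vtx P j})"
  have less: "vtx P i $ 1 < ?v $ 1" "?v $ 1 < vtx P k $ 1" "vtx P i' $ 1 < ?v $ 1" "?v $ 1 < vtx P k' $ 1"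
    using vtx_less assms by auto
  obtain y where y: "y \<in> closed_segment (vtx P i) (vtx P k)" "y $ 1 = ?v $ 1" "orient (vtx P i) (vtx P k) y = 0"
    using point_on_chord[of "vtx P i" "?v $ 1" "vtx P k"] less by force
  obtain z where z: "z \<in> closed_segment (vtx P i') (vtx P k')" "z $ 1 = ?v $ 1" "orient (vtx P i') (vtx P k') z = 0"
    using point_on_chord[of "vtx P i'" "?v $ 1" "vtx P k'"] less by force
  have "vtx P a \<in> ?S" if "a \<noteq> j" "a \<le> n + 2" for a
    using that vtx_rank(1)[of a] vtx_neq[of a j] assms by (intro hull_inc) auto
  then have "vtx P i \<in> ?S" "vtx P k \<in> ?S" "vtx P i' \<in> ?S" "vtx P k' \<in> ?S" using assms by auto
  then have "y \<in> ?S" "z \<in> ?S" using y(1) z(1) closed_segment_subset[of _ ?S] by blast+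
  moreover have "y $ 2 \<le> ?v $ 2"
    using orient_above(2)[of "vtx P i" "vtx P k" y ?v] y assms(7) less by simp
  moreover have "?v $ 2 \<le> z $ 2"
    using orient_above(2)[of "vtx P i'" "vtx P k'" ?v z] z assms(8) less by simp
  ultimately have "?v \<in> ?S" using vertical_convex(2)[of ?S y z ?v] y z by simp
  then show False using vertex_not_in_hull vtx_rank(1)[of j] assms by auto
qed

text \<open>The chord from the leftmost to the rightmost vertex serves as reference. The inequality
  is strict, so both of its ends count as not up and are placed on the lower run of
  positions.\<close>

definition up :: "nat \<Rightarrow> bool" where
  "up j \<longleftrightarrow> 0 < orient (vtx P 0) (vtx P (n + 2)) (vtx P j)"

lemma not_up_ends: "\<not> up 0" "\<not> up (n + 2)"
  by (auto simp: up_def)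

text \<open>By \<open>same_side\<close> the position of \<open>j\<close> relative to the reference
  chord decides its position, strictly, relative to every chord that passes over or under
  it.\<close>

lemma orient_vtx:
  assumes "i < j" "j < k" "k \<le> n + 2"
  shows "if up j then orient (vtx P i) (vtx P j) (vtx P k) < 0 else 0 < orient (vtx P i) (vtx P j) (vtx P k)"
proof -
  have s: "orient (vtx P i) (vtx P j) (vtx P k) = - orient (vtx P i) (vtx P k) (vtx P j)"
    by (rule orient_swap)
  have "\<not> (0 \<le> orient (vtx P i) (vtx P k) (vtx P j) \<and> orient (vtx P 0) (vtx P (n + 2)) (vtx P j) \<le> 0)"
    "\<not> (0 \<le> orient (vtx P 0) (vtx P (n + 2)) (vtx P j) \<and> orient (vtx P i) (vtx P k) (vtx P j) \<le> 0)"
    using same_side[OF assms, of 0 "n + 2"] same_side[of 0 j "n + 2" i k] assms by auto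
  then show ?thesis unfolding s up_def by auto
qed

lemma strictly_over_chord:
  assumes "0 < j" "j < n + 2"
  obtains y where "y \<in> P" "y $ 1 = vtx P j $ 1" "y \<noteq> vtx P j" "up j \<longleftrightarrow> y $ 2 < vtx P j $ 2"
proof -
  let ?v = "vtx P j"
  have less: "vtx P 0 $ 1 < ?v $ 1" "?v $ 1 < vtx P (n + 2) $ 1" using vtx_less assms by auto
  obtain y where y: "y \<in> closed_segment (vtx P 0) (vtx P (n + 2))" "y $ 1 = ?v $ 1" "orient (vtx P 0) (vtx P (n + 2)) y = 0"
    using point_on_chord[of "vtx P 0" "?v $ 1" "vtx P (n + 2)"] less by force
  have "y \<in> P"
    using y(1) vtx_rank(1)[of 0] vtx_rank(1)[of "n + 2"] vertices_in_P
      closed_segment_subset[OF _ _ polytope_imp_convex[OF polytope]] by (meson le0 order_refl subsetD)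
  moreover have "y \<noteq> ?v"
    using orient_vtx[of 0 j "n + 2"] y(3) assms orient_swap(1)[of "vtx P 0" "vtx P (n + 2)" ?v] by (auto split: if_splits)
  moreover have "up j \<longleftrightarrow> y $ 2 < ?v $ 2"
    using orient_above(1)[of "vtx P 0" "vtx P (n + 2)" y ?v] y less by (simp add: up_def)
  ultimately show thesis using that y(2) by blast
qed

text \<open>On the vertical through a vertex, the reference chord provides a point of
  \<open>P\<close> on one side; a point of \<open>P\<close> on the other side would put the vertex
  inside a segment, against extremality.\<close>

lemma up_down_labels: "up_labels n P = {j \<in> {1..n + 1}. up j}" "down_labels n P = {j \<in> {1..n + 1}. \<not> up j}"
proof -
  have "(vtx P j \<in> upper_hull P \<longleftrightarrow> up j) \<and> (vtx P j \<in> lower_hull P \<longleftrightarrow> \<not> up j)" if j: "j \<in> {1..n + 1}" for j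
  proof -
    let ?v = "vtx P j"
    obtain y where y: "y \<in> P" "y $ 1 = ?v $ 1" "y \<noteq> ?v" "up j \<longleftrightarrow> y $ 2 < ?v $ 2"
      using strictly_over_chord[of j] j by auto
    have yv: "y $ 2 \<noteq> ?v $ 2" using y(2,3) by (auto simp: vec_eq_iff forall_2)
    have v: "?v extreme_point_of P" "?v \<in> P"
      using vtx_rank(1)[of j] j vertices_in_P by (auto simp: vertices_def)
    have no: False if "q \<in> P" "q $ 1 = ?v $ 1" "y $ 2 < ?v $ 2 \<and> ?v $ 2 < q $ 2 \<or> q $ 2 < ?v $ 2 \<and> ?v $ 2 < y $ 2" for q
    proof -
      have "?v \<in> closed_segment y q"
        using that(3)
      proof
        assume "y $ 2 < ?v $ 2 \<and> ?v $ 2 < q $ 2"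
        then show ?thesis using vertical_convex(1)[of UNIV y q ?v] y(2) that(2) by simp
      next
        assume "q $ 2 < ?v $ 2 \<and> ?v $ 2 < y $ 2"
        then show ?thesis
          using vertical_convex(1)[of UNIV q y ?v] y(2) that(2) by (simp add: closed_segment_commute)
      qed
      moreover have "?v \<noteq> y" "?v \<noteq> q" using that(3) by auto
      ultimately have "?v \<in> open_segment y q" by (simp add: open_segment_def)
      then show False using v(1) y(1) that(1) by (auto simp: extreme_point_of_def)
    qed
    have "?v \<in> upper_hull P" if "up j"
      using no y(4) that v(2) by (force simp: upper_hull_def)
    moreover have "?v \<notin> upper_hull P" if "\<not> up j"
      using y that yv by (force simp: upper_hull_def)
    moreover have "?v \<in> lower_hull P" if "\<not> up j"
      using no y(4) yv that v(2) by (force simp: lower_hull_def)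
    moreover have "?v \<notin> lower_hull P" if "up j"
      using y that by (force simp: lower_hull_def)
    ultimately show ?thesis by blast
  qed
  then show "up_labels n P = {j \<in> {1..n + 1}. up j}" "down_labels n P = {j \<in> {1..n + 1}. \<not> up j}"
    by (auto simp: up_labels_def down_labels_def)
qed

end

text \<open>The labels outside \<open>U\<close> in increasing order, then those in \<open>U\<close>
  in decreasing order: for the up labels this is the counterclockwise tour from the leftmost vertex.
  As \<open>0\<close> is not in \<open>U\<close>, the first block is nonempty and \<open>M\<close>
  is its last index.\<close>

lemma unimodal_labels_exist:
  fixes U :: "nat set"
  assumes "U \<subseteq> {..m}" "0 \<notin> U"
  obtains l M where "bij_betw l {..m} {..m}" "unimodal_labels l m M" "\<And>p. p \<le> m \<Longrightarrow> p \<le> M \<longleftrightarrow> l p \<notin> U"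
proof -
  define xs ys where "xs = sorted_list_of_set ({..m} - U)" and "ys = rev (sorted_list_of_set U)"
  have fU: "finite U" using assms(1) finite_subset by blast
  have sets: "set xs = {..m} - U" "set ys = U" "distinct xs" "distinct ys"
    using fU by (auto simp: xs_def ys_def)
  have len: "length (xs @ ys) = m + 1"
    using distinct_card[OF sets(3)] distinct_card[OF sets(4)] sets card_Diff_subset[OF fU assms(1)]
      card_mono[OF _ assms(1)] by simp
  have lx: "0 < length xs" using sets(1) assms(2) by auto
  have sx: "sorted_wrt (<) xs" "sorted_wrt (>) ys"
    by (auto simp: xs_def ys_def sorted_wrt_rev strict_sorted_iff)
  let ?l = "\<lambda>p. (xs @ ys) ! p" and ?M = "length xs - 1"
  have bij: "bij_betw ?l {..m} {..m}"
  proof (rule bij_betw_nth)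
    show "distinct (xs @ ys)" using sets by auto
    show "{..m} = {..<length (xs @ ys)}" using len by auto
    show "{..m} = set (xs @ ys)" using sets assms(1) by auto
  qed
  have "unimodal_labels ?l m ?M"
  proof
    show "inj_on ?l {..m}" using bij by (simp add: bij_betw_def)
    fix p q :: nat assume pq: "p < q" "q \<le> m"
    show "?l p < ?l q" if "q \<le> ?M"
    proof -
      have "p < length xs" "q < length xs" using that pq lx by linarith+
      then show ?thesis using pq sorted_wrt_nth_less[OF sx(1), of p q] by (simp add: nth_append)
    qed
    show "?l q < ?l p" if "?M < p"
    proof -
      have "\<not> p < length xs" "\<not> q < length xs" using that pq lx by linarith+
      then show ?thesis
        using pq len sorted_wrt_nth_less[OF sx(2), of "p - length xs" "q - length xs"] by (simp add: nth_append)
    qed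
  qed
  moreover have "p \<le> ?M \<longleftrightarrow> ?l p \<notin> U" if "p \<le> m" for p
  proof (cases "p < length xs")
    case True
    then have "?l p \<in> {..m} - U" using nth_mem[OF True] sets(1) by (simp add: nth_append)
    then show ?thesis using True by auto
  next
    case False
    then have "p - length xs < length ys" using that len by auto
    then have "?l p \<in> U" using False nth_mem[of "p - length xs" ys] sets(2) by (simp add: nth_append)
    moreover have "\<not> p \<le> ?M" using False lx by linarith
    ultimately show ?thesis by simp
  qed
  ultimately show thesis using that bij by blast
qed

section \<open>Counterclockwise positions, and triangulations as trees\<close>

locale polygon_positions = generic_polygon n P + unimodal_labels l "n + 2" M
  for n :: nat and P :: "(real ^ 2) set" and l :: "nat \<Rightarrow> nat" and M :: nat +
  assumes l_bij: "bij_betw l {..n + 2} {..n + 2}"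
    and up_iff: "\<And>p. p \<le> n + 2 \<Longrightarrow> up (l p) \<longleftrightarrow> M < p"
begin

abbreviation w :: "nat \<Rightarrow> real ^ 2" where
  "w p \<equiv> vtx P (l p)"

lemma l_le: "p \<le> n + 2 \<Longrightarrow> l p \<le> n + 2"
  using l_bij by (auto simp: bij_betw_def)

lemma w_bij: "bij_betw w {..n + 2} (vertices P)"
  using bij_betw_trans[OF l_bij vtx_bij] by (simp add: o_def)

lemma w_less: "p \<le> n + 2 \<Longrightarrow> q \<le> n + 2 \<Longrightarrow> l p < l q \<Longrightarrow> w p $ 1 < w q $ 1"
  using vtx_less l_le by blast

lemma w_neq: "p \<noteq> q \<Longrightarrow> p \<le> n + 2 \<Longrightarrow> q \<le> n + 2 \<Longrightarrow> w p \<noteq> w q"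
  using w_bij by (auto simp: bij_betw_def dest: inj_onD)

text \<open>With the three vertices sorted by label, the orientation depends only on whether the
  middle one is up; unimodality makes the order of positions agree with it, up to rotation, in each
  case.\<close>

lemma ccw:
  assumes "p < r" "r < q" "q \<le> n + 2"
  shows "0 < orient (w p) (w r) (w q)"
proof -
  have le: "p \<le> n + 2" "r \<le> n + 2" "l p \<le> n + 2" "l r \<le> n + 2" "l q \<le> n + 2" using assms l_le by auto
  note rf = rise_fall[of p r] rise_fall[of r q] rise_fall[of p q]
  have c: "0 < orient (vtx P i) (vtx P j) (vtx P k)" if "i < j" "j < k" "k \<le> n + 2" "\<not> up j" for i j k
    using orient_vtx[OF that(1-3)] that(4) by simp
  have d: "0 < orient (vtx P k) (vtx P j) (vtx P i)" if "i < j" "j < k" "k \<le> n + 2" "up j" for i j k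
    using orient_vtx[OF that(1-3)] that(4) orient_swap[of "vtx P i" "vtx P j" "vtx P k"]
      orient_rotate[of "vtx P k" "vtx P j" "vtx P i"] orient_rotate[of "vtx P i" "vtx P k" "vtx P j"] by simp
  show ?thesis
  proof (cases rule: mid_cases[OF assms])
    case 1
    show ?thesis
    proof (cases "r \<le> M")
      case True
      then have "l p < l r \<and> l r < l q" using 1(2) rf(1) assms by auto
      then show ?thesis using c[of "l p" "l r" "l q"] up_iff[of r] le True by auto
    next
      case False
      then have "l q < l r \<and> l r < l p" using 1(2) rf(2) assms by auto
      then show ?thesis using d[of "l q" "l r" "l p"] up_iff[of r] le False by auto
    qed
  next
    case 2
    have "p \<le> M" "l q < l p" "l p < l r" using 2(2) rf assms by auto
    then have "0 < orient (w q) (w p) (w r)" using c[of "l q" "l p" "l r"] up_iff[of p] le by auto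
    then show ?thesis by (simp only: orient_rotate[of "w p" "w r" "w q"])
  next
    case 3
    have "M < q" "l p < l q" "l q < l r" using 3(2) rf assms by auto
    then have "0 < orient (w r) (w q) (w p)" using d[of "l p" "l q" "l r"] up_iff[of q] le assms by auto
    then show ?thesis by (simp only: orient_rotate[of "w r" "w q" "w p"])
  qed
qed

lemma positions_exist:
  assumes "v \<in> vertices P"
  obtains p where "p \<le> n + 2" "v = w p"
  using assms w_bij by (auto simp: bij_betw_def)

lemma edge_succ:
  assumes "p < n + 2"
  shows "polygon_edge (vertices P) (w p) (w (Suc p))"
proof
  show "finite (vertices P)" by (rule finite_vertices)
  show "w p \<in> vertices P" "w (Suc p) \<in> vertices P" using assms w_bij by (auto simp: bij_betw_def)
  show "w p \<noteq> w (Suc p)" using w_neq assms by auto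
  fix c assume c: "c \<in> vertices P" "c \<noteq> w p" "c \<noteq> w (Suc p)"
  obtain q where q: "q \<le> n + 2" "c = w q" using positions_exist[OF c(1)] by blast
  then have "q < p \<or> Suc p < q" using c(2,3) by (metis Suc_lessI nat_neq_iff)
  then show "0 < orient (w p) (w (Suc p)) c"
    using ccw[of p "Suc p" q] ccw[of q p "Suc p"] orient_rotate[of "w p" "w (Suc p)" c] q assms by auto
qed

lemma edge_closing: "polygon_edge (vertices P) (w (n + 2)) (w 0)"
proof
  show "finite (vertices P)" by (rule finite_vertices)
  show "w (n + 2) \<in> vertices P" "w 0 \<in> vertices P" using w_bij by (auto simp: bij_betw_def)
  show "w (n + 2) \<noteq> w 0" using w_neq by auto
  fix c assume c: "c \<in> vertices P" "c \<noteq> w (n + 2)" "c \<noteq> w 0"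
  obtain q where q: "q \<le> n + 2" "c = w q" using positions_exist[OF c(1)] by blast
  then have "q \<noteq> 0" "q \<noteq> n + 2" using c(2,3) by metis+
  then have "0 < q" "q < n + 2" using q(1) by linarith+
  then show "0 < orient (w (n + 2)) (w 0) c"
    using ccw[of 0 q "n + 2"] orient_rotate[of "w 0" c "w (n + 2)"] q by auto
qed

definition label_chord :: "nat \<times> nat \<Rightarrow> chord" where
  "label_chord = (\<lambda>(p, q). (min (l p) (l q), max (l p) (l q)))"

lemma label_chord_segments:
  "closed_chord P (label_chord (p, q)) = closed_segment (w p) (w q)"
  "open_chord P (label_chord (p, q)) = open_segment (w p) (w q)"
  by (auto simp: label_chord_def min_def max_def closed_segment_commute open_segment_commute)

lemma label_chord_bij: "bij_betw label_chord {(p, q). p < q \<and> q \<le> n + 2} (chords n)"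
  unfolding bij_betw_def
proof
  have linj: "p = q" if "l p = l q" "p \<le> n + 2" "q \<le> n + 2" for p q
    using l_bij that by (auto simp: bij_betw_def dest: inj_onD)
  show "inj_on label_chord {(p, q). p < q \<and> q \<le> n + 2}"
  proof (rule inj_onI, clarify)
    fix p q p' q' assume a: "p < q" "q \<le> n + 2" "p' < q'" "q' \<le> n + 2" "label_chord (p, q) = label_chord (p', q')"
    then have "l p = l p' \<and> l q = l q' \<or> l p = l q' \<and> l q = l p'"
      by (auto simp: label_chord_def min_def max_def split: if_splits)
    then show "p = p' \<and> q = q'"
      using linj[of p p'] linj[of q q'] linj[of p q'] linj[of q p'] a(1-4) by auto
  qed
  show "label_chord ` {(p, q). p < q \<and> q \<le> n + 2} = chords n"
  proof (intro antisym subsetI)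
    fix d assume "d \<in> label_chord ` {(p, q). p < q \<and> q \<le> n + 2}"
    then obtain p q where d: "d = label_chord (p, q)" "p < q" "q \<le> n + 2" by auto
    then show "d \<in> chords n"
      using l_neq[of p q] l_le[of p] l_le[of q] by (auto simp: label_chord_def chords_def min_def max_def)
  next
    fix d assume "d \<in> chords n"
    then obtain i j where d: "d = (i, j)" "i < j" "j \<le> n + 2" by (auto simp: chords_def)
    then have "i \<in> l ` {..n + 2}" "j \<in> l ` {..n + 2}" using l_bij by (auto simp: bij_betw_def)
    then obtain p q where pq: "p \<le> n + 2" "q \<le> n + 2" "i = l p" "j = l q" by auto
    show "d \<in> label_chord ` {(p, q). p < q \<and> q \<le> n + 2}"
    proof (cases "p < q")
      case True
      then show ?thesis using d pq by (intro image_eqI[of _ _ "(p, q)"]) (auto simp: label_chord_def)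
    next
      case False
      then have "q < p" using d pq by (metis linorder_neqE_nat less_irrefl)
      then show ?thesis using d pq by (intro image_eqI[of _ _ "(q, p)"]) (auto simp: label_chord_def)
    qed
  qed
qed

lemma another_vertex:
  fixes a b :: "real ^ 2"
  obtains c where "c \<in> vertices P" "c \<noteq> a" "c \<noteq> b"
proof -
  have "card {a, b} \<le> 2" by (simp add: card_insert_if)
  then have "\<not> vertices P \<subseteq> {a, b}"
    using card_mono[of "{a, b}" "vertices P"] card_vertices n_pos by auto
  then show thesis using that by blast
qed

text \<open>The two sides of the diagonal are witnessed by position \<open>p + 1\<close> and by any
  position outside \<open>{p..q}\<close>, which exists because the closing edge is excluded.\<close>

lemma diagonal_internal:
  assumes "(p, q) \<in> diagonals (n + 2)"
  shows "open_segment (w p) (w q) \<subseteq> interior P"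
proof -
  have pq: "p + 1 < q" "q \<le> n + 2" "p \<noteq> 0 \<or> q \<noteq> n + 2" using assms by (auto simp: diagonals_def)
  obtain d where d: "d \<le> n + 2" "d < p \<or> q < d" using pq(3)
    by (metis bot_nat_0.not_eq_extremum le_less_trans less_le linorder_not_le nat_le_linear pq(2))
  have "0 < orient (w p) (w q) (w d)"
    using d(2) ccw[of p q d] ccw[of d p q] orient_rotate[of "w p" "w q" "w d"] pq d(1) by auto
  moreover have "orient (w p) (w q) (w (p + 1)) < 0"
    using ccw[of p "p + 1" q] orient_swap(1)[of "w p" "w q" "w (p + 1)"] pq by auto
  moreover have "w p \<in> vertices P" "w q \<in> vertices P" "w d \<in> vertices P" "w (p + 1) \<in> vertices P" "w p \<noteq> w q"
    using w_bij pq d w_neq[of p q] by (auto simp: bij_betw_def)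
  ultimately have "open_segment (w p) (w q) \<subseteq> interior (convex hull (vertices P))"
    using diagonal_interior[OF finite_vertices, of "w p" "w q" "w (p + 1)" "w d"] by blast
  then show ?thesis using P_hull by simp
qed

lemma internal_iff:
  assumes "p < q" "q \<le> n + 2"
  shows "label_chord (p, q) \<in> internal_diagonals n P \<longleftrightarrow> (p, q) \<in> diagonals (n + 2)"
proof -
  have "label_chord (p, q) \<in> chords n" using label_chord_bij assms by (auto simp: bij_betw_def)
  moreover have "\<not> open_segment (w p) (w q) \<subseteq> interior P" if "(p, q) \<notin> diagonals (n + 2)"
  proof -
    have "q = Suc p \<or> p = 0 \<and> q = n + 2" using that assms by (auto simp: diagonals_def)
    then show ?thesis
      using polygon_edge.not_interior[OF edge_succ[of p]] polygon_edge.not_interior[OF edge_closing] assms P_hull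
      by (auto simp: open_segment_commute)
  qed
  ultimately show ?thesis
    using diagonal_internal by (auto simp: internal_diagonals_def label_chord_segments)
qed

lemma bottom_top_iff:
  assumes "p < q" "q \<le> n + 2"
  shows "label_chord (p, q) \<in> bottom_edges n P \<longleftrightarrow> q = Suc p \<and> l p < l q \<or> (p, q) = (0, n + 2) \<and> l q < l p"
    and "label_chord (p, q) \<in> top_edges n P \<longleftrightarrow> q = Suc p \<and> l q < l p \<or> (p, q) = (0, n + 2) \<and> l p < l q"
proof -
  have ch: "label_chord (p, q) \<in> chords n" using label_chord_bij assms by (auto simp: bij_betw_def)
  have lt: "l p < l q \<or> l q < l p" using l_neq[OF assms] by auto
  note le = assms(1)[THEN less_imp_le, THEN order.trans, OF assms(2)]
  have main: "(label_chord (p, q) \<in> bottom_edges n P \<longleftrightarrow> q = Suc p \<and> l p < l q \<or> (p, q) = (0, n + 2) \<and> l q < l p) \<and>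
    (label_chord (p, q) \<in> top_edges n P \<longleftrightarrow> q = Suc p \<and> l q < l p \<or> (p, q) = (0, n + 2) \<and> l p < l q)"
  proof (cases "(p, q) \<in> diagonals (n + 2)")
    case True
    then have "\<not> closed_segment (w p) (w q) edge_of P"
      using interior_not_edge[OF w_neq polytope_imp_convex[OF polytope] diagonal_internal[OF True]] assms le by auto
    moreover have "q \<noteq> Suc p" "(p, q) \<noteq> (0, n + 2)" using True by (auto simp: diagonals_def)
    ultimately show ?thesis by (auto simp: bottom_edges_def top_edges_def label_chord_segments)
  next
    case False
    then have "q = Suc p \<or> p = 0 \<and> q = n + 2" using assms by (auto simp: diagonals_def)
    then consider "q = Suc p" | "q \<noteq> Suc p" "p = 0" "q = n + 2" by blast
    then show ?thesis
    proof cases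
      case 1
      have "p < n + 2" "(p, q) \<noteq> (0, n + 2)" using 1 assms n_pos by auto
      interpret E: polygon_edge "vertices P" "w p" "w q" using edge_succ[OF \<open>p < n + 2\<close>] 1 by simp
      obtain c where c: "c \<in> vertices P" "c \<noteq> w p" "c \<noteq> w q" by (rule another_vertex)
      show ?thesis
        using E.edge E.lower E.upper E.not_upper[OF _ c] E.not_lower[OF _ c] ch lt 1 \<open>(p, q) \<noteq> (0, n + 2)\<close>
          w_less[of p q] w_less[of q p] assms le P_hull[symmetric]
        by (auto simp: bottom_edges_def top_edges_def label_chord_segments)
    next
      case 2
      interpret E: polygon_edge "vertices P" "w q" "w p" using edge_closing 2 by simp
      obtain c where c: "c \<in> vertices P" "c \<noteq> w q" "c \<noteq> w p" by (rule another_vertex)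
      have cc: "closed_chord P (label_chord (p, q)) = closed_segment (w q) (w p)"
        by (rule trans[OF label_chord_segments(1) closed_segment_commute])
      let ?s = "closed_segment (w q) (w p)"
      have e: "?s edge_of P" using E.edge P_hull by simp
      have mem: "label_chord (p, q) \<in> bottom_edges n P \<longleftrightarrow> ?s \<subseteq> lower_hull P"
        "label_chord (p, q) \<in> top_edges n P \<longleftrightarrow> ?s \<subseteq> upper_hull P"
        using ch e by (simp_all add: bottom_edges_def top_edges_def cc)
      have hull: "?s \<subseteq> lower_hull P \<longleftrightarrow> l q < l p" "?s \<subseteq> upper_hull P \<longleftrightarrow> l p < l q"
        using E.lower E.upper E.not_upper[OF _ c] E.not_lower[OF _ c] lt
          w_less[of p q] w_less[of q p] assms le P_hull[symmetric] by auto
      show ?thesis unfolding mem hull using 2 by simp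
    qed
  qed
  then show "label_chord (p, q) \<in> bottom_edges n P \<longleftrightarrow> q = Suc p \<and> l p < l q \<or> (p, q) = (0, n + 2) \<and> l q < l p"
    "label_chord (p, q) \<in> top_edges n P \<longleftrightarrow> q = Suc p \<and> l q < l p \<or> (p, q) = (0, n + 2) \<and> l p < l q" by auto
qed

text \<open>If interleaved, each chord has its ends strictly on different sides of the other, and
  the common point is computed. If not, both ends of one chord lie weakly on one side of the other,
  at least one of them strictly.\<close>

lemma chords_disjoint_iff:
  assumes "p < q" "q \<le> n + 2" "p' < q'" "q' \<le> n + 2" "(p, q) \<noteq> (p', q')"
  shows "open_segment (w p) (w q) \<inter> open_segment (w p') (w q') = {} \<longleftrightarrow>
    \<not> interleaved (p, q) (p', q') \<and> \<not> interleaved (p', q') (p, q)"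
proof -
  have meet: "open_segment (w a) (w b) \<inter> open_segment (w c) (w d) \<noteq> {}"
    if "a < c" "c < b" "b < d" "d \<le> n + 2" for a b c d
  proof -
    let ?a = "w a" and ?b = "w b" and ?c = "w c" and ?d = "w d"
    define \<alpha> \<beta> \<gamma> \<delta> where "\<alpha> = orient ?a ?b ?c" "\<beta> = orient ?a ?b ?d" "\<gamma> = orient ?c ?d ?a" "\<delta> = orient ?c ?d ?b"
    note defs = \<alpha>_\<beta>_\<gamma>_\<delta>_def
    have sg: "\<alpha> < 0" "0 < \<beta>" "0 < \<gamma>" "\<delta> < 0"
      using ccw[of a c b] ccw[of a b d] ccw[of a c d] ccw[of c b d] that
        orient_swap(1)[of ?a ?b ?c] orient_rotate[of ?c ?d ?a] orient_swap(1)[of ?c ?d ?b]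
      by (auto simp: defs)
    \<comment> \<open>Both differences are the cross product of \<open>?b - ?a\<close> and
      \<open>?d - ?c\<close>, so one denominator \<open>s\<close> serves both parametrisations of
      the common point.\<close>
    have eq: "\<beta> - \<alpha> = \<gamma> - \<delta>" by (simp add: defs orient_def algebra_simps)
    define s where "s = \<beta> - \<alpha>"
    have s: "s > 0" "s = \<gamma> - \<delta>" using sg eq by (auto simp: s_def)
    have coord: "\<beta> * ?c $ i - \<alpha> * ?d $ i = \<gamma> * ?b $ i - \<delta> * ?a $ i" for i
      using exhaust_2[of i] by (auto simp: defs orient_def algebra_simps)
    define z where "z = (1 - \<gamma> / s) *\<^sub>R ?a + (\<gamma> / s) *\<^sub>R ?b"
    have "z = (1 - (- \<alpha> / s)) *\<^sub>R ?c + (- \<alpha> / s) *\<^sub>R ?d"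
    proof (rule vec_eq_iff[THEN iffD2, rule_format])
      fix i
      have e1: "1 - \<gamma> / s = - \<delta> / s" "1 - (- \<alpha> / s) = \<beta> / s" using s s_def by (auto simp: field_simps)
      have "z $ i = (\<gamma> * ?b $ i - \<delta> * ?a $ i) / s"
        unfolding z_def e1 using s(1) by (simp add: field_simps)
      also have "\<dots> = (\<beta> * ?c $ i - \<alpha> * ?d $ i) / s" using coord by simp
      also have "\<dots> = ((1 - (- \<alpha> / s)) *\<^sub>R ?c + (- \<alpha> / s) *\<^sub>R ?d) $ i"
        unfolding e1 using s(1) by (simp add: field_simps)
      finally show "z $ i = \<dots>" .
    qed
    moreover have "0 < \<gamma> / s" "\<gamma> / s < 1" "0 < - \<alpha> / s" "- \<alpha> / s < 1" using s sg s_def by (auto simp: field_simps)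
    moreover have "?a \<noteq> ?b" "?c \<noteq> ?d" using w_neq[of a b] w_neq[of c d] that by auto
    ultimately have "z \<in> open_segment ?a ?b" "z \<in> open_segment ?c ?d"
      unfolding in_segment using z_def by blast+
    then show ?thesis by blast
  qed
  have zero: "t * orient x y b + (1 - t) * orient x y a = 0"
    if z: "z = (1 - t) *\<^sub>R a + t *\<^sub>R b" "z \<in> open_segment x y" for t x y z and a b :: "real ^ 2"
  proof -
    obtain u where "z = (1 - u) *\<^sub>R x + u *\<^sub>R y" using z(2) by (auto simp: in_segment)
    then have "orient x y z = 0" by (simp add: orient_affine)
    then show ?thesis using z(1) by (simp add: orient_affine)
  qed
  have same: "open_segment x y \<inter> open_segment a b = {}"
    if "0 < orient x y a \<and> 0 \<le> orient x y b \<or> 0 \<le> orient x y a \<and> 0 < orient x y b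
      \<or> orient x y a < 0 \<and> orient x y b \<le> 0 \<or> orient x y a \<le> 0 \<and> orient x y b < 0"
    for x y a b :: "real ^ 2"
  proof (rule ccontr)
    assume "open_segment x y \<inter> open_segment a b \<noteq> {}"
    then obtain z where z: "z \<in> open_segment x y" "z \<in> open_segment a b" by blast
    obtain t where t: "0 < t" "t < 1" "z = (1 - t) *\<^sub>R a + t *\<^sub>R b" using z(2) by (auto simp: in_segment)
    have eq: "t * orient x y b + (1 - t) * orient x y a = 0" by (rule zero[OF t(3) z(1)])
    have pos: "0 < 1 - t" using t(2) by simp
    show False
      using that
    proof (elim disjE conjE)
      assume "0 < orient x y a" "0 \<le> orient x y b"
      then have "0 \<le> t * orient x y b" "0 < (1 - t) * orient x y a" using t(1) pos by simp_all
      then show False using eq by linarith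
    next
      assume "0 \<le> orient x y a" "0 < orient x y b"
      then have "0 < t * orient x y b" "0 \<le> (1 - t) * orient x y a" using t(1) pos by simp_all
      then show False using eq by linarith
    next
      assume "orient x y a < 0" "orient x y b \<le> 0"
      then have "t * orient x y b \<le> 0" "(1 - t) * orient x y a < 0"
        using t(1) pos by (simp_all add: mult_le_0_iff mult_less_0_iff)
      then show False using eq by linarith
    next
      assume "orient x y a \<le> 0" "orient x y b < 0"
      then have "t * orient x y b < 0" "(1 - t) * orient x y a \<le> 0"
        using t(1) pos by (simp_all add: mult_le_0_iff mult_less_0_iff)
      then show False using eq by linarith
    qed
  qed
  have outside: "0 \<le> orient (w p) (w q) (w r)" "r \<noteq> p \<Longrightarrow> r \<noteq> q \<Longrightarrow> 0 < orient (w p) (w q) (w r)"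
    if hyp: "r \<le> p \<or> q \<le> r" "p < q" "q \<le> n + 2" "r \<le> n + 2" for p q r
  proof -
    consider "r = p" | "r = q" | "r < p" | "q < r" using hyp(1) by linarith
    then have "0 \<le> orient (w p) (w q) (w r) \<and> (r \<noteq> p \<longrightarrow> r \<noteq> q \<longrightarrow> 0 < orient (w p) (w q) (w r))"
    proof cases
      case 3
      then show ?thesis using ccw[of r p q] hyp orient_rotate[of "w p" "w q" "w r"] by simp
    next
      case 4
      then show ?thesis using ccw[of p q r] hyp by simp
    qed auto
    then show "0 \<le> orient (w p) (w q) (w r)" "r \<noteq> p \<Longrightarrow> r \<noteq> q \<Longrightarrow> 0 < orient (w p) (w q) (w r)" by auto
  qed
  have inside: "orient (w p) (w q) (w r) \<le> 0" "p < r \<Longrightarrow> r < q \<Longrightarrow> orient (w p) (w q) (w r) < 0"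
    if hyp: "p \<le> r" "r \<le> q" "q \<le> n + 2" for p q r
  proof -
    consider "r = p" | "r = q" | "p < r" "r < q" using hyp by linarith
    then have "orient (w p) (w q) (w r) \<le> 0 \<and> (p < r \<longrightarrow> r < q \<longrightarrow> orient (w p) (w q) (w r) < 0)"
    proof cases
      case 3
      then show ?thesis using ccw[of p r q] hyp orient_swap(1)[of "w p" "w q" "w r"] by simp
    qed auto
    then show "orient (w p) (w q) (w r) \<le> 0" "p < r \<Longrightarrow> r < q \<Longrightarrow> orient (w p) (w q) (w r) < 0" by auto
  qed
  show ?thesis
  proof
    assume "open_segment (w p) (w q) \<inter> open_segment (w p') (w q') = {}"
    then show "\<not> interleaved (p, q) (p', q') \<and> \<not> interleaved (p', q') (p, q)"
      using meet[of p p' q q'] meet[of p' p q' q] assms by (auto simp: interleaved_def)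
  next
    assume "\<not> interleaved (p, q) (p', q') \<and> \<not> interleaved (p', q') (p, q)"
    then consider "(p' \<le> p \<or> q \<le> p') \<and> (q' \<le> p \<or> q \<le> q')"
      | "p \<le> p'" "q' \<le> q" | "p' \<le> p" "q \<le> q'"
      using assms(1,3) by (fastforce simp: interleaved_def)
    then show "open_segment (w p) (w q) \<inter> open_segment (w p') (w q') = {}"
    proof cases
      case 1
      have "(p' \<noteq> p \<and> p' \<noteq> q) \<or> (q' \<noteq> p \<and> q' \<noteq> q)" using assms by auto
      then show ?thesis
        using outside[of p' p q] outside[of q' p q] 1 assms by (intro same) auto
    next
      case 2
      have "(p < p' \<and> p' < q) \<or> (p < q' \<and> q' < q)" using assms 2 by auto
      then show ?thesis
        using inside[of p p' q] inside[of p q' q] 2 assms by (intro same) auto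
    next
      case 3
      have "(p' < p \<and> p < q') \<or> (p' < q \<and> q < q')" using assms 3 by auto
      then have "open_segment (w p') (w q') \<inter> open_segment (w p) (w q) = {}"
        using inside[of p' p q'] inside[of p' q q'] 3 assms by (intro same) auto
      then show ?thesis by blast
    qed
  qed
qed

text \<open>\<open>label_chord\<close> is injective and turns crossing into interleaving, so
  maximality carries over in both directions.\<close>

lemma triangulation_iff:
  "triangulation n P T \<longleftrightarrow> (\<exists>t\<in>trees (n + 2). T = label_chord ` (ivals 0 t \<inter> diagonals (n + 2)))"
proof -
  let ?D = "diagonals (n + 2)"
  have D_sub: "?D \<subseteq> {(p, q). p < q \<and> q \<le> n + 2}" by (auto simp: diagonals_def)
  have inj: "inj_on label_chord ?D"
    using label_chord_bij D_sub by (auto simp: bij_betw_def intro: inj_on_subset)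
  have int: "internal_diagonals n P = label_chord ` ?D"
  proof (intro antisym subsetI)
    fix d assume d: "d \<in> internal_diagonals n P"
    then have "d \<in> chords n" by (simp add: internal_diagonals_def)
    then have "d \<in> label_chord ` {(p, q). p < q \<and> q \<le> n + 2}" using label_chord_bij by (simp add: bij_betw_def)
    then obtain p q where "d = label_chord (p, q)" "p < q" "q \<le> n + 2" by auto
    then show "d \<in> label_chord ` ?D" using internal_iff[of p q] d by auto
  next
    fix d assume "d \<in> label_chord ` ?D"
    then obtain p q where "d = label_chord (p, q)" "(p, q) \<in> ?D" by auto
    then show "d \<in> internal_diagonals n P" using internal_iff[of p q] D_sub by auto
  qed
  have nc: "noncrossing P (label_chord ` C) \<longleftrightarrow> laminar C" if "C \<subseteq> ?D" for C
  proof -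
    have injC: "inj_on label_chord C" by (rule inj_on_subset[OF inj that])
    have "open_chord P (label_chord d) \<inter> open_chord P (label_chord e) = {} \<longleftrightarrow> \<not> interleaved d e \<and> \<not> interleaved e d"
      if "d \<in> C" "e \<in> C" "d \<noteq> e" for d e
    proof -
      obtain p q p' q' where "d = (p, q)" "e = (p', q')" by (cases d, cases e)
      moreover from this have "p < q" "q \<le> n + 2" "p' < q'" "q' \<le> n + 2"
        using that \<open>C \<subseteq> ?D\<close> D_sub by auto
      ultimately show ?thesis using chords_disjoint_iff[of p q p' q'] that by (simp add: label_chord_segments)
    qed
    moreover have "\<not> interleaved d d" for d by (simp add: interleaved_def)
    ultimately show ?thesis
      using inj_on_eq_iff[OF injC] unfolding noncrossing_def laminar_def pairwise_def by (auto; metis)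
  qed
  have sub: "label_chord ` A \<subseteq> label_chord ` B \<longleftrightarrow> A \<subseteq> B" if "A \<subseteq> ?D" "B \<subseteq> ?D" for A B
    using inj that by (meson inj_on_image_subset_iff)
  have eq: "label_chord ` A = label_chord ` B \<longleftrightarrow> A = B" if "A \<subseteq> ?D" "B \<subseteq> ?D" for A B
    using inj that by (meson inj_on_image_eq_iff)
  have "triangulation n P T \<longleftrightarrow> (\<exists>C. maximal_laminar (n + 2) C \<and> T = label_chord ` C)"
  proof
    assume t: "triangulation n P T"
    then have "T \<subseteq> label_chord ` ?D" by (simp add: triangulation_def int)
    then obtain C where C: "C \<subseteq> ?D" "T = label_chord ` C" by (meson subset_image_iff)
    have "C' = C" if "C \<subseteq> C'" "C' \<subseteq> ?D" "laminar C'" for C'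
    proof -
      have "T \<subseteq> label_chord ` C'" "label_chord ` C' \<subseteq> internal_diagonals n P" "noncrossing P (label_chord ` C')"
        using that C nc int by auto
      then have "label_chord ` C' = label_chord ` C" using t C(2) unfolding triangulation_def by blast
      then show "C' = C" using eq that C by blast
    qed
    then have "maximal_laminar (n + 2) C"
      using t C nc[OF C(1)] by (auto simp: maximal_laminar_def triangulation_def)
    then show "\<exists>C. maximal_laminar (n + 2) C \<and> T = label_chord ` C" using C by blast
  next
    assume "\<exists>C. maximal_laminar (n + 2) C \<and> T = label_chord ` C"
    then obtain C where C: "maximal_laminar (n + 2) C" "T = label_chord ` C" by blast
    then have CD: "C \<subseteq> ?D" "laminar C" "\<And>C'. C \<subseteq> C' \<Longrightarrow> C' \<subseteq> ?D \<Longrightarrow> laminar C' \<Longrightarrow> C' = C"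
      by (auto simp: maximal_laminar_def)
    show "triangulation n P T"
      unfolding triangulation_def
    proof (intro conjI allI impI)
      show "T \<subseteq> internal_diagonals n P" "noncrossing P T" using C(2) CD nc int by auto
      fix T' assume T': "T \<subseteq> T' \<and> T' \<subseteq> internal_diagonals n P \<and> noncrossing P T'"
      then obtain C' where C': "C' \<subseteq> ?D" "T' = label_chord ` C'" by (metis int subset_image_iff)
      have "C \<subseteq> C'" using sub[OF CD(1) C'(1)] T' C(2) C'(2) by simp
      moreover have "laminar C'" using nc[OF C'(1)] T' C'(2) by simp
      ultimately have "C' = C" using CD(3) C'(1) by blast
      then show "T' = T" using C' C by simp
    qed
  qed
  then show ?thesis using maximal_laminar_iff[of "n + 2"] by auto
qed

end

section \<open>The spine of a triangulation\<close>

lemma sorted_triple_unique: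
  fixes a b c a' b' c' :: nat
  assumes "a < b" "b < c" "a' < b'" "b' < c'" "{a, b, c} = {a', b', c'}"
  shows "a = a' \<and> b = b' \<and> c = c'"
proof -
  have "a = a' \<or> a = b' \<or> a = c'" "b = a' \<or> b = b' \<or> b = c'" "c = a' \<or> c = b' \<or> c = c'"
    using assms(5) by auto
  then show ?thesis using assms(1-4) by (elim disjE) simp_all
qed

context polygon_positions
begin

lemma l_inj: "p \<le> n + 2 \<Longrightarrow> q \<le> n + 2 \<Longrightarrow> l p = l q \<longleftrightarrow> p = q"
  using l_bij by (auto simp: bij_betw_def dest: inj_onD)

lemma label_chord_eq_iff:
  assumes "p < q" "q \<le> n + 2" "p' < q'" "q' \<le> n + 2"
  shows "label_chord (p, q) = label_chord (p', q') \<longleftrightarrow> (p, q) = (p', q')"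
  using label_chord_bij assms inj_onD[of label_chord _ "(p, q)" "(p', q')"] by (auto simp: bij_betw_def)

lemma boundary_edge_orient:
  assumes "(a, b) \<in> bottom_edges n P \<union> top_edges n P" "c \<le> n + 2" "c \<noteq> a" "c \<noteq> b"
  shows "(a, b) \<in> bottom_edges n P \<Longrightarrow> 0 < orient (vtx P a) (vtx P b) (vtx P c)"
    and "(a, b) \<in> top_edges n P \<Longrightarrow> orient (vtx P a) (vtx P b) (vtx P c) < 0"
proof -
  have "(a, b) \<in> label_chord ` {(p, q). p < q \<and> q \<le> n + 2}"
    using assms(1) label_chord_bij by (auto simp: bottom_edges_def top_edges_def bij_betw_def)
  then obtain p q where pq: "p < q" "q \<le> n + 2" "(a, b) = label_chord (p, q)" by auto
  have le: "a \<le> n + 2" "b \<le> n + 2" using pq l_le[of p] l_le[of q] by (auto simp: label_chord_def)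
  have c: "vtx P c \<in> vertices P" "vtx P c \<noteq> vtx P a" "vtx P c \<noteq> vtx P b"
    using vtx_rank(1)[OF assms(2)] vtx_neq[of c a] vtx_neq[of c b] assms le by auto
  have ab: "a = l p \<and> b = l q \<and> l p < l q \<or> a = l q \<and> b = l p \<and> l q < l p"
    using pq l_neq[OF pq(1,2)] by (auto simp: label_chord_def min_def max_def)
  have succ: "0 < orient (w p) (w q) (vtx P c)" if "q = Suc p"
    using polygon_edge.left[OF edge_succ[of p] c(1)] c ab that pq(2) by auto
  have closing: "0 < orient (w q) (w p) (vtx P c)" if "(p, q) = (0, n + 2)"
    using polygon_edge.left[OF edge_closing c(1)] c ab that by auto
  note s = orient_swap(2)[of "vtx P a" "vtx P b" "vtx P c"]
  show "0 < orient (vtx P a) (vtx P b) (vtx P c)" if "(a, b) \<in> bottom_edges n P"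
    using bottom_top_iff(1)[OF pq(1,2)] that pq(3) ab succ closing by auto
  show "orient (vtx P a) (vtx P b) (vtx P c) < 0" if "(a, b) \<in> top_edges n P"
    using bottom_top_iff(2)[OF pq(1,2)] that pq(3) ab succ closing s by auto
qed

definition label_tri :: "nat \<times> nat \<times> nat \<Rightarrow> triangle" where
  "label_tri = (\<lambda>(p, r, q). (min (l p) (min (l r) (l q)), l (mid l (p, r, q)), max (l p) (max (l r) (l q))))"

text \<open>The last property expresses in positions the two sides that meet at the median vertex,
  the pair that defines \<open>R(j)\<close>.\<close>

lemma label_tri_props:
  assumes "p < r" "r < q" "q \<le> n + 2" "label_tri (p, r, q) = (i, j, k)"
  shows "i < j" "j < k" "k \<le> n + 2" "{i, j, k} = {l p, l r, l q}" "j = l (mid l (p, r, q))"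
    "sides (i, j, k) = {label_chord (p, r), label_chord (r, q), label_chord (p, q)}"
    "{(i, j), (j, k)} = label_chord ` (if mid l (p, r, q) = r then {(p, r), (r, q)}
       else if mid l (p, r, q) = p then {(p, r), (p, q)} else {(r, q), (p, q)})"
proof -
  have le: "l p \<le> n + 2" "l r \<le> n + 2" "l q \<le> n + 2" using l_le assms by auto
  have "i < j \<and> j < k \<and> k \<le> n + 2 \<and> {i, j, k} = {l p, l r, l q} \<and> j = l (mid l (p, r, q)) \<and>
    sides (i, j, k) = {label_chord (p, r), label_chord (r, q), label_chord (p, q)} \<and>
    {(i, j), (j, k)} = label_chord ` (if mid l (p, r, q) = r then {(p, r), (r, q)}
       else if mid l (p, r, q) = p then {(p, r), (p, q)} else {(r, q), (p, q)})"
  proof (cases rule: mid_cases[OF assms(1-3)])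
    case 1
    from 1(2) show ?thesis
    proof
      assume o: "l p < l r \<and> l r < l q"
      then have "i = l p" "j = l r" "k = l q" using assms(4) 1(1) by (auto simp: label_tri_def)
      then show ?thesis using o 1(1) le by (auto simp: label_chord_def)
    next
      assume o: "l q < l r \<and> l r < l p"
      then have "i = l q" "j = l r" "k = l p" using assms(4) 1(1) by (auto simp: label_tri_def)
      then show ?thesis using o 1(1) le by (auto simp: label_chord_def)
    qed
  next
    case 2
    have pr: "p \<noteq> r" using assms by simp
    from 2(2) show ?thesis
    proof
      assume o: "l r < l p \<and> l p < l q"
      then have "i = l r" "j = l p" "k = l q" using assms(4) 2(1) by (auto simp: label_tri_def)
      then show ?thesis using o 2(1) le pr by (auto simp: label_chord_def)
    next
      assume o: "l q < l p \<and> l p < l r"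
      then have "i = l q" "j = l p" "k = l r" using assms(4) 2(1) by (auto simp: label_tri_def)
      then show ?thesis using o 2(1) le pr by (auto simp: label_chord_def)
    qed
  next
    case 3
    have pr: "q \<noteq> r" "q \<noteq> p" using assms by auto
    from 3(2) show ?thesis
    proof
      assume o: "l r < l q \<and> l q < l p"
      then have "i = l r" "j = l q" "k = l p" using assms(4) 3(1) by (auto simp: label_tri_def)
      then show ?thesis using o 3(1) le pr by (auto simp: label_chord_def)
    next
      assume o: "l p < l q \<and> l q < l r"
      then have "i = l p" "j = l q" "k = l r" using assms(4) 3(1) by (auto simp: label_tri_def)
      then show ?thesis using o 3(1) le pr by (auto simp: label_chord_def)
    qed
  qed
  then show "i < j" "j < k" "k \<le> n + 2" "{i, j, k} = {l p, l r, l q}" "j = l (mid l (p, r, q))"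
    "sides (i, j, k) = {label_chord (p, r), label_chord (r, q), label_chord (p, q)}"
    "{(i, j), (j, k)} = label_chord ` (if mid l (p, r, q) = r then {(p, r), (r, q)}
       else if mid l (p, r, q) = p then {(p, r), (p, q)} else {(r, q), (p, q)})" by blast+
qed

lemma label_tri_inj: "inj_on label_tri triples"
proof (rule inj_onI)
  fix D D' assume D: "D \<in> triples" "D' \<in> triples" "label_tri D = label_tri D'"
  obtain p r q p' r' q' where e: "D = (p, r, q)" "D' = (p', r', q')" by (cases D, cases D')
  have o: "p < r" "r < q" "q \<le> n + 2" "p' < r'" "r' < q'" "q' \<le> n + 2" using D unfolding e triples_def by auto
  obtain i j k where ijk: "label_tri (p, r, q) = (i, j, k)" by (cases "label_tri (p, r, q)")
  then have "{l p, l r, l q} = {l p', l r', l q'}"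
    using label_tri_props(4)[OF o(1-3) ijk] label_tri_props(4)[OF o(4-6), of i j k] D(3) e by simp
  then have "l ` {p, r, q} = l ` {p', r', q'}" by simp
  then have "{p, r, q} = {p', r', q'}"
    using inj_on_image_eq_iff[OF inj, of "{p, r, q}" "{p', r', q'}"] o by auto
  then show "D = D'" using sorted_triple_unique[OF o(1,2,4,5)] e by simp
qed

end

section \<open>The spine of the triangulation given by a tree\<close>

locale polygon_tree = polygon_positions +
  fixes t :: btree
  assumes leaves: "leaves t = n + 2"
begin

definition T :: "chord set" where
  "T = label_chord ` (ivals 0 t \<inter> diagonals (n + 2))"

abbreviation G :: "(triangle, chord) blossoming_graph" where
  "G \<equiv> spine n P T"

lemma ivals_le: "(x, y) \<in> ivals 0 t \<Longrightarrow> x < y \<and> y \<le> n + 2"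
  using ivals_bounds[of x y 0 t] leaves by auto

lemma tris_le: "(p, r, q) \<in> tris 0 t \<Longrightarrow> p < r \<and> r < q \<and> q \<le> n + 2"
  using tris_bounds[of p r q 0 t] leaves by auto

lemma tris_triples: "tris 0 t \<subseteq> triples"
  unfolding triples_def using tris_le by auto

text \<open>Boundary edges are numbered by their first position in counterclockwise order, with
  \<open>n + 2\<close> for the closing edge; sets of blossoms become sets of numbers.\<close>

definition boundary_edge :: "nat \<Rightarrow> chord" where
  "boundary_edge e = (if e = n + 2 then label_chord (0, n + 2) else label_chord (e, Suc e))"

lemma boundary_edge_inj: "inj_on boundary_edge {..n + 2}"
proof (rule inj_onI)
  fix e f assume ef: "e \<in> {..n + 2}" "f \<in> {..n + 2}" "boundary_edge e = boundary_edge f"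
  then show "e = f"
    using label_chord_eq_iff[of e "Suc e" f "Suc f"] label_chord_eq_iff[of 0 "n + 2" f "Suc f"]
      label_chord_eq_iff[of e "Suc e" 0 "n + 2"] n_pos
    by (cases "e = n + 2"; cases "f = n + 2") (auto simp: boundary_edge_def)
qed

lemma boundary_edges: "top_edges n P \<union> bottom_edges n P = boundary_edge ` {..n + 2}"
proof (intro antisym subsetI)
  fix d assume d: "d \<in> top_edges n P \<union> bottom_edges n P"
  then have "d \<in> label_chord ` {(p, q). p < q \<and> q \<le> n + 2}"
    using label_chord_bij by (auto simp: bottom_edges_def top_edges_def bij_betw_def)
  then obtain p q where pq: "p < q" "q \<le> n + 2" "d = label_chord (p, q)" by auto
  then have "q = Suc p \<or> (p, q) = (0, n + 2)" using bottom_top_iff[OF pq(1,2)] d by auto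
  then show "d \<in> boundary_edge ` {..n + 2}"
  proof
    assume "q = Suc p"
    then show ?thesis using pq by (intro image_eqI[of _ _ p]) (auto simp: boundary_edge_def)
  next
    assume "(p, q) = (0, n + 2)"
    then show ?thesis using pq by (intro image_eqI[of _ _ "n + 2"]) (auto simp: boundary_edge_def)
  qed
next
  fix d assume "d \<in> boundary_edge ` {..n + 2}"
  then obtain e where e: "e \<le> n + 2" "d = boundary_edge e" by auto
  show "d \<in> top_edges n P \<union> bottom_edges n P"
  proof (cases "e = n + 2")
    case True
    then show ?thesis
      using e bottom_top_iff[of 0 "n + 2"] l_neq[of 0 "n + 2"] by (auto simp: boundary_edge_def)
  next
    case False
    then show ?thesis
      using e bottom_top_iff[of e "Suc e"] l_neq[of e "Suc e"] by (auto simp: boundary_edge_def)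
  qed
qed

lemma all_edges: "T \<union> top_edges n P \<union> bottom_edges n P = label_chord ` ivals 0 t"
proof -
  have "boundary_edge ` {..n + 2} = label_chord ` ({(p, Suc p) | p. p < n + 2} \<union> {(0, n + 2)})"
  proof -
    have "{..n + 2} = insert (n + 2) {..<n + 2}" by auto
    then have "boundary_edge ` {..n + 2} = insert (boundary_edge (n + 2)) (boundary_edge ` {..<n + 2})"
      by (simp only: image_insert)
    moreover have "boundary_edge (n + 2) = label_chord (0, n + 2)" by (simp add: boundary_edge_def)
    moreover have "boundary_edge ` {..<n + 2} = label_chord ` {(p, Suc p) | p. p < n + 2}"
      by (auto simp: boundary_edge_def image_iff)
    ultimately show ?thesis by auto
  qed
  moreover have "ivals 0 t = (ivals 0 t \<inter> diagonals (n + 2)) \<union> ({(p, Suc p) | p. p < n + 2} \<union> {(0, n + 2)})"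
    using ivals_eq_diagonals[of t] unfolding leaves by (simp only: Un_assoc)
  then have "label_chord ` ivals 0 t = T \<union> label_chord ` ({(p, Suc p) | p. p < n + 2} \<union> {(0, n + 2)})"
    unfolding T_def image_Un[symmetric] by (rule arg_cong)
  ultimately show ?thesis using boundary_edges by (simp only: Un_assoc)
qed

lemma edge_in_ivals:
  assumes "p < q" "q \<le> n + 2"
  shows "label_chord (p, q) \<in> label_chord ` ivals 0 t \<longleftrightarrow> (p, q) \<in> ivals 0 t"
proof
  assume "label_chord (p, q) \<in> label_chord ` ivals 0 t"
  then obtain x y where xy: "(x, y) \<in> ivals 0 t" "label_chord (p, q) = label_chord (x, y)" by auto
  then show "(p, q) \<in> ivals 0 t" using label_chord_eq_iff[OF assms] ivals_le[OF xy(1)] by auto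
qed auto

lemma T_diagonal:
  assumes "p < q" "q \<le> n + 2"
  shows "label_chord (p, q) \<in> T \<longleftrightarrow> (p, q) \<in> ivals 0 t \<and> (p, q) \<in> diagonals (n + 2)"
proof
  assume "label_chord (p, q) \<in> T"
  then obtain x y where xy: "(x, y) \<in> ivals 0 t \<inter> diagonals (n + 2)" "label_chord (p, q) = label_chord (x, y)"
    by (auto simp: T_def)
  then show "(p, q) \<in> ivals 0 t \<and> (p, q) \<in> diagonals (n + 2)"
    using label_chord_eq_iff[OF assms] ivals_le[of x y] by auto
qed (auto simp: T_def)

text \<open>The definition lists corners by label, the tree by position; once the three positions
  are sorted, the side criterion of \<open>tris_ivals\<close> applies.\<close>

lemma triangles_eq: "triangles n P T = label_tri ` tris 0 t"
proof (intro antisym subsetI)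
  fix v assume "v \<in> label_tri ` tris 0 t"
  then obtain p r q where D: "(p, r, q) \<in> tris 0 t" "v = label_tri (p, r, q)" by auto
  obtain i j k where v: "label_tri (p, r, q) = (i, j, k)" by (cases "label_tri (p, r, q)")
  have o: "p < r" "r < q" "q \<le> n + 2" using tris_le[OF D(1)] by auto
  note props = label_tri_props[OF o v]
  have "sides (i, j, k) \<subseteq> label_chord ` ivals 0 t"
    unfolding props(6) using D(1) by (auto simp: tris_ivals)
  then show "v \<in> triangles n P T"
    using props(1-3) D(2) v by (simp add: triangles_def all_edges)
next
  fix v assume "v \<in> triangles n P T"
  then obtain i j k where v: "v = (i, j, k)" "i < j" "j < k" "k \<le> n + 2" "sides (i, j, k) \<subseteq> label_chord ` ivals 0 t"
    by (auto simp: triangles_def all_edges)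
  have "i \<in> l ` {..n + 2}" "j \<in> l ` {..n + 2}" "k \<in> l ` {..n + 2}"
    using l_bij v by (auto simp: bij_betw_def)
  then obtain a b c where abc: "a \<le> n + 2" "b \<le> n + 2" "c \<le> n + 2" "i = l a" "j = l b" "k = l c" by auto
  have ne: "a \<noteq> b" "b \<noteq> c" "a \<noteq> c" using v abc by auto
  have chord: "(min x y, max x y) \<in> ivals 0 t"
    if "(l x, l y) \<in> sides (i, j, k)" "x \<le> n + 2" "y \<le> n + 2" "l x < l y" for x y
  proof -
    have "x \<noteq> y" using that by auto
    then have "(l x, l y) = label_chord (min x y, max x y)" using that(4) by (auto simp: label_chord_def min_def max_def)
    moreover have "min x y < max x y" "max x y \<le> n + 2" using \<open>x \<noteq> y\<close> that by auto
    ultimately show ?thesis using that(1) v(5) edge_in_ivals[of "min x y" "max x y"] by (metis subsetD)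
  qed
  have ch: "(min a b, max a b) \<in> ivals 0 t" "(min b c, max b c) \<in> ivals 0 t" "(min a c, max a c) \<in> ivals 0 t"
    using chord[of a b] chord[of b c] chord[of a c] v abc by auto
  have ord: "\<exists>p r q. {p, r, q} = {a, b, c} \<and> p < r \<and> r < q \<and> q \<le> n + 2 \<and> (p, r, q) \<in> tris 0 t"
  proof -
    have *: "?thesis" if "p < r" "r < q" "{p, r, q} = {a, b, c}" "q \<le> n + 2"
      "(p, r) \<in> ivals 0 t" "(r, q) \<in> ivals 0 t" "(p, q) \<in> ivals 0 t" for p r q
      using that by (intro exI[of _ p] exI[of _ r] exI[of _ q]) (auto simp: tris_ivals)
    consider "a < b" "b < c" | "a < c" "c < b" | "b < a" "a < c" | "b < c" "c < a" | "c < a" "a < b" | "c < b" "b < a"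
      using ne by linarith
    then show ?thesis
    proof cases
      case 1 then show ?thesis using *[of a b c] ch abc by auto
    next
      case 2 then show ?thesis using *[of a c b] ch abc by (auto simp: insert_commute)
    next
      case 3 then show ?thesis using *[of b a c] ch abc by (auto simp: insert_commute)
    next
      case 4 then show ?thesis using *[of b c a] ch abc by (auto simp: insert_commute)
    next
      case 5 then show ?thesis using *[of c a b] ch abc by (auto simp: insert_commute)
    next
      case 6 then show ?thesis using *[of c b a] ch abc by (auto simp: insert_commute)
    qed
  qed
  then obtain p r q where D: "{p, r, q} = {a, b, c}" "p < r" "r < q" "q \<le> n + 2" "(p, r, q) \<in> tris 0 t" by blast
  obtain i' j' k' where v': "label_tri (p, r, q) = (i', j', k')" by (cases "label_tri (p, r, q)")
  note props = label_tri_props[OF D(2-4) v']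
  have "{l p, l r, l q} = l ` {p, r, q}" by simp
  then have "{i', j', k'} = {i, j, k}" unfolding props(4) D(1) using abc by simp
  then have "(i', j', k') = (i, j, k)" using sorted_triple_unique[OF props(1,2) v(2,3)] by simp
  then show "v \<in> label_tri ` tris 0 t" using D(5) v' v(1) by force
qed

text \<open>A side is incoming iff the third corner lies above its line. This sign for the two sides
  at \<open>j\<close> is opposite to that for the long side \<open>(i, k)\<close>, and for boundary
  edges it agrees with being a bottom edge.\<close>

lemma side_orient:
  assumes v: "(i, j, k) \<in> triangles n P T" and d: "d \<in> sides (i, j, k)"
  shows "d \<in> incoming G (i, j, k) \<longleftrightarrow> (d = (i, k) \<longleftrightarrow> up j)"
    and "d \<in> outgoing G (i, j, k) \<longleftrightarrow> (d = (i, k) \<longleftrightarrow> \<not> up j)"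
proof -
  have o: "i < j" "j < k" "k \<le> n + 2" and sub: "sides (i, j, k) \<subseteq> T \<union> top_edges n P \<union> bottom_edges n P"
    using v by (auto simp: triangles_def)
  let ?o = "orient (vtx P i) (vtx P j) (vtx P k)"
  have j: "if up j then ?o < 0 else 0 < ?o" by (rule orient_vtx[OF o])
  have less: "vtx P i $ 1 < vtx P j $ 1" "vtx P j $ 1 < vtx P k $ 1" "vtx P i $ 1 < vtx P k $ 1"
    using vtx_less o by auto
  obtain a b c where abc: "d = (a, b)" "{a, b, c} = {i, j, k}" "c \<noteq> a" "c \<noteq> b" "c \<le> n + 2"
    "vtx P a $ 1 < vtx P b $ 1"
    "0 < orient (vtx P a) (vtx P b) (vtx P c) \<longleftrightarrow> (d = (i, k) \<longleftrightarrow> up j)"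
    "orient (vtx P a) (vtx P b) (vtx P c) < 0 \<longleftrightarrow> (d = (i, k) \<longleftrightarrow> \<not> up j)"
  proof -
    consider "d = (i, j)" | "d = (j, k)" | "d = (i, k)" using d by auto
    then show thesis
    proof cases
      case 1
      then show thesis using that[of i j k] o less j by (auto split: if_splits)
    next
      case 2
      then show thesis using that[of j k i] o less j orient_rotate[of "vtx P j" "vtx P k" "vtx P i"]
        by (auto split: if_splits)
    next
      case 3
      then show thesis using that[of i k j] o less j orient_swap(1)[of "vtx P i" "vtx P k" "vtx P j"]
        by (auto split: if_splits)
    qed
  qed
  let ?O = "orient (vtx P a) (vtx P b) (vtx P c)"
  have corners: "corners (i, j, k) = {a, b, c}" using abc(2) by simp
  have above: "lies_above P (i, j, k) d \<longleftrightarrow> 0 \<le> ?O" and below: "lies_below P (i, j, k) d \<longleftrightarrow> ?O \<le> 0"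
    unfolding abc(1) lies_above.simps lies_below.simps corners orient_le_iff[OF abc(6)] by auto
  have bot: "0 < ?O" if "d \<in> bottom_edges n P" using boundary_edge_orient(1)[of a b c] that abc by auto
  have top: "?O < 0" if "d \<in> top_edges n P" using boundary_edge_orient(2)[of a b c] that abc by auto
  have nz: "?O \<noteq> 0" using abc(7,8) by auto
  have mem: "d \<in> T \<or> d \<in> top_edges n P \<or> d \<in> bottom_edges n P" using sub d by blast
  have "d \<in> incoming G (i, j, k) \<longleftrightarrow> 0 < ?O"
    using d mem bot top nz above unfolding spine_def by auto
  then show "d \<in> incoming G (i, j, k) \<longleftrightarrow> (d = (i, k) \<longleftrightarrow> up j)" using abc(7) by simp
  have "d \<in> outgoing G (i, j, k) \<longleftrightarrow> ?O < 0"
    using d mem bot top nz below unfolding spine_def by auto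
  then show "d \<in> outgoing G (i, j, k) \<longleftrightarrow> (d = (i, k) \<longleftrightarrow> \<not> up j)" using abc(8) by simp
qed

lemma spine_edges:
  assumes v: "(i, j, k) \<in> triangles n P T"
  shows "incoming G (i, j, k) = (if up j then {(i, k)} else {(i, j), (j, k)})"
    and "outgoing G (i, j, k) = (if up j then {(i, j), (j, k)} else {(i, k)})"
    and "incident G (i, j, k) = sides (i, j, k)"
proof -
  have o: "i < j" "j < k" using v by (auto simp: triangles_def)
  have sub: "incoming G (i, j, k) \<subseteq> sides (i, j, k)" "outgoing G (i, j, k) \<subseteq> sides (i, j, k)"
    by (auto simp: spine_def)
  have "incoming G (i, j, k) = {d \<in> sides (i, j, k). d = (i, k) \<longleftrightarrow> up j}"
    using sub(1) side_orient(1)[OF v] by blast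
  then show i: "incoming G (i, j, k) = (if up j then {(i, k)} else {(i, j), (j, k)})"
    by (cases "up j") (use o in auto)
  have "outgoing G (i, j, k) = {d \<in> sides (i, j, k). d = (i, k) \<longleftrightarrow> \<not> up j}"
    using sub(2) side_orient(2)[OF v] by blast
  then show o: "outgoing G (i, j, k) = (if up j then {(i, j), (j, k)} else {(i, k)})"
    by (cases "up j") (use o in auto)
  show "incident G (i, j, k) = sides (i, j, k)" unfolding incident_def i o by auto
qed

lemma incident_label_tri:
  assumes "(p, r, q) \<in> tris 0 t"
  shows "incident G (label_tri (p, r, q)) = label_chord ` {(p, r), (r, q), (p, q)}"
proof -
  obtain i j k where v: "label_tri (p, r, q) = (i, j, k)" by (cases "label_tri (p, r, q)")
  have "(i, j, k) \<in> triangles n P T" using assms v by (force simp: triangles_eq)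
  then show ?thesis
    unfolding v spine_edges(3)[OF \<open>(i, j, k) \<in> triangles n P T\<close>]
    using label_tri_props(6)[OF _ _ _ v] tris_le[OF assms] by simp
qed

text \<open>Beyond the long side \<open>(p, q)\<close> lies the rest of the boundary, including edge
  \<open>n + 2\<close>; beyond the other two sides lie the arcs that they close off in the
  tree.\<close>

definition arc_edges :: "nat \<times> nat \<times> nat \<Rightarrow> nat \<times> nat \<Rightarrow> nat set" where
  "arc_edges = (\<lambda>(p, r, q) (x, y). if (x, y) = (p, q) then {..n + 2} - {p..<q} else {x..<y})"

text \<open>\<open>blossoming_tree\<close> takes a function of labelled triangles and chords, so the
  inverse maps translate back to positions.\<close>

definition beyond :: "triangle \<Rightarrow> chord \<Rightarrow> chord set" where
  "beyond v d = boundary_edge ` arc_edges (the_inv_into (tris 0 t) label_tri v)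
     (the_inv_into {(p, q). p < q \<and> q \<le> n + 2} label_chord d)"

lemma beyond_eq:
  assumes "D \<in> tris 0 t" "x < y" "y \<le> n + 2"
  shows "beyond (label_tri D) (label_chord (x, y)) = boundary_edge ` arc_edges D (x, y)"
proof -
  have "inj_on label_tri (tris 0 t)" by (rule inj_on_subset[OF label_tri_inj tris_triples])
  moreover have "inj_on label_chord {(p, q). p < q \<and> q \<le> n + 2}" using label_chord_bij by (simp add: bij_betw_def)
  ultimately show ?thesis using assms by (simp add: beyond_def the_inv_into_f_f)
qed

lemma arc_edges_simps:
  assumes "p < r" "r < q"
  shows "arc_edges (p, r, q) (p, r) = {p..<r}" "arc_edges (p, r, q) (r, q) = {r..<q}"
    "arc_edges (p, r, q) (p, q) = {..n + 2} - {p..<q}"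
  using assms by (auto simp: arc_edges_def)

lemma G_simps:
  "nodes G = label_tri ` tris 0 t" "arcs G = T" "blossoms G = boundary_edge ` {..n + 2}"
  "node_label G (i, j, k) = j"
  using triangles_eq boundary_edges by (auto simp: spine_def)

lemma boundary_not_T: "boundary_edge ` {..n + 2} \<inter> T = {}"
proof -
  have "boundary_edge e \<notin> T" if "e \<le> n + 2" for e
    using that T_diagonal[of 0 "n + 2"] T_diagonal[of e "Suc e"] by (auto simp: boundary_edge_def diagonals_def)
  then show ?thesis by auto
qed

lemma boundary_image_Diff: "A \<subseteq> {..n + 2} \<Longrightarrow> boundary_edge ` ({..n + 2} - A) = boundary_edge ` {..n + 2} - boundary_edge ` A"
  using boundary_edge_inj by (intro inj_on_image_set_diff) auto

lemma incident_mem: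
  assumes "v \<in> nodes G" "d \<in> incident G v"
  obtains p r q x y where "(p, r, q) \<in> tris 0 t" "p < r" "r < q" "q \<le> n + 2" "v = label_tri (p, r, q)"
    "d = label_chord (x, y)" "(x, y) \<in> {(p, r), (r, q), (p, q)}" "(x, y) \<in> ivals 0 t" "x < y" "y \<le> n + 2"
    "beyond v d = boundary_edge ` arc_edges (p, r, q) (x, y)"
proof -
  obtain p r q where D: "(p, r, q) \<in> tris 0 t" "v = label_tri (p, r, q)" using assms(1) by (auto simp: G_simps)
  obtain x y where xy: "d = label_chord (x, y)" "(x, y) \<in> {(p, r), (r, q), (p, q)}"
    using assms(2) unfolding D(2) incident_label_tri[OF D(1)] by auto
  have "(x, y) \<in> ivals 0 t" using D(1) xy(2) by (auto simp: tris_ivals)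
  then show thesis using that[OF D(1) _ _ _ D(2) xy] tris_le[OF D(1)] ivals_le[of x y] beyond_eq[OF D(1), of x y] D(2) xy(1)
    by simp
qed

sublocale blossoming_tree G beyond
proof
  show "finite (blossoms G)" by (simp add: G_simps)
  show "blossoms G \<inter> arcs G = {}" using boundary_not_T by (simp add: G_simps)
next
  fix v assume v: "v \<in> nodes G"
  then obtain p r q where D: "(p, r, q) \<in> tris 0 t" "v = label_tri (p, r, q)" by (auto simp: G_simps)
  have o: "p < r" "r < q" "q \<le> n + 2" using tris_le[OF D(1)] by auto
  have inc: "incident G v = {label_chord (p, r), label_chord (r, q), label_chord (p, q)}"
    using incident_label_tri[OF D(1)] D(2) by simp
  have neq: "label_chord (p, r) \<noteq> label_chord (r, q)" "label_chord (p, r) \<noteq> label_chord (p, q)"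
    "label_chord (r, q) \<noteq> label_chord (p, q)"
    using label_chord_eq_iff o by auto
  have b: "beyond v (label_chord (p, r)) = boundary_edge ` {p..<r}"
    "beyond v (label_chord (r, q)) = boundary_edge ` {r..<q}"
    "beyond v (label_chord (p, q)) = boundary_edge ` ({..n + 2} - {p..<q})"
    unfolding D(2) using beyond_eq[OF D(1)] arc_edges_simps[OF o(1,2)] o by auto
  show "incident G v \<subseteq> arcs G \<union> blossoms G"
  proof -
    have "incident G v \<subseteq> label_chord ` ivals 0 t" unfolding inc using D(1) by (auto simp: tris_ivals)
    then show ?thesis using all_edges boundary_edges by (auto simp: G_simps)
  qed
  show "\<exists>d\<in>incident G v. d \<noteq> e \<and> d \<noteq> e'" for e e'
    unfolding inc using neq by auto
  have "{p..<r} \<union> {r..<q} \<union> ({..n + 2} - {p..<q}) = {..n + 2}" using o by auto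
  then have "boundary_edge ` {p..<r} \<union> boundary_edge ` {r..<q} \<union> boundary_edge ` ({..n + 2} - {p..<q}) =
      boundary_edge ` {..n + 2}" by (simp only: image_Un[symmetric])
  then show "(\<Union>e\<in>incident G v. beyond v e) = blossoms G"
    unfolding inc G_simps using b by auto
  have dj: "boundary_edge ` A \<inter> boundary_edge ` B = {}" if "A \<inter> B = {}" "A \<subseteq> {..n + 2}" "B \<subseteq> {..n + 2}" for A B
    using that inj_on_image_Int[OF boundary_edge_inj, of A B] by auto
  have djs: "beyond v (label_chord (p, r)) \<inter> beyond v (label_chord (r, q)) = {}"
    "beyond v (label_chord (p, r)) \<inter> beyond v (label_chord (p, q)) = {}"
    "beyond v (label_chord (r, q)) \<inter> beyond v (label_chord (p, q)) = {}"
    unfolding b using o by (intro dj; auto)+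
  show "beyond v e \<inter> beyond v e' = {}" if "e \<in> incident G v" "e' \<in> incident G v" "e \<noteq> e'" for e e'
    using that djs unfolding inc by (auto simp: Int_commute)
  show "beyond v e \<noteq> {}" if "e \<in> incident G v" for e
  proof -
    have "n + 2 \<in> {..n + 2} - {p..<q}" using o by auto
    then have "{..n + 2} - {p..<q} \<noteq> {}" by blast
    then have "beyond v (label_chord (p, q)) \<noteq> {}" unfolding b by simp
    moreover have "beyond v (label_chord (p, r)) \<noteq> {}" "beyond v (label_chord (r, q)) \<noteq> {}"
      unfolding b using o by auto
    ultimately show ?thesis using that unfolding inc by auto
  qed
next
  fix v u e assume v: "v \<in> nodes G" and u: "u \<in> nodes G" and ne: "v \<noteq> u"
    and e: "e \<in> incident G v" "e \<in> incident G u"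
  obtain p r q x y where D: "(p, r, q) \<in> tris 0 t" "p < r" "r < q" "q \<le> n + 2" "v = label_tri (p, r, q)"
    "e = label_chord (x, y)" "(x, y) \<in> {(p, r), (r, q), (p, q)}" "(x, y) \<in> ivals 0 t" "x < y" "y \<le> n + 2"
    "beyond v e = boundary_edge ` arc_edges (p, r, q) (x, y)"
    using v e(1) by (rule incident_mem)
  obtain p' r' q' x' y' where D': "(p', r', q') \<in> tris 0 t" "p' < r'" "r' < q'" "q' \<le> n + 2" "u = label_tri (p', r', q')"
    "e = label_chord (x', y')" "(x', y') \<in> {(p', r'), (r', q'), (p', q')}" "(x', y') \<in> ivals 0 t" "x' < y'" "y' \<le> n + 2"
    "beyond u e = boundary_edge ` arc_edges (p', r', q') (x', y')"
    using u e(2) by (rule incident_mem)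
  have xy: "x' = x" "y' = y" using label_chord_eq_iff[OF D(9,10) D'(9,10)] D(6) D'(6) by auto
  have Dne: "(p, r, q) \<noteq> (p', r', q')" using ne D(5) D'(5) by auto
  \<comment> \<open>By uniqueness of apex and parent, a chord shared by two triangles is the base of
    one and a child side of the other; the two sets are therefore complementary.\<close>
  have "arc_edges (p', r', q') (x, y) = {..n + 2} - arc_edges (p, r, q) (x, y) \<and> arc_edges (p, r, q) (x, y) \<subseteq> {..n + 2}"
  proof (cases "(x, y) = (p, q)")
    case True
    have "(x, y) \<noteq> (p', q')" using tris_apex_unique[of p r q 0 t r'] D(1) D'(1) Dne True by auto
    then have "(x, y) \<in> {(p', r'), (r', q')}" using D'(7) xy by auto
    then show ?thesis using True \<open>(x, y) \<noteq> (p', q')\<close> D(4,10) by (auto simp: arc_edges_def)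
  next
    case False
    then have c: "(x, y) \<in> {(p, r), (r, q)}" using D(7) by auto
    have "(x, y) = (p', q')"
    proof (rule ccontr)
      assume "(x, y) \<noteq> (p', q')"
      then have c': "(x, y) \<in> {(p', r'), (r', q')}" using D'(7) xy by auto
      then show False
        using c Dne D(1) D'(1) ivals_parent_unique(1)[of x y q 0 t q'] ivals_parent_unique(2)[of p x y 0 t p']
          ivals_parent_unique(3)[of x y q 0 t p'] ivals_parent_unique(3)[of x y q' 0 t p] by auto
    qed
    then show ?thesis using False D(4,10) by (auto simp: arc_edges_def)
  qed
  then show "beyond u e = blossoms G - beyond v e"
    unfolding D(11) D'(11) xy G_simps using boundary_image_Diff by simp
next
  fix v e assume v: "v \<in> nodes G" and e: "e \<in> arcs G" "e \<in> incident G v"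
  obtain p r q x y where D: "(p, r, q) \<in> tris 0 t" "p < r" "r < q" "q \<le> n + 2" "v = label_tri (p, r, q)"
    "e = label_chord (x, y)" "(x, y) \<in> {(p, r), (r, q), (p, q)}" "(x, y) \<in> ivals 0 t" "x < y" "y \<le> n + 2"
    "beyond v e = boundary_edge ` arc_edges (p, r, q) (x, y)"
    using v e(2) by (rule incident_mem)
  have d: "(x, y) \<in> diagonals (n + 2)" using T_diagonal[OF D(9,10)] e(1) D(6) by (simp add: G_simps)
  \<comment> \<open>A diagonal is neither the root nor a leaf of the tree, so it has a triangle on
    each side.\<close>
  have "\<exists>D'\<in>tris 0 t. D' \<noteq> (p, r, q) \<and> e \<in> incident G (label_tri D')"
  proof (cases "(x, y) = (p, q)")
    case True
    have "(x, y) \<noteq> (0, 0 + leaves t)" using d leaves by (auto simp: diagonals_def)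
    then consider z where "(x, y, z) \<in> tris 0 t" | z where "(z, x, y) \<in> tris 0 t"
      using ivals_parent[OF D(8)] by auto
    then show ?thesis
    proof cases
      case 1
      then show ?thesis using incident_label_tri[OF 1] D(6) True tris_le[OF 1] by (intro bexI[OF _ 1]) auto
    next
      case 2
      then show ?thesis using incident_label_tri[OF 2] D(6) True tris_le[OF 2] by (intro bexI[OF _ 2]) auto
    qed
  next
    case False
    obtain s where s: "(x, s, y) \<in> tris 0 t" using ivals_split[OF D(8)] d by (auto simp: diagonals_def)
    then show ?thesis using incident_label_tri[OF s] D(6) False by (intro bexI[OF _ s]) auto
  qed
  then obtain D' where D': "D' \<in> tris 0 t" "D' \<noteq> (p, r, q)" "e \<in> incident G (label_tri D')" by blast
  then have "label_tri D' \<noteq> v"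
    using inj_onD[OF label_tri_inj, of D' "(p, r, q)"] D(1,5) tris_triples by auto
  then show "\<exists>w\<in>nodes G. w \<noteq> v \<and> e \<in> incident G w" using D' by (auto simp: G_simps)
next
  fix v e assume v: "v \<in> nodes G" and e: "e \<in> blossoms G" "e \<in> incident G v"
  obtain p r q x y where D: "(p, r, q) \<in> tris 0 t" "p < r" "r < q" "q \<le> n + 2" "v = label_tri (p, r, q)"
    "e = label_chord (x, y)" "(x, y) \<in> {(p, r), (r, q), (p, q)}" "(x, y) \<in> ivals 0 t" "x < y" "y \<le> n + 2"
    "beyond v e = boundary_edge ` arc_edges (p, r, q) (x, y)"
    using v e(2) by (rule incident_mem)
  obtain f where f: "f \<le> n + 2" "e = boundary_edge f" using e(1) by (auto simp: G_simps)
  have "arc_edges (p, r, q) (x, y) = {f}"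
  proof (cases "f = n + 2")
    case True
    then have "(x, y) = (0, n + 2)"
      using label_chord_eq_iff[OF D(9,10), of 0 "n + 2"] D(6) f(2) by (simp add: boundary_edge_def)
    then show ?thesis using D(2-4,7) True by (auto simp: arc_edges_def)
  next
    case False
    then have "(x, y) = (f, Suc f)"
      using label_chord_eq_iff[OF D(9,10), of f "Suc f"] D(6) f by (simp add: boundary_edge_def)
    then show ?thesis using D(2-4,7) by (auto simp: arc_edges_def)
  qed
  then show "beyond v e = {e}" using D(11) f(2) by simp
qed

lemma card_beyond:
  assumes "D \<in> tris 0 t" "x < y" "y \<le> n + 2" "arc_edges D (x, y) \<subseteq> {..n + 2}"
  shows "card (beyond (label_tri D) (label_chord (x, y))) = card (arc_edges D (x, y))"
  unfolding beyond_eq[OF assms(1-3)] by (rule card_image) (rule inj_on_subset[OF boundary_edge_inj assms(4)])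

text \<open>Up or down, the relevant edges at the node are \<open>(i, j)\<close> and
  \<open>(j, k)\<close>, the two sides at the median vertex; \<open>card_paths_through\<close>
  multiplies the numbers of blossoms beyond them.\<close>

lemma card_R_paths:
  assumes D: "D \<in> tris 0 t" "l (mid l D) = j" and j: "j \<in> {1..n + 1}"
  shows "real (card (R_paths n P T j)) = mid_product (mid l D) D"
proof -
  obtain p r q where e: "D = (p, r, q)" by (cases D)
  have o: "p < r" "r < q" "q \<le> n + 2" using tris_le D(1) e by auto
  obtain i j' k where v: "label_tri (p, r, q) = (i, j', k)" by (cases "label_tri (p, r, q)")
  note props = label_tri_props[OF o v]
  have jj: "j' = j" using props(5) D(2) e by simp
  have vn: "(i, j, k) \<in> nodes G" using D(1) e v jj by (force simp: G_simps)
  then have vt: "(i, j, k) \<in> triangles n P T" by (simp add: spine_def)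
  \<comment> \<open>\<open>R_paths\<close> ranges over all nodes with label \<open>j\<close>;
    injectivity of \<open>mid\<close> leaves just one.\<close>
  have uniq: "u = (i, j, k)" if u: "u \<in> nodes G" "node_label G u = j" for u
  proof -
    obtain D' where D': "D' \<in> tris 0 t" "u = label_tri D'" using u(1) by (auto simp: G_simps)
    obtain p' r' q' where e': "D' = (p', r', q')" by (cases D')
    have o': "p' < r'" "r' < q'" "q' \<le> n + 2" using tris_le D'(1) e' by auto
    have "node_label G u = l (mid l D')" unfolding D'(2) e' by (simp add: spine_def label_tri_def)
    then have "l (mid l D') = l (mid l D)" using u(2) D(2) by simp
    moreover have "mid l D' \<le> n + 2" "mid l D \<le> n + 2" using o o' unfolding e e' by (auto simp: mid.simps)
    ultimately have "mid l D' = mid l D" using l_inj by simp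
    moreover have "inj_on (mid l) (tris 0 t)"
      using mid_bij_betw[of 0 t] leaves by (auto simp: bij_betw_def)
    ultimately have "D' = D" using D(1) D'(1) by (auto dest: inj_onD)
    then show ?thesis using D'(2) e v jj by simp
  qed
  let ?E = "{(i, j), (j, k)}"
  have ud: "j \<in> up_labels n P \<longleftrightarrow> up j" "j \<in> down_labels n P \<longleftrightarrow> \<not> up j" using up_down_labels j by auto
  have "R_paths n P T j = {(V, E) \<in> blossom_paths G. (i, j, k) \<in> V \<and> ?E \<subseteq> E}"
  proof (intro set_eqI iffI)
    fix x assume "x \<in> R_paths n P T j"
    then obtain V E u where x: "x = (V, E)" "(V, E) \<in> blossom_paths G" "u \<in> V" "node_label G u = j"
      "\<not> up j \<and> incoming G u \<subseteq> E \<or> up j \<and> outgoing G u \<subseteq> E"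
      unfolding R_paths_def Let_def ud by blast
    have "u \<in> nodes G" using x(2,3) by (auto simp: blossom_paths_def blossom_path_def)
    then have "u = (i, j, k)" using uniq x(4) by blast
    then show "x \<in> {(V, E) \<in> blossom_paths G. (i, j, k) \<in> V \<and> ?E \<subseteq> E}"
      using x spine_edges[OF vt] by (auto split: if_splits)
  next
    fix x assume "x \<in> {(V, E) \<in> blossom_paths G. (i, j, k) \<in> V \<and> ?E \<subseteq> E}"
    then obtain V E where x: "x = (V, E)" "(V, E) \<in> blossom_paths G" "(i, j, k) \<in> V" "?E \<subseteq> E" by blast
    have "\<not> up j \<and> incoming G (i, j, k) \<subseteq> E \<or> up j \<and> outgoing G (i, j, k) \<subseteq> E"
      using x(4) spine_edges[OF vt] by simp
    then show "x \<in> R_paths n P T j"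
      unfolding R_paths_def Let_def ud using x(1-3) G_simps(4)[of i j k] by blast
  qed
  moreover have "(i, j) \<in> incident G (i, j, k)" "(j, k) \<in> incident G (i, j, k)" "(i, j) \<noteq> (j, k)"
    using spine_edges(3)[OF vt] props(1) jj by auto
  ultimately have card: "card (R_paths n P T j) = card (beyond (i, j, k) (i, j)) * card (beyond (i, j, k) (j, k))"
    using card_paths_through[OF vn] by simp
  have two: "card (beyond (i, j, k) (i, j)) * card (beyond (i, j, k) (j, k)) = card (beyond (i, j, k) a) * card (beyond (i, j, k) b)"
    if "?E = {a, b}" for a b
    using that by (auto simp: doubleton_eq_iff mult.commute)
  have E: "?E = label_chord ` (if mid l (p, r, q) = r then {(p, r), (r, q)}
       else if mid l (p, r, q) = p then {(p, r), (p, q)} else {(r, q), (p, q)})"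
    using props(7) jj by simp
  have De: "(p, r, q) \<in> tris 0 t" using D(1) e by simp
  note arcs = arc_edges_simps[OF o(1,2)]
  have b: "card (beyond (i, j, k) (label_chord (p, r))) = r - p" "card (beyond (i, j, k) (label_chord (r, q))) = q - r"
    "card (beyond (i, j, k) (label_chord (p, q))) = n + 2 + 1 - (q - p)"
  proof -
    have v': "(i, j, k) = label_tri (p, r, q)" using v jj by simp
    show "card (beyond (i, j, k) (label_chord (p, r))) = r - p" "card (beyond (i, j, k) (label_chord (r, q))) = q - r"
      unfolding v' using card_beyond[OF De, of p r, unfolded arcs] card_beyond[OF De, of r q, unfolded arcs] o
      by (simp_all add: subset_iff)
    have "card ({..n + 2} - {p..<q}) = n + 2 + 1 - (q - p)" using o by (subst card_Diff_subset) auto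
    then show "card (beyond (i, j, k) (label_chord (p, q))) = n + 2 + 1 - (q - p)"
      unfolding v' using card_beyond[OF De, of p q, unfolded arcs] o by simp
  qed
  show ?thesis
  proof (cases rule: mid_cases[OF o])
    case 1
    then have E2: "?E = {label_chord (p, r), label_chord (r, q)}" using E by simp
    then show ?thesis unfolding card two[OF E2] b e 1(1) mid_product.simps by simp
  next
    case 2
    then have E2: "?E = {label_chord (p, r), label_chord (p, q)}" using E o by simp
    then show ?thesis unfolding card two[OF E2] b e 2(1) mid_product.simps using o by simp
  next
    case 3
    then have E2: "?E = {label_chord (r, q), label_chord (p, q)}" using E o by simp
    then show ?thesis unfolding card two[OF E2] b e 3(1) mid_product.simps using o by simp
  qed
qed

lemma spine_coord_tree:
  assumes "v \<in> arc_inner l (0, n + 2)"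
  shows "spine_coord n P T (l v) = tree_coord t v"
proof -
  have v: "v \<le> n + 2" using assms by (auto simp: arc_inner_def)
  have j: "l v \<in> {1..n + 1}"
  proof -
    obtain x y where "x \<le> n + 2" "y \<le> n + 2" "l x < l v" "l v < l y" using assms by (auto simp: arc_inner_def)
    then show ?thesis using l_le[of y] by auto
  qed
  have bij: "bij_betw (mid l) (tris 0 t) (arc_inner l (0, n + 2))"
    using mid_bij_betw[of 0 t] leaves by simp
  then have "v \<in> mid l ` tris 0 t" using assms by (simp add: bij_betw_def)
  then obtain D where D: "D \<in> tris 0 t" "mid l D = v" by auto
  have "D' = D" if "D' \<in> tris 0 t" "mid l D' = v" for D'
    using inj_onD[OF bij_betw_imp_inj_on[OF bij], of D' D] that D by simp
  then have "{D. D \<in> tris 0 t \<and> mid l D = v} = {D}" using D by blast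
  then have "tree_coord t v = tri_val l (n + 2) D" unfolding tree_coord_def by simp
  also have "\<dots> = (if v \<le> M then mid_product v D else real (n + 2) - mid_product v D)"
    using tri_val_mid_product[of D v] D tris_triples by blast
  also have "\<dots> = spine_coord n P T (l v)"
    using card_R_paths[OF D(1) refl] D(2) j up_iff[OF v] up_down_labels(2)
    by (simp add: spine_coord_def not_le[symmetric])
  finally show ?thesis by simp
qed

end

section \<open>Vertex barycenters\<close>

text \<open>A strict minimiser of a functional over \<open>F\<close> lies outside the hull of the
  other points, hence is extreme.\<close>

lemma vertices_convex_hull_exposed:
  fixes F :: "'a::euclidean_space set"
  assumes "finite F" "\<And>x. x \<in> F \<Longrightarrow> \<exists>c. \<forall>y\<in>F - {x}. c \<bullet> x < c \<bullet> y"
  shows "vertices (convex hull F) = F"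
proof
  show "vertices (convex hull F) \<subseteq> F"
    unfolding vertices_def using extreme_point_of_convex_hull by blast
  show "F \<subseteq> vertices (convex hull F)"
  proof
    fix x assume x: "x \<in> F"
    obtain c where c: "\<And>y. y \<in> F - {x} \<Longrightarrow> c \<bullet> x < c \<bullet> y" using assms(2)[OF x] by blast
    have "convex hull (F - {x}) \<subseteq> {y. c \<bullet> y > c \<bullet> x}"
      by (rule hull_minimal) (use c convex_halfspace_gt in auto)
    then have "x \<notin> convex hull (F - {x})" by auto
    then have "x extreme_point_of (convex hull (insert x (F - {x})))"
      using assms(1) by (intro extreme_point_of_convex_hull_insert) auto
    then show "x \<in> vertices (convex hull F)" using x by (simp add: vertices_def insert_absorb)
  qed
qed

text \<open>All points have the same norm, so the functional \<open>- x\<close> is strictly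
  minimised at \<open>x\<close> because squared distances are positive; hence every permutation
  point is a vertex.\<close>

lemma vertex_barycenter_permutahedron:
  fixes lab :: "'n::finite \<Rightarrow> nat"
  assumes lab: "bij_betw lab (UNIV :: 'n set) {1..n+1}"
  shows "vertex_barycenter (permutahedron n lab) = (\<chi> i. (real n + 2) / 2)"
proof -
  let ?x = "\<lambda>\<sigma>. point lab (\<lambda>j. real (\<sigma> j))"
  define F where "F = {?x \<sigma> | \<sigma>. \<sigma> permutes {1..n+1}}"
  have F_image: "F = ?x ` {\<sigma>. \<sigma> permutes {1..n+1}}" by (auto simp: F_def)
  have fin: "finite F" unfolding F_image by (intro finite_imageI finite_permutations) simp
  have "?x id \<in> F" unfolding F_def by (auto intro!: exI[of _ id] permutes_id)
  then have ne: "card F > 0" using fin card_gt_0_iff by blast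
  define S where "S = (\<Sum>j\<in>{1..n+1}. (real j)\<^sup>2)"
  have norm: "x \<bullet> x = S" if xF: "x \<in> F" for x
  proof -
    obtain \<sigma> where s: "\<sigma> permutes {1..n+1}" "x = ?x \<sigma>" using xF unfolding F_def by blast
    have "x \<bullet> x = (\<Sum>i\<in>UNIV. (real (\<sigma> (lab i)))\<^sup>2)"
      unfolding s(2) by (simp add: inner_vec_def point_def power2_eq_square)
    also have "\<dots> = (\<Sum>j\<in>{1..n+1}. (real (\<sigma> j))\<^sup>2)"
      by (rule sum.reindex_bij_betw[OF lab])
    also have "\<dots> = S"
      unfolding S_def by (rule sum.reindex_bij_betw[OF permutes_imp_bij[OF s(1)]])
    finally show ?thesis .
  qed
  have V: "vertices (permutahedron n lab) = F"
    unfolding permutahedron_def F_def[symmetric]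
  proof (rule vertices_convex_hull_exposed[OF fin])
    fix x assume x: "x \<in> F"
    have "(- x) \<bullet> x < (- x) \<bullet> y" if "y \<in> F - {x}" for y
    proof -
      have "0 < (x - y) \<bullet> (x - y)" using that by auto
      also have "(x - y) \<bullet> (x - y) = 2 * S - 2 * (x \<bullet> y)"
        using norm[OF x] norm[of y] that by (simp add: inner_diff inner_commute)
      finally show ?thesis using norm[OF x] by simp
    qed
    then show "\<exists>c. \<forall>y\<in>F - {x}. c \<bullet> x < c \<bullet> y" by blast
  qed
  let ?c = "(\<chi> i. real n + 2) :: real ^ 'n"
  have refl: "?c - x \<in> F" if xF: "x \<in> F" for x
  proof -
    obtain \<sigma> where s: "\<sigma> permutes {1..n+1}" "x = ?x \<sigma>" using xF unfolding F_def by blast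
    \<comment> \<open>The reflection of \<open>{1..n+1}\<close>, extended by the identity as
      \<open>permutes\<close> requires.\<close>
    define \<rho> where "\<rho> = (\<lambda>j. if j \<in> {1..n+1} then n + 2 - j else j)"
    have "\<rho> permutes {1..n+1}"
      by (rule bij_imp_permutes, rule bij_betw_byWitness[where f' = \<rho>]) (auto simp: \<rho>_def)
    then have "\<rho> \<circ> \<sigma> permutes {1..n+1}" using s(1) by (rule permutes_compose[rotated])
    moreover have "?c - x = ?x (\<rho> \<circ> \<sigma>)"
    proof (rule vec_eq_iff[THEN iffD2, rule_format])
      fix i
      have "lab i \<in> {1..n+1}" using lab by (auto simp: bij_betw_def)
      then have "\<sigma> (lab i) \<in> {1..n+1}" using permutes_in_image[OF s(1)] by blast
      then show "(?c - x) $ i = ?x (\<rho> \<circ> \<sigma>) $ i" by (auto simp: s(2) point_def \<rho>_def of_nat_diff)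
    qed
    ultimately show ?thesis unfolding F_def by blast
  qed
  have "(\<Sum>x\<in>F. x) = (\<Sum>x\<in>F. ?c - x)"
    by (rule sum.reindex_bij_witness[of _ "\<lambda>x. ?c - x" "\<lambda>x. ?c - x"]) (use refl in auto)
  also have "\<dots> = real (card F) *\<^sub>R ?c - (\<Sum>x\<in>F. x)"
    by (simp add: sum_subtractf scaleR_conv_of_real sum_constant_scaleR)
  finally have "2 *\<^sub>R (\<Sum>x\<in>F. x) = real (card F) *\<^sub>R ?c" by (simp add: scaleR_2)
  then have "2 * (\<Sum>x\<in>F. x) $ i = real (card F) * (real n + 2)" for i
    by (metis vector_scaleR_component real_scaleR_def vec_lambda_beta)
  then have "(\<Sum>x\<in>F. x) $ i = real (card F) * ((real n + 2) / 2)" for i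
    by (simp add: field_simps)
  then show ?thesis
    unfolding vertex_barycenter_def V using ne by (simp add: vec_eq_iff)
qed

section \<open>The vertices of the associahedron and their average\<close>

context polygon_positions
begin

lemma arc_inner_full: "arc_inner l (0, n + 2) = {v. v \<le> n + 2 \<and> l v \<in> {1..n+1}}"
proof -
  have "0 \<in> l ` {..n + 2}" "n + 2 \<in> l ` {..n + 2}" using l_bij by (auto simp: bij_betw_def)
  then obtain a b where ab: "a \<le> n + 2" "l a = 0" "b \<le> n + 2" "l b = n + 2" by (metis atMost_iff imageE)
  show ?thesis
  proof (intro antisym subsetI)
    fix v assume "v \<in> arc_inner l (0, n + 2)"
    then obtain x y where "v \<le> n + 2" "y \<le> n + 2" "l x < l v" "l v < l y" by (auto simp: arc_inner_def)
    then show "v \<in> {v. v \<le> n + 2 \<and> l v \<in> {1..n+1}}" using l_le[of y] by auto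
  next
    fix v assume "v \<in> {v. v \<le> n + 2 \<and> l v \<in> {1..n+1}}"
    then show "v \<in> arc_inner l (0, n + 2)" using ab by (intro arc_innerI[of 0 v "n + 2" a b]) auto
  qed
qed

lemma tree_weight_coord:
  assumes "leaves t = n + 2"
  shows "tree_weight \<tau> t = (\<Sum>v\<in>arc_inner l (0, n + 2). \<tau> v * tree_coord t v)"
proof -
  have sub: "mid l ` tris 0 t \<subseteq> arc_inner l (0, n + 2)"
    using mid_bij_betw[of 0 t] assms by (auto simp: bij_betw_def)
  have fin: "finite (arc_inner l (0, n + 2))" by (simp add: arc_inner_def)
  have "tree_weight \<tau> t = (\<Sum>v\<in>arc_inner l (0, n + 2). \<Sum>D | D \<in> tris 0 t \<and> mid l D = v. \<tau> (mid l D) * tri_val l (n + 2) D)"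
    unfolding tree_weight_def using sum.group[OF finite_tris fin sub, of "\<lambda>D. \<tau> (mid l D) * tri_val l (n + 2) D"] by simp
  also have "\<dots> = (\<Sum>v\<in>arc_inner l (0, n + 2). \<tau> v * tree_coord t v)"
    unfolding tree_coord_def sum_distrib_left by (intro sum.cong refl) auto
  finally show ?thesis .
qed

lemma vertex_barycenter_associahedron:
  fixes lab :: "'n::finite \<Rightarrow> nat"
  assumes lab: "bij_betw lab (UNIV :: 'n set) {1..n+1}"
  shows "vertex_barycenter (associahedron n P lab) = (\<chi> i. (real n + 2) / 2)"
proof -
  let ?I = "arc_inner l (0, n + 2)"
  have "l ` ?I = {1..n+1}"
  proof
    show "l ` ?I \<subseteq> {1..n+1}" by (auto simp only: arc_inner_full)
    show "{1..n+1} \<subseteq> l ` ?I"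
    proof
      fix j assume j: "j \<in> {1..n+1}"
      then have "j \<in> l ` {..n + 2}" using l_bij by (auto simp: bij_betw_def)
      then obtain v where "v \<le> n + 2" "j = l v" by auto
      then show "j \<in> l ` ?I" using j unfolding arc_inner_full by blast
    qed
  qed
  moreover have "inj_on l ?I" unfolding arc_inner_full by (rule inj_on_subset[OF inj]) auto
  ultimately have lI: "bij_betw l ?I {1..n+1}" by (simp add: bij_betw_def)
  \<comment> \<open>Index \<open>i\<close> is matched with the position whose label is
    \<open>lab i\<close>, so that vectors are indexed by inner positions.\<close>
  define pos where "pos = the_inv_into ?I l \<circ> lab"
  have pos: "bij_betw pos (UNIV :: 'n set) ?I"
    unfolding pos_def by (rule bij_betw_trans[OF lab bij_betw_the_inv_into[OF lI]])
  have l_pos: "l (pos i) = lab i" for i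
    using f_the_inv_into_f_bij_betw[OF lI, of "lab i"] bij_betwE[OF lab] by (simp add: pos_def)
  define X :: "btree \<Rightarrow> real ^ 'n" where "X t = (\<chi> i. tree_coord t (pos i))" for t
  have point: "point lab (spine_coord n P (label_chord ` (ivals 0 t \<inter> diagonals (n + 2)))) = X t"
    if "t \<in> trees (n + 2)" for t
  proof -
    interpret polygon_tree n P l M t by unfold_locales (use that in \<open>simp add: trees_def\<close>)
    have "pos i \<in> ?I" for i using pos by (auto simp: bij_betw_def)
    then have "spine_coord n P T (lab i) = tree_coord t (pos i)" for i
      using spine_coord_tree[of "pos i"] l_pos by simp
    then show ?thesis by (simp add: X_def point_def T_def vec_eq_iff)
  qed
  have set_eq: "{point lab (spine_coord n P T) | T. triangulation n P T} = X ` trees (n + 2)"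
  proof (intro antisym subsetI)
    fix x assume "x \<in> {point lab (spine_coord n P T) | T. triangulation n P T}"
    then obtain T where "triangulation n P T" "x = point lab (spine_coord n P T)" by blast
    then show "x \<in> X ` trees (n + 2)" using point unfolding triangulation_iff by blast
  next
    fix x assume "x \<in> X ` trees (n + 2)"
    then obtain t where t: "t \<in> trees (n + 2)" "x = X t" by blast
    let ?T = "label_chord ` (ivals 0 t \<inter> diagonals (n + 2))"
    have "triangulation n P ?T" unfolding triangulation_iff using t(1) by (intro bexI[of _ t]) auto
    moreover have "x = point lab (spine_coord n P ?T)" using point[OF t(1)] t(2) by simp
    ultimately show "x \<in> {point lab (spine_coord n P T) | T. triangulation n P T}" by blast
  qed
  have weight: "(\<chi> i. \<tau> (pos i)) \<bullet> X t = tree_weight \<tau> t" if "t \<in> trees (n + 2)" for \<tau> t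
  proof -
    have "(\<chi> i. \<tau> (pos i)) \<bullet> X t = (\<Sum>i\<in>UNIV. \<tau> (pos i) * tree_coord t (pos i))"
      by (simp add: inner_vec_def X_def)
    also have "\<dots> = (\<Sum>v\<in>?I. \<tau> v * tree_coord t v)"
      by (rule sum.reindex_bij_betw[OF pos])
    finally show ?thesis using tree_weight_coord that by (simp add: trees_def)
  qed
  have sep: "\<exists>c. \<forall>u\<in>trees (n + 2) - {t}. c \<bullet> X t < c \<bullet> X u" if t: "t \<in> trees (n + 2)" for t
  proof -
    let ?\<tau> = "\<lambda>v. \<Sum>e\<in>ivals 0 t. arc_sign e v"
    have "(\<chi> i. ?\<tau> (pos i)) \<bullet> X t < (\<chi> i. ?\<tau> (pos i)) \<bullet> X u" if u: "u \<in> trees (n + 2) - {t}" for u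
    proof -
      have "u \<in> trees (n + 2)" "u \<noteq> t" using u by auto
      then show ?thesis
        using tree_weight_unique_min[of t u] t unfolding weight[OF t, of ?\<tau>] weight[OF \<open>u \<in> trees (n + 2)\<close>, of ?\<tau>]
        by (simp add: trees_def)
    qed
    then show ?thesis by blast
  qed
  \<comment> \<open>A strict minimum at \<open>X t\<close> also excludes coincidences, so the sum
    over vertices is a sum over trees.\<close>
  have injX: "inj_on X (trees (n + 2))"
  proof (rule inj_onI, rule ccontr)
    fix t u assume "t \<in> trees (n + 2)" "u \<in> trees (n + 2)" "X t = X u" "t \<noteq> u"
    then show False using sep[of t] by force
  qed
  have V: "vertices (associahedron n P lab) = X ` trees (n + 2)"
    unfolding associahedron_def set_eq
  proof (rule vertices_convex_hull_exposed)
    fix x assume "x \<in> X ` trees (n + 2)"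
    then obtain t where t: "t \<in> trees (n + 2)" "x = X t" by blast
    then show "\<exists>c. \<forall>y\<in>X ` trees (n + 2) - {x}. c \<bullet> x < c \<bullet> y" using sep[OF t(1)] by blast
  qed simp
  have "(\<Sum>x\<in>X ` trees (n + 2). x) = (\<Sum>t\<in>trees (n + 2). X t)"
    using sum.reindex[OF injX, of "\<lambda>x. x"] by simp
  moreover have "(\<Sum>t\<in>trees (n + 2). X t) $ i = real (n + 2) / 2 * num_trees (n + 2)" for i
  proof -
    have "pos i \<in> ?I" using pos by (auto simp: bij_betw_def)
    then show ?thesis using sum_tree_coord[of "pos i"] by (simp add: X_def)
  qed
  moreover have "real (card (X ` trees (n + 2))) = num_trees (n + 2)"
    using card_image[OF injX] by (simp add: num_trees_def)
  ultimately show ?thesis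
    unfolding vertex_barycenter_def V using num_trees_pos[of "n + 2"] by (simp add: vec_eq_iff)
qed

end

theorem theorem28:
  fixes n :: nat and P :: "(real ^ 2) set" and lab :: "'n::finite \<Rightarrow> nat"
  assumes "n \<ge> 1"
    and "polytope P" and "card (vertices P) = n + 3"
    and "inj_on (\<lambda>v. v $ 1) (vertices P)"
    and "bij_betw lab (UNIV :: 'n set) {1..n+1}"
  shows "vertex_barycenter (associahedron n P lab) = vertex_barycenter (permutahedron n lab)"
proof -
  interpret generic_polygon n P using assms(1-4) by unfold_locales
  let ?U = "{j. j \<le> n + 2 \<and> up j}"
  have "?U \<subseteq> {..n + 2}" "0 \<notin> ?U" using not_up_ends by auto
  then obtain l M where l: "bij_betw l {..n + 2} {..n + 2}" "unimodal_labels l (n + 2) M"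
    "\<And>p. p \<le> n + 2 \<Longrightarrow> p \<le> M \<longleftrightarrow> l p \<notin> ?U"
    by (rule unimodal_labels_exist[of ?U "n + 2"]) (rule that)
  interpret L: unimodal_labels l "n + 2" M by (rule l(2))
  interpret polygon_positions n P l M
  proof
    show "bij_betw l {..n + 2} {..n + 2}" by (rule l(1))
    show "up (l p) \<longleftrightarrow> M < p" if "p \<le> n + 2" for p
      using l(3)[OF that] bij_betwE[OF l(1)] that by auto
  qed
  show ?thesis
    using vertex_barycenter_associahedron[OF assms(5)] vertex_barycenter_permutahedron[OF assms(5)] by simp
qed

end
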